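(* Let $\mathcal{E}$ be an extensive category with pullbacks and suppose that the $2$-category $\mathbf{Cat}(\mathcal{E})$ has coequalisers of parallel pairs of internal functors that agree on objects. If these coequalisers are stable under pullback along discrete Conduché fibrations, then $\mathcal{E}$ has pullback-stable coequalisers.
   Context: A category is extensive if it has finite coproducts and, for all $A,B$, the canonical functor $\mathcal{E}/A \times \mathcal{E}/B \to \mathcal{E}/(A+B)$ is an equivalence. A category $\mathcal{E}$ with pullbacks has pullback-stable coequalisers if it has coequalisers and for every $f: X \to Y$ in $\mathcal{E}$ the pullback functor $f^{*}: \mathcal{E}/Y \to \mathcal{E}/X$ preserves coequalisers. $\mathbf{Cat}(\mathcal{E})$ is the $2$-category of internal categories, internal functors and internal natural transformations in $\mathcal{E}$. An internal category $\mathbb{A}$ has object of objects $A_0$, object of morphisms $A_1$ and object of composable pairs $A_2$ with composition $m:A_2\to A_1$; an internal functor $F$ has components $F_0,F_1$ and induced map $F_2$. Internal functors $F,G$ agree on objects if $F_0=G_0$. An internal functor $F:\mathbb{X}\to\mathbb{Y}$ is a discrete Conduché fibration if the commutative square $m\circ F_2=F_1\circ m$ is a pullback. Stability under pullback along discrete Conduché fibrations means: if $F,G:\mathbb{A}\rightrightarrows\mathbb{B}$ is a parallel pair in $\mathbf{Cat}(\mathcal{E})/\mathbb{Y}$ with $F_0=G_0$ and coequaliser $Q$, and $f:\mathbb{X}\to\mathbb{Y}$ is a discrete Conduché fibration, then $f^*(Q)$ is the coequaliser of $f^*(F)$ and $f^*(G)$.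
   Formalization: The category E is additionally assumed to have a terminal object; without one the claim fails, e.g. for free Z/2-sets, where the identity and the nontrivial translation of Z/2 have no coequaliser. *)

theory Defs
  imports Main
begin

section \<open>Categories and functors\<close>

record ('o, 'm) cat =
  Obj :: "'o set"
  Arr :: "'m set"
  Dom :: "'m \<Rightarrow> 'o"
  Cod :: "'m \<Rightarrow> 'o"
  Ident :: "'o \<Rightarrow> 'm"
  Comp :: "'m \<Rightarrow> 'm \<Rightarrow> 'm" (infixl "\<cdot>\<index>" 70)

definition hom :: "('o, 'm, 'z) cat_scheme \<Rightarrow> 'o \<Rightarrow> 'o \<Rightarrow> 'm set" where
  "hom C a b = {f \<in> Arr C. Dom C f = a \<and> Cod C f = b}"

locale category =
  fixes C :: "('o, 'm, 'z) cat_scheme" (structure)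
  assumes Dom_in_Obj: "f \<in> Arr C \<Longrightarrow> Dom C f \<in> Obj C"
    and Cod_in_Obj: "f \<in> Arr C \<Longrightarrow> Cod C f \<in> Obj C"
    and Ident_in_hom: "a \<in> Obj C \<Longrightarrow> Ident C a \<in> hom C a a"
    and Comp_in_hom: "f \<in> hom C a b \<Longrightarrow> g \<in> hom C b c \<Longrightarrow> g \<cdot> f \<in> hom C a c"
    and Comp_Ident: "f \<in> hom C a b \<Longrightarrow> f \<cdot> Ident C a = f"
    and Ident_Comp: "f \<in> hom C a b \<Longrightarrow> Ident C b \<cdot> f = f"
    and Comp_assoc: "f \<in> hom C a b \<Longrightarrow> g \<in> hom C b c \<Longrightarrow> h \<in> hom C c d \<Longrightarrow>
      (h \<cdot> g) \<cdot> f = h \<cdot> (g \<cdot> f)"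

definition iso :: "('o, 'm, 'z) cat_scheme \<Rightarrow> 'm \<Rightarrow> bool" where
  "iso C f \<longleftrightarrow> f \<in> Arr C \<and>
     (\<exists>g \<in> hom C (Cod C f) (Dom C f).
        g \<cdot>\<^bsub>C\<^esub> f = Ident C (Dom C f) \<and> f \<cdot>\<^bsub>C\<^esub> g = Ident C (Cod C f))"

definition parallel :: "('o, 'm, 'z) cat_scheme \<Rightarrow> 'm \<Rightarrow> 'm \<Rightarrow> bool" where
  "parallel C f g \<longleftrightarrow> f \<in> Arr C \<and> g \<in> Arr C \<and> Dom C f = Dom C g \<and> Cod C f = Cod C g"

record ('o, 'm, 'p, 'n) cfun =
  FObj :: "'o \<Rightarrow> 'p"
  FArr :: "'m \<Rightarrow> 'n"

definition is_functor ::
  "('o, 'm, 'y) cat_scheme \<Rightarrow> ('p, 'n, 'z) cat_scheme \<Rightarrow> ('o, 'm, 'p, 'n) cfun \<Rightarrow> bool" where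
  "is_functor C D F \<longleftrightarrow>
     (\<forall>a \<in> Obj C. FObj F a \<in> Obj D) \<and>
     (\<forall>f \<in> Arr C. FArr F f \<in> hom D (FObj F (Dom C f)) (FObj F (Cod C f))) \<and>
     (\<forall>a \<in> Obj C. FArr F (Ident C a) = Ident D (FObj F a)) \<and>
     (\<forall>f \<in> Arr C. \<forall>g \<in> Arr C. Cod C f = Dom C g \<longrightarrow>
        FArr F (g \<cdot>\<^bsub>C\<^esub> f) = FArr F g \<cdot>\<^bsub>D\<^esub> FArr F f)"

definition id_functor :: "('o, 'm, 'o, 'm) cfun" where
  "id_functor = \<lparr>FObj = id, FArr = id\<rparr>"

definition comp_functor ::
  "('p, 'n, 'q, 'k) cfun \<Rightarrow> ('o, 'm, 'p, 'n) cfun \<Rightarrow> ('o, 'm, 'q, 'k) cfun" where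
  "comp_functor G F = \<lparr>FObj = FObj G \<circ> FObj F, FArr = FArr G \<circ> FArr F\<rparr>"

definition natural_iso ::
  "('o, 'm, 'y) cat_scheme \<Rightarrow> ('p, 'n, 'z) cat_scheme \<Rightarrow>
   ('o, 'm, 'p, 'n) cfun \<Rightarrow> ('o, 'm, 'p, 'n) cfun \<Rightarrow> ('o \<Rightarrow> 'n) \<Rightarrow> bool" where
  "natural_iso C D F G \<eta> \<longleftrightarrow>
     (\<forall>a \<in> Obj C. \<eta> a \<in> hom D (FObj F a) (FObj G a) \<and> iso D (\<eta> a)) \<and>
     (\<forall>f \<in> Arr C. FArr G f \<cdot>\<^bsub>D\<^esub> \<eta> (Dom C f) = \<eta> (Cod C f) \<cdot>\<^bsub>D\<^esub> FArr F f)"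

definition equivalence ::
  "('o, 'm, 'y) cat_scheme \<Rightarrow> ('p, 'n, 'z) cat_scheme \<Rightarrow> ('o, 'm, 'p, 'n) cfun \<Rightarrow> bool" where
  "equivalence C D F \<longleftrightarrow> is_functor C D F \<and>
     (\<exists>G. is_functor D C G \<and>
        (\<exists>\<eta>. natural_iso C C id_functor (comp_functor G F) \<eta>) \<and>
        (\<exists>\<epsilon>. natural_iso D D (comp_functor F G) id_functor \<epsilon>))"

definition product_cat ::
  "('o, 'm, 'y) cat_scheme \<Rightarrow> ('p, 'n, 'z) cat_scheme \<Rightarrow> ('o \<times> 'p, 'm \<times> 'n) cat" where
  "product_cat C D =
     \<lparr>Obj = Obj C \<times> Obj D,
      Arr = Arr C \<times> Arr D,
      Dom = (\<lambda>(f, g). (Dom C f, Dom D g)),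
      Cod = (\<lambda>(f, g). (Cod C f, Cod D g)),
      Ident = (\<lambda>(a, b). (Ident C a, Ident D b)),
      Comp = (\<lambda>(f', g') (f, g). (f' \<cdot>\<^bsub>C\<^esub> f, g' \<cdot>\<^bsub>D\<^esub> g))\<rparr>"

text \<open>An arrow of the slice is stored as \<open>(b, h, b')\<close>: the arrow \<open>h\<close> together with its source
  \<open>b\<close> and target \<open>b'\<close> in the slice, which \<open>h\<close> alone does not determine.\<close>

definition slice :: "('o, 'm, 'z) cat_scheme \<Rightarrow> 'o \<Rightarrow> ('m, 'm \<times> 'm \<times> 'm) cat" where
  "slice C y =
     \<lparr>Obj = {b \<in> Arr C. Cod C b = y},
      Arr = {(b, h, b'). b \<in> Arr C \<and> Cod C b = y \<and> b' \<in> Arr C \<and> Cod C b' = y \<and>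
               h \<in> hom C (Dom C b) (Dom C b') \<and> b' \<cdot>\<^bsub>C\<^esub> h = b},
      Dom = (\<lambda>(b, h, b'). b),
      Cod = (\<lambda>(b, h, b'). b'),
      Ident = (\<lambda>b. (b, Ident C (Dom C b), b)),
      Comp = (\<lambda>(c, k, c') (b, h, b'). (b, k \<cdot>\<^bsub>C\<^esub> h, c'))\<rparr>"

abbreviation slice_arrow :: "'m \<times> 'm \<times> 'm \<Rightarrow> 'm" where
  "slice_arrow u \<equiv> fst (snd u)"


section \<open>Limits and colimits\<close>

definition is_terminal :: "('o, 'm, 'z) cat_scheme \<Rightarrow> 'o \<Rightarrow> bool" where
  "is_terminal C t \<longleftrightarrow> t \<in> Obj C \<and> (\<forall>a \<in> Obj C. \<exists>!f. f \<in> hom C a t)"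

definition has_terminal :: "('o, 'm, 'z) cat_scheme \<Rightarrow> bool" where
  "has_terminal C \<longleftrightarrow> (\<exists>t. is_terminal C t)"

definition is_initial :: "('o, 'm, 'z) cat_scheme \<Rightarrow> 'o \<Rightarrow> bool" where
  "is_initial C z \<longleftrightarrow> z \<in> Obj C \<and> (\<forall>a \<in> Obj C. \<exists>!f. f \<in> hom C z a)"

definition is_coproduct ::
  "('o, 'm, 'z) cat_scheme \<Rightarrow> 'o \<Rightarrow> 'o \<Rightarrow> 'o \<Rightarrow> 'm \<Rightarrow> 'm \<Rightarrow> bool" where
  "is_coproduct C a b s i j \<longleftrightarrow>
     s \<in> Obj C \<and> i \<in> hom C a s \<and> j \<in> hom C b s \<and>
     (\<forall>c \<in> Obj C. \<forall>f \<in> hom C a c. \<forall>g \<in> hom C b c.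
        \<exists>!h. h \<in> hom C s c \<and> h \<cdot>\<^bsub>C\<^esub> i = f \<and> h \<cdot>\<^bsub>C\<^esub> j = g)"

definition has_finite_coproducts :: "('o, 'm, 'z) cat_scheme \<Rightarrow> bool" where
  "has_finite_coproducts C \<longleftrightarrow>
     (\<exists>z. is_initial C z) \<and>
     (\<forall>a \<in> Obj C. \<forall>b \<in> Obj C. \<exists>s i j. is_coproduct C a b s i j)"

definition coprod :: "('o, 'm, 'z) cat_scheme \<Rightarrow> 'o \<Rightarrow> 'o \<Rightarrow> 'o \<times> 'm \<times> 'm" where
  "coprod C a b = (SOME (s, i, j). is_coproduct C a b s i j)"

definition coprod_ob :: "('o, 'm, 'z) cat_scheme \<Rightarrow> 'o \<Rightarrow> 'o \<Rightarrow> 'o" where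
  "coprod_ob C a b = fst (coprod C a b)"

definition inj1 :: "('o, 'm, 'z) cat_scheme \<Rightarrow> 'o \<Rightarrow> 'o \<Rightarrow> 'm" where
  "inj1 C a b = fst (snd (coprod C a b))"

definition inj2 :: "('o, 'm, 'z) cat_scheme \<Rightarrow> 'o \<Rightarrow> 'o \<Rightarrow> 'm" where
  "inj2 C a b = snd (snd (coprod C a b))"

definition coprod_arr :: "('o, 'm, 'z) cat_scheme \<Rightarrow> 'm \<Rightarrow> 'm \<Rightarrow> 'm" where
  "coprod_arr C f g =
     (THE h. h \<in> hom C (coprod_ob C (Dom C f) (Dom C g)) (coprod_ob C (Cod C f) (Cod C g)) \<and>
        h \<cdot>\<^bsub>C\<^esub> inj1 C (Dom C f) (Dom C g) = inj1 C (Cod C f) (Cod C g) \<cdot>\<^bsub>C\<^esub> f \<and>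
        h \<cdot>\<^bsub>C\<^esub> inj2 C (Dom C f) (Dom C g) = inj2 C (Cod C f) (Cod C g) \<cdot>\<^bsub>C\<^esub> g)"

definition coprod_functor ::
  "('o, 'm, 'z) cat_scheme \<Rightarrow>
   ('m \<times> 'm, ('m \<times> 'm \<times> 'm) \<times> ('m \<times> 'm \<times> 'm), 'm, 'm \<times> 'm \<times> 'm) cfun" where
  "coprod_functor C =
     \<lparr>FObj = (\<lambda>(f, g). coprod_arr C f g),
      FArr = (\<lambda>((f, h, f'), (g, k, g')).
                (coprod_arr C f g, coprod_arr C h k, coprod_arr C f' g'))\<rparr>"

definition extensive :: "('o, 'm, 'z) cat_scheme \<Rightarrow> bool" where
  "extensive C \<longleftrightarrow> has_finite_coproducts C \<and>
     (\<forall>a \<in> Obj C. \<forall>b \<in> Obj C.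
        equivalence (product_cat (slice C a) (slice C b)) (slice C (coprod_ob C a b))
          (coprod_functor C))"

text \<open>\<open>is_pullback C f g x p q\<close>: the square \<open>f \<cdot> p = g \<cdot> q\<close> with apex \<open>x\<close> is a pullback of the
  cospan \<open>f, g\<close>.\<close>

definition is_pullback ::
  "('o, 'm, 'z) cat_scheme \<Rightarrow> 'm \<Rightarrow> 'm \<Rightarrow> 'o \<Rightarrow> 'm \<Rightarrow> 'm \<Rightarrow> bool" where
  "is_pullback C f g x p q \<longleftrightarrow>
     f \<in> Arr C \<and> g \<in> Arr C \<and> Cod C f = Cod C g \<and> x \<in> Obj C \<and>
     p \<in> hom C x (Dom C f) \<and> q \<in> hom C x (Dom C g) \<and> f \<cdot>\<^bsub>C\<^esub> p = g \<cdot>\<^bsub>C\<^esub> q \<and>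
     (\<forall>w \<in> Obj C. \<forall>u \<in> hom C w (Dom C f). \<forall>v \<in> hom C w (Dom C g).
        f \<cdot>\<^bsub>C\<^esub> u = g \<cdot>\<^bsub>C\<^esub> v \<longrightarrow> (\<exists>!h. h \<in> hom C w x \<and> p \<cdot>\<^bsub>C\<^esub> h = u \<and> q \<cdot>\<^bsub>C\<^esub> h = v))"

definition has_pullbacks :: "('o, 'm, 'z) cat_scheme \<Rightarrow> bool" where
  "has_pullbacks C \<longleftrightarrow>
     (\<forall>f \<in> Arr C. \<forall>g \<in> Arr C. Cod C f = Cod C g \<longrightarrow> (\<exists>x p q. is_pullback C f g x p q))"

definition pb :: "('o, 'm, 'z) cat_scheme \<Rightarrow> 'm \<Rightarrow> 'm \<Rightarrow> 'o \<times> 'm \<times> 'm" where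
  "pb C f g = (SOME (x, p, q). is_pullback C f g x p q)"

definition pb_ob :: "('o, 'm, 'z) cat_scheme \<Rightarrow> 'm \<Rightarrow> 'm \<Rightarrow> 'o" where
  "pb_ob C f g = fst (pb C f g)"

definition pb1 :: "('o, 'm, 'z) cat_scheme \<Rightarrow> 'm \<Rightarrow> 'm \<Rightarrow> 'm" where
  "pb1 C f g = fst (snd (pb C f g))"

definition pb2 :: "('o, 'm, 'z) cat_scheme \<Rightarrow> 'm \<Rightarrow> 'm \<Rightarrow> 'm" where
  "pb2 C f g = snd (snd (pb C f g))"

definition pullback_functor ::
  "('o, 'm, 'z) cat_scheme \<Rightarrow> 'm \<Rightarrow> ('m, 'm \<times> 'm \<times> 'm, 'm, 'm \<times> 'm \<times> 'm) cfun" where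
  "pullback_functor C f =
     \<lparr>FObj = (\<lambda>b. pb1 C f b),
      FArr = (\<lambda>(b, h, b').
        (pb1 C f b,
         (THE k. k \<in> hom C (pb_ob C f b) (pb_ob C f b') \<and>
                 pb1 C f b' \<cdot>\<^bsub>C\<^esub> k = pb1 C f b \<and> pb2 C f b' \<cdot>\<^bsub>C\<^esub> k = h \<cdot>\<^bsub>C\<^esub> pb2 C f b),
         pb1 C f b'))\<rparr>"

definition is_coequaliser :: "('o, 'm, 'z) cat_scheme \<Rightarrow> 'm \<Rightarrow> 'm \<Rightarrow> 'm \<Rightarrow> bool" where
  "is_coequaliser C f g q \<longleftrightarrow>
     parallel C f g \<and> q \<in> Arr C \<and> Dom C q = Cod C f \<and> q \<cdot>\<^bsub>C\<^esub> f = q \<cdot>\<^bsub>C\<^esub> g \<and>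
     (\<forall>z \<in> Obj C. \<forall>h \<in> hom C (Cod C f) z. h \<cdot>\<^bsub>C\<^esub> f = h \<cdot>\<^bsub>C\<^esub> g \<longrightarrow>
        (\<exists>!k. k \<in> hom C (Cod C q) z \<and> k \<cdot>\<^bsub>C\<^esub> q = h))"

definition has_coequalisers :: "('o, 'm, 'z) cat_scheme \<Rightarrow> bool" where
  "has_coequalisers C \<longleftrightarrow> (\<forall>f g. parallel C f g \<longrightarrow> (\<exists>q. is_coequaliser C f g q))"

definition preserves_coequalisers ::
  "('o, 'm, 'y) cat_scheme \<Rightarrow> ('p, 'n, 'z) cat_scheme \<Rightarrow> ('o, 'm, 'p, 'n) cfun \<Rightarrow> bool" where
  "preserves_coequalisers C D F \<longleftrightarrow>
     (\<forall>f g q. is_coequaliser C f g q \<longrightarrow> is_coequaliser D (FArr F f) (FArr F g) (FArr F q))"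

definition pullback_stable_coequalisers :: "('o, 'm, 'z) cat_scheme \<Rightarrow> bool" where
  "pullback_stable_coequalisers C \<longleftrightarrow> has_coequalisers C \<and>
     (\<forall>f \<in> Arr C.
        preserves_coequalisers (slice C (Cod C f)) (slice C (Dom C f)) (pullback_functor C f))"


section \<open>2-categories\<close>

text \<open>\<open>Obj\<close> and \<open>Arr\<close> are the objects and 1-cells.\<close>

record ('o, 'm, 'c) two_cat = "('o, 'm) cat" +
  Cell :: "'c set"
  Src :: "'c \<Rightarrow> 'm"
  Trg :: "'c \<Rightarrow> 'm"
  Ident2 :: "'m \<Rightarrow> 'c"
  VComp :: "'c \<Rightarrow> 'c \<Rightarrow> 'c"
  HComp :: "'c \<Rightarrow> 'c \<Rightarrow> 'c" (infixl "\<star>\<index>" 70)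

definition cells :: "('o, 'm, 'c, 'z) two_cat_scheme \<Rightarrow> 'm \<Rightarrow> 'm \<Rightarrow> 'c set" where
  "cells K f g = {\<alpha> \<in> Cell K. Src K \<alpha> = f \<and> Trg K \<alpha> = g}"

text \<open>The universal property of a coequaliser \<open>q : b \<rightarrow> c\<close> of \<open>f, g : a \<rightarrow> b\<close> in a 2-category:
  precomposition with \<open>q\<close> is an isomorphism from \<open>K(c, z)\<close> onto the equaliser of the two
  precomposition functors \<open>K(b, z) \<rightarrow> K(a, z)\<close>. The two conjuncts over \<open>z\<close> say that it is bijective
  on objects and on the 2-cells between any two given 1-cells.\<close>

definition is_2coequaliser :: "('o, 'm, 'c, 'z) two_cat_scheme \<Rightarrow> 'm \<Rightarrow> 'm \<Rightarrow> 'm \<Rightarrow> bool" where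
  "is_2coequaliser K f g q \<longleftrightarrow>
     parallel K f g \<and> q \<in> Arr K \<and> Dom K q = Cod K f \<and> q \<cdot>\<^bsub>K\<^esub> f = q \<cdot>\<^bsub>K\<^esub> g \<and>
     (\<forall>z \<in> Obj K.
        (\<forall>h \<in> hom K (Cod K f) z. h \<cdot>\<^bsub>K\<^esub> f = h \<cdot>\<^bsub>K\<^esub> g \<longrightarrow>
           (\<exists>!k. k \<in> hom K (Cod K q) z \<and> k \<cdot>\<^bsub>K\<^esub> q = h)) \<and>
        (\<forall>k \<in> hom K (Cod K q) z. \<forall>k' \<in> hom K (Cod K q) z.
           \<forall>\<alpha> \<in> cells K (k \<cdot>\<^bsub>K\<^esub> q) (k' \<cdot>\<^bsub>K\<^esub> q).
             \<alpha> \<star>\<^bsub>K\<^esub> Ident2 K f = \<alpha> \<star>\<^bsub>K\<^esub> Ident2 K g \<longrightarrow>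
             (\<exists>!\<beta>. \<beta> \<in> cells K k k' \<and> \<beta> \<star>\<^bsub>K\<^esub> Ident2 K q = \<alpha>)))"

text \<open>The strict slice: 1-cells are strictly commuting triangles, and a 2-cell \<open>\<alpha>\<close> between two
  1-cells from \<open>b\<close> to \<open>b'\<close> must satisfy \<open>b' \<star> \<alpha> = 1\<close>.\<close>

definition slice2 ::
  "('o, 'm, 'c, 'z) two_cat_scheme \<Rightarrow> 'o \<Rightarrow>
   ('m, 'm \<times> 'm \<times> 'm, ('m \<times> 'm \<times> 'm) \<times> 'c \<times> ('m \<times> 'm \<times> 'm)) two_cat" where
  "slice2 K y = cat.extend (slice K y)
     (two_cat.fields
       {(u, \<alpha>, v). parallel (slice K y) u v \<and>
          \<alpha> \<in> cells K (slice_arrow u) (slice_arrow v) \<and>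
          Ident2 K (Cod (slice K y) u) \<star>\<^bsub>K\<^esub> \<alpha> = Ident2 K (Dom (slice K y) u)}
       (\<lambda>(u, \<alpha>, v). u)
       (\<lambda>(u, \<alpha>, v). v)
       (\<lambda>u. (u, Ident2 K (slice_arrow u), u))
       (\<lambda>(v, \<beta>, w) (u, \<alpha>, v'). (u, VComp K \<beta> \<alpha>, w))
       (\<lambda>(u', \<beta>, v') (u, \<alpha>, v).
          (u' \<cdot>\<^bsub>slice K y\<^esub> u, \<beta> \<star>\<^bsub>K\<^esub> \<alpha>, v' \<cdot>\<^bsub>slice K y\<^esub> v)))"


section \<open>Internal categories\<close>

text \<open>\<open>I2\<close> is the object of composable pairs \<open>(g, f)\<close> with \<open>g\<close> after \<open>f\<close>; its projections are
  \<open>ipr1\<close> (to \<open>g\<close>) and \<open>ipr2\<close> (to \<open>f\<close>). An internal category carries a pullback \<open>I2\<close> as part of its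
  data; a different choice of it gives an isomorphic internal category.\<close>

record ('o, 'm) icat =
  I0 :: 'o
  I1 :: 'o
  I2 :: 'o
  isrc :: 'm
  itrg :: 'm
  iid :: 'm
  ipr1 :: 'm
  ipr2 :: 'm
  icomp :: 'm

definition ipair :: "('o, 'm, 'z) cat_scheme \<Rightarrow> ('o, 'm) icat \<Rightarrow> 'm \<Rightarrow> 'm \<Rightarrow> 'm" where
  "ipair E A g f =
     (THE h. h \<in> hom E (Dom E g) (I2 A) \<and> ipr1 A \<cdot>\<^bsub>E\<^esub> h = g \<and> ipr2 A \<cdot>\<^bsub>E\<^esub> h = f)"

text \<open>Composite in \<open>A\<close> of generalised elements \<open>f, g : T \<rightarrow> A\<^sub>1\<close>.\<close>

definition ecomp :: "('o, 'm, 'z) cat_scheme \<Rightarrow> ('o, 'm) icat \<Rightarrow> 'm \<Rightarrow> 'm \<Rightarrow> 'm" where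
  "ecomp E A g f = icomp A \<cdot>\<^bsub>E\<^esub> ipair E A g f"

text \<open>Associativity is stated for generalised elements; the case where \<open>T\<close> is the object of
  composable triples is the usual diagram, and it implies all the others by precomposition.\<close>

definition internal_category :: "('o, 'm, 'z) cat_scheme \<Rightarrow> ('o, 'm) icat \<Rightarrow> bool" where
  "internal_category E A \<longleftrightarrow>
     I0 A \<in> Obj E \<and> I1 A \<in> Obj E \<and>
     isrc A \<in> hom E (I1 A) (I0 A) \<and> itrg A \<in> hom E (I1 A) (I0 A) \<and>
     iid A \<in> hom E (I0 A) (I1 A) \<and>
     is_pullback E (isrc A) (itrg A) (I2 A) (ipr1 A) (ipr2 A) \<and>
     icomp A \<in> hom E (I2 A) (I1 A) \<and>
     isrc A \<cdot>\<^bsub>E\<^esub> iid A = Ident E (I0 A) \<and>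
     itrg A \<cdot>\<^bsub>E\<^esub> iid A = Ident E (I0 A) \<and>
     isrc A \<cdot>\<^bsub>E\<^esub> icomp A = isrc A \<cdot>\<^bsub>E\<^esub> ipr2 A \<and>
     itrg A \<cdot>\<^bsub>E\<^esub> icomp A = itrg A \<cdot>\<^bsub>E\<^esub> ipr1 A \<and>
     ecomp E A (Ident E (I1 A)) (iid A \<cdot>\<^bsub>E\<^esub> isrc A) = Ident E (I1 A) \<and>
     ecomp E A (iid A \<cdot>\<^bsub>E\<^esub> itrg A) (Ident E (I1 A)) = Ident E (I1 A) \<and>
     (\<forall>T \<in> Obj E. \<forall>f \<in> hom E T (I1 A). \<forall>g \<in> hom E T (I1 A). \<forall>h \<in> hom E T (I1 A).
        isrc A \<cdot>\<^bsub>E\<^esub> g = itrg A \<cdot>\<^bsub>E\<^esub> f \<and> isrc A \<cdot>\<^bsub>E\<^esub> h = itrg A \<cdot>\<^bsub>E\<^esub> g \<longrightarrow>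
        ecomp E A (ecomp E A h g) f = ecomp E A h (ecomp E A g f))"

record ('o, 'm) ifun =
  fdom :: "('o, 'm) icat"
  fcod :: "('o, 'm) icat"
  F0 :: 'm
  F1 :: 'm

definition F2 :: "('o, 'm, 'z) cat_scheme \<Rightarrow> ('o, 'm) ifun \<Rightarrow> 'm" where
  "F2 E F = ipair E (fcod F) (F1 F \<cdot>\<^bsub>E\<^esub> ipr1 (fdom F)) (F1 F \<cdot>\<^bsub>E\<^esub> ipr2 (fdom F))"

definition internal_functor :: "('o, 'm, 'z) cat_scheme \<Rightarrow> ('o, 'm) ifun \<Rightarrow> bool" where
  "internal_functor E F \<longleftrightarrow>
     internal_category E (fdom F) \<and> internal_category E (fcod F) \<and>
     F0 F \<in> hom E (I0 (fdom F)) (I0 (fcod F)) \<and>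
     F1 F \<in> hom E (I1 (fdom F)) (I1 (fcod F)) \<and>
     isrc (fcod F) \<cdot>\<^bsub>E\<^esub> F1 F = F0 F \<cdot>\<^bsub>E\<^esub> isrc (fdom F) \<and>
     itrg (fcod F) \<cdot>\<^bsub>E\<^esub> F1 F = F0 F \<cdot>\<^bsub>E\<^esub> itrg (fdom F) \<and>
     F1 F \<cdot>\<^bsub>E\<^esub> iid (fdom F) = iid (fcod F) \<cdot>\<^bsub>E\<^esub> F0 F \<and>
     F1 F \<cdot>\<^bsub>E\<^esub> icomp (fdom F) = icomp (fcod F) \<cdot>\<^bsub>E\<^esub> F2 E F"

definition id_ifun :: "('o, 'm, 'z) cat_scheme \<Rightarrow> ('o, 'm) icat \<Rightarrow> ('o, 'm) ifun" where
  "id_ifun E A = \<lparr>fdom = A, fcod = A, F0 = Ident E (I0 A), F1 = Ident E (I1 A)\<rparr>"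

definition comp_ifun ::
  "('o, 'm, 'z) cat_scheme \<Rightarrow> ('o, 'm) ifun \<Rightarrow> ('o, 'm) ifun \<Rightarrow> ('o, 'm) ifun" where
  "comp_ifun E G F =
     \<lparr>fdom = fdom F, fcod = fcod G, F0 = F0 G \<cdot>\<^bsub>E\<^esub> F0 F, F1 = F1 G \<cdot>\<^bsub>E\<^esub> F1 F\<rparr>"

text \<open>An internal natural transformation is given by its component \<open>tcomp : A\<^sub>0 \<rightarrow> B\<^sub>1\<close>.\<close>

record ('o, 'm) inat =
  tsrc :: "('o, 'm) ifun"
  ttrg :: "('o, 'm) ifun"
  tcomp :: 'm

definition internal_nat_trans :: "('o, 'm, 'z) cat_scheme \<Rightarrow> ('o, 'm) inat \<Rightarrow> bool" where
  "internal_nat_trans E \<alpha> \<longleftrightarrow>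
     (let F = tsrc \<alpha>; G = ttrg \<alpha>; A = fdom F; B = fcod F in
        internal_functor E F \<and> internal_functor E G \<and> fdom G = A \<and> fcod G = B \<and>
        tcomp \<alpha> \<in> hom E (I0 A) (I1 B) \<and>
        isrc B \<cdot>\<^bsub>E\<^esub> tcomp \<alpha> = F0 F \<and>
        itrg B \<cdot>\<^bsub>E\<^esub> tcomp \<alpha> = F0 G \<and>
        ecomp E B (tcomp \<alpha> \<cdot>\<^bsub>E\<^esub> itrg A) (F1 F) = ecomp E B (F1 G) (tcomp \<alpha> \<cdot>\<^bsub>E\<^esub> isrc A))"

definition id_inat :: "('o, 'm, 'z) cat_scheme \<Rightarrow> ('o, 'm) ifun \<Rightarrow> ('o, 'm) inat" where
  "id_inat E F = \<lparr>tsrc = F, ttrg = F, tcomp = iid (fcod F) \<cdot>\<^bsub>E\<^esub> F0 F\<rparr>"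

definition vcomp_inat ::
  "('o, 'm, 'z) cat_scheme \<Rightarrow> ('o, 'm) inat \<Rightarrow> ('o, 'm) inat \<Rightarrow> ('o, 'm) inat" where
  "vcomp_inat E \<beta> \<alpha> =
     \<lparr>tsrc = tsrc \<alpha>, ttrg = ttrg \<beta>, tcomp = ecomp E (fcod (tsrc \<alpha>)) (tcomp \<beta>) (tcomp \<alpha>)\<rparr>"

text \<open>For \<open>\<alpha> : F \<Rightarrow> G : A \<rightarrow> B\<close> and \<open>\<beta> : H \<Rightarrow> K : B \<rightarrow> C\<close> the component at \<open>a\<close> is
  \<open>\<beta>(G a) \<circ> H(\<alpha>(a))\<close>.\<close>

definition hcomp_inat ::
  "('o, 'm, 'z) cat_scheme \<Rightarrow> ('o, 'm) inat \<Rightarrow> ('o, 'm) inat \<Rightarrow> ('o, 'm) inat" where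
  "hcomp_inat E \<beta> \<alpha> =
     \<lparr>tsrc = comp_ifun E (tsrc \<beta>) (tsrc \<alpha>),
      ttrg = comp_ifun E (ttrg \<beta>) (ttrg \<alpha>),
      tcomp = ecomp E (fcod (tsrc \<beta>))
                (tcomp \<beta> \<cdot>\<^bsub>E\<^esub> F0 (ttrg \<alpha>)) (F1 (tsrc \<beta>) \<cdot>\<^bsub>E\<^esub> tcomp \<alpha>)\<rparr>"

definition Cat ::
  "('o, 'm, 'z) cat_scheme \<Rightarrow> (('o, 'm) icat, ('o, 'm) ifun, ('o, 'm) inat) two_cat" where
  "Cat E =
     \<lparr>Obj = {A. internal_category E A},
      Arr = {F. internal_functor E F},
      Dom = fdom,
      Cod = fcod,
      Ident = id_ifun E,
      Comp = comp_ifun E,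
      Cell = {\<alpha>. internal_nat_trans E \<alpha>},
      Src = tsrc,
      Trg = ttrg,
      Ident2 = id_inat E,
      VComp = vcomp_inat E,
      HComp = hcomp_inat E\<rparr>"

definition agree_on_objects :: "('o, 'm) ifun \<Rightarrow> ('o, 'm) ifun \<Rightarrow> bool" where
  "agree_on_objects F G \<longleftrightarrow> F0 F = F0 G"

definition discrete_conduche :: "('o, 'm, 'z) cat_scheme \<Rightarrow> ('o, 'm) ifun \<Rightarrow> bool" where
  "discrete_conduche E F \<longleftrightarrow> internal_functor E F \<and>
     is_pullback E (F1 F) (icomp (fcod F)) (I2 (fdom F)) (icomp (fdom F)) (F2 E F)"

definition Cat_has_coequalisers_agreeing_on_objects :: "('o, 'm, 'z) cat_scheme \<Rightarrow> bool" where
  "Cat_has_coequalisers_agreeing_on_objects E \<longleftrightarrow>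
     (\<forall>F G. parallel (Cat E) F G \<and> agree_on_objects F G \<longrightarrow> (\<exists>Q. is_2coequaliser (Cat E) F G Q))"

definition Cat_coequalisers_stable_along_discrete_conduche ::
  "('o, 'm, 'z) cat_scheme \<Rightarrow> bool" where
  "Cat_coequalisers_stable_along_discrete_conduche E \<longleftrightarrow>
     (\<forall>f F G Q. discrete_conduche E f \<longrightarrow>
        is_2coequaliser (slice2 (Cat E) (fcod f)) F G Q \<and>
        agree_on_objects (slice_arrow F) (slice_arrow G) \<longrightarrow>
        is_2coequaliser (slice2 (Cat E) (fdom f))
          (FArr (pullback_functor (Cat E) f) F)
          (FArr (pullback_functor (Cat E) f) G)
          (FArr (pullback_functor (Cat E) f) Q))"

end

theory Submission
  imports Defs
begin

text \<open>An object \<open>X\<close> generates an internal category \<open>two X\<close> with two objects and \<open>X\<close> as its object of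
  arrows from the first to the second. A functor \<open>two X \<rightarrow> D\<close> is a pair of points \<open>a, b\<close> of \<open>D\<^sub>0\<close>
  together with an \<open>X\<close>-indexed family of arrows \<open>a \<rightarrow> b\<close>; in particular the functors \<open>two X \<rightarrow> two Z\<close>
  that are the identity on objects are exactly the arrows \<open>X \<rightarrow> Z\<close>.

  Existence: for \<open>f, g : X \<rightarrow> Y\<close> let \<open>Q : two Y \<rightarrow> D\<close> be the coequaliser of \<open>two f, two g\<close>, and let \<open>H\<close> be
  the object of arrows of \<open>D\<close> between the images of the two objects. Then \<open>Q\<close> factors through
  \<open>two H \<rightarrow> D\<close>, and the universal property of \<open>Q\<close> makes \<open>two H \<rightarrow> D\<close> invertible, so that \<open>Y \<rightarrow> H\<close> is a
  coequaliser of \<open>f, g\<close>.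

  Stability: \<open>two\<close> takes coequalisers of a slice to 2-coequalisers of the strict slice, takes every
  arrow to a discrete Conduche fibration, and preserves pullbacks. Hence the hypothesis applied to
  \<open>two f\<close> says that \<open>two\<close> of the pulled-back diagram is a coequaliser, and full faithfulness on
  functors that are the identity on objects reflects this to the slice over the domain of \<open>f\<close>.\<close>

section \<open>Pullbacks and coproducts\<close>

text \<open>Extensivity is what makes \<open>two X\<close> computable: a map into a sum splits its
  domain, so pullbacks can be taken summand by summand. A composable pair in \<open>two X\<close>
  always contains an identity; this presents the object of pairs as a sum of two copies of
  \<open>1 + X\<close> and reduces associativity and preservation of composition to unit laws. The
  terminal object supplies the two points of \<open>two X\<close> and the binary products that
  compare a slice with its base.

  Three obstacles shape the rest. The codomain of \<open>Q\<close> is an arbitrary internal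
  category, so the candidate quotient has to be cut out of it as an object of arrows. The objects of
  the strict slice are arbitrary functors into \<open>two Y\<close>, so a coequaliser in a slice
  must first be seen to be a coequaliser in the base. The pullback functors rest on choices made
  independently in the base and in the 2-category, so the chosen pullback of \<open>two\<close> of
  an arrow is only isomorphic to \<open>two\<close> of the chosen pullback; the comparison
  isomorphisms and their naturality are carried along explicitly.\<close>

lemma homI: "f \<in> Arr C \<Longrightarrow> Dom C f = a \<Longrightarrow> Cod C f = b \<Longrightarrow> f \<in> hom C a b"
  by (simp add: hom_def)

lemma homD:
  assumes "f \<in> hom C a b"
  shows "f \<in> Arr C" "Dom C f = a" "Cod C f = b"
  using assms by (simp_all add: hom_def)

context category
begin

lemma comp_type [simp]:
  assumes "f \<in> Arr C" "g \<in> Arr C" "Cod C f = Dom C g"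
  shows "g \<cdot> f \<in> Arr C" "Dom C (g \<cdot> f) = Dom C f" "Cod C (g \<cdot> f) = Cod C g"
  using Comp_in_hom[of f "Dom C f" "Cod C f" g "Cod C g"] assms by (auto simp: hom_def)

lemma comp_assoc [simp]:
  assumes "f \<in> Arr C" "g \<in> Arr C" "h \<in> Arr C" "Cod C f = Dom C g" "Cod C g = Dom C h"
  shows "(h \<cdot> g) \<cdot> f = h \<cdot> (g \<cdot> f)"
  using Comp_assoc[of f "Dom C f" "Cod C f" g "Cod C g" h "Cod C h"] assms
  by (auto simp: hom_def)

lemma ident_type [simp]:
  assumes "a \<in> Obj C"
  shows "Ident C a \<in> Arr C" "Dom C (Ident C a) = a" "Cod C (Ident C a) = a"
  using Ident_in_hom[OF assms] by (auto simp: hom_def)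

lemma comp_ident [simp]:
  assumes "f \<in> Arr C"
  shows "Dom C f = a \<Longrightarrow> f \<cdot> Ident C a = f" "Cod C f = a \<Longrightarrow> Ident C a \<cdot> f = f"
  using assms Comp_Ident[of f a "Cod C f"] Ident_Comp[of f "Dom C f" a] by (auto simp: hom_def)

lemma dom_cod_obj [simp]:
  assumes "f \<in> Arr C"
  shows "Dom C f \<in> Obj C" "Cod C f \<in> Obj C"
  using assms Dom_in_Obj Cod_in_Obj by auto

lemma hom_obj: "f \<in> hom C a b \<Longrightarrow> a \<in> Obj C" "f \<in> hom C a b \<Longrightarrow> b \<in> Obj C"
  by (auto simp: hom_def)

lemma comp_eq_comp:
  assumes "g \<cdot> f = k" "f \<in> Arr C" "g \<in> Arr C" "Cod C f = Dom C g" "x \<in> Arr C" "Cod C x = Dom C f"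
  shows "g \<cdot> (f \<cdot> x) = k \<cdot> x"
  using assms comp_assoc[of x f g] by simp

lemma pullback_factor:
  assumes "is_pullback C f g x p q" "u \<in> hom C w (Dom C f)" "v \<in> hom C w (Dom C g)" "f \<cdot> u = g \<cdot> v"
  obtains h where "h \<in> hom C w x" "p \<cdot> h = u" "q \<cdot> h = v"
  using assms hom_obj(1)[OF assms(2)] unfolding is_pullback_def by blast

lemma pullback_unique:
  assumes "is_pullback C f g x p q" "h \<in> hom C w x" "k \<in> hom C w x"
    "p \<cdot> h = p \<cdot> k" "q \<cdot> h = q \<cdot> k"
  shows "h = k"
proof -
  have 1: "p \<in> Arr C" "q \<in> Arr C" "Dom C p = x" "Dom C q = x" "Cod C p = Dom C f" "Cod C q = Dom C g"
    "f \<in> Arr C" "g \<in> Arr C" "Cod C f = Cod C g" "f \<cdot> p = g \<cdot> q"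
    using assms(1) by (auto simp: is_pullback_def hom_def)
  have 2: "w \<in> Obj C" using hom_obj assms(2) by blast
  have 3: "p \<cdot> k \<in> hom C w (Dom C f)" "q \<cdot> k \<in> hom C w (Dom C g)"
    using assms(3) 1 by (auto simp: hom_def)
  have 4: "f \<cdot> (p \<cdot> k) = g \<cdot> (q \<cdot> k)"
    using comp_eq_comp[OF 1(10)] assms(3) 1 by (auto simp: hom_def)
  have "\<exists>!h. h \<in> hom C w x \<and> p \<cdot> h = p \<cdot> k \<and> q \<cdot> h = q \<cdot> k"
    using assms(1) 2 3 4 unfolding is_pullback_def by blast
  then show ?thesis using assms by blast
qed

lemma pullbackI:
  assumes "f \<in> Arr C" "g \<in> Arr C" "Cod C f = Cod C g"
    "p \<in> hom C x (Dom C f)" "q \<in> hom C x (Dom C g)" "f \<cdot> p = g \<cdot> q"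
    and ex: "\<And>w u v. u \<in> hom C w (Dom C f) \<Longrightarrow> v \<in> hom C w (Dom C g) \<Longrightarrow> f \<cdot> u = g \<cdot> v \<Longrightarrow>
      \<exists>h. h \<in> hom C w x \<and> p \<cdot> h = u \<and> q \<cdot> h = v"
    and un: "\<And>w h k. h \<in> hom C w x \<Longrightarrow> k \<in> hom C w x \<Longrightarrow> p \<cdot> h = p \<cdot> k \<Longrightarrow> q \<cdot> h = q \<cdot> k \<Longrightarrow> h = k"
  shows "is_pullback C f g x p q"
  unfolding is_pullback_def
proof (intro conjI ballI impI)
  show "x \<in> Obj C" using assms(4) hom_obj by blast
  fix w u v assume "u \<in> hom C w (Dom C f)" "v \<in> hom C w (Dom C g)" "f \<cdot> u = g \<cdot> v"
  with ex obtain h where "h \<in> hom C w x \<and> p \<cdot> h = u \<and> q \<cdot> h = v" by blast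
  then show "\<exists>!h. h \<in> hom C w x \<and> p \<cdot> h = u \<and> q \<cdot> h = v"
    using un by (metis (no_types, lifting))
qed (use assms in auto)

lemma pullbackD:
  assumes "is_pullback C f g x p q"
  shows "f \<in> Arr C" "g \<in> Arr C" "Cod C f = Cod C g" "x \<in> Obj C" "p \<in> Arr C" "q \<in> Arr C"
    "Dom C p = x" "Dom C q = x" "Cod C p = Dom C f" "Cod C q = Dom C g" "f \<cdot> p = g \<cdot> q"
  using assms by (auto simp: is_pullback_def hom_def)

lemma pullback_paste:
  assumes 1: "is_pullback C f g x p q" and 2: "is_pullback C q k y r s"
  shows "is_pullback C f (g \<cdot> k) y (p \<cdot> r) s"
proof -
  note t = pullbackD[OF 1] pullbackD[OF 2]
  show ?thesis
  proof (rule pullbackI)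
    show "f \<cdot> (p \<cdot> r) = g \<cdot> k \<cdot> s"
      using t comp_eq_comp[OF t(11), of r] by simp
  next
    fix w u v
    assume u: "u \<in> hom C w (Dom C f)" and v: "v \<in> hom C w (Dom C (g \<cdot> k))" and e: "f \<cdot> u = g \<cdot> k \<cdot> v"
    have kv: "k \<cdot> v \<in> hom C w (Dom C g)" using v t by (auto simp: hom_def)
    obtain h where h: "h \<in> hom C w x" "p \<cdot> h = u" "q \<cdot> h = k \<cdot> v"
      using pullback_factor[OF 1 u kv] e v t by (auto simp: hom_def)
    obtain h' where h': "h' \<in> hom C w y" "r \<cdot> h' = h" "s \<cdot> h' = v"
      using pullback_factor[OF 2 _ _ h(3)] h v t by (auto simp: hom_def)
    have "(p \<cdot> r) \<cdot> h' = u" using h h' t by (auto simp: hom_def)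
    then show "\<exists>h. h \<in> hom C w y \<and> p \<cdot> r \<cdot> h = u \<and> s \<cdot> h = v" using h' by blast
  next
    fix w h k' assume a: "h \<in> hom C w y" "k' \<in> hom C w y" "p \<cdot> r \<cdot> h = p \<cdot> r \<cdot> k'" "s \<cdot> h = s \<cdot> k'"
    have "r \<cdot> h = r \<cdot> k'"
    proof (rule pullback_unique[OF 1])
      show "p \<cdot> (r \<cdot> h) = p \<cdot> (r \<cdot> k')" using a t by (auto simp: hom_def)
      show "q \<cdot> (r \<cdot> h) = q \<cdot> (r \<cdot> k')"
        using a t comp_eq_comp[OF t(22), of h] comp_eq_comp[OF t(22), of k']
        by (auto simp: hom_def)
    qed (use a t in \<open>auto simp: hom_def\<close>)
    then show "h = k'" using pullback_unique[OF 2] a by blast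
  qed (use t in \<open>auto simp: hom_def\<close>)
qed

section \<open>Coproduct cocones, independently of any choice\<close>

lemma coproduct_sym:
  assumes "is_coproduct C a b s i j"
  shows "is_coproduct C b a s j i"
  using assms unfolding is_coproduct_def by (metis (no_types, lifting))

lemma coproductD:
  assumes "is_coproduct C a b s i j"
  shows "s \<in> Obj C" "i \<in> Arr C" "j \<in> Arr C" "Dom C i = a" "Dom C j = b" "Cod C i = s" "Cod C j = s"
    "a \<in> Obj C" "b \<in> Obj C"
  using assms by (auto simp: is_coproduct_def hom_def)

lemma coproduct_factor:
  assumes "is_coproduct C a b s i j" "f \<in> hom C a c" "g \<in> hom C b c"
  obtains h where "h \<in> hom C s c" "h \<cdot> i = f" "h \<cdot> j = g"
  using assms hom_obj(2)[OF assms(2)] unfolding is_coproduct_def by blast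

lemma coproduct_unique:
  assumes "is_coproduct C a b s i j" "h \<in> hom C s c" "k \<in> hom C s c" "h \<cdot> i = k \<cdot> i" "h \<cdot> j = k \<cdot> j"
  shows "h = k"
proof -
  note t = coproductD[OF assms(1)]
  have 2: "c \<in> Obj C" "k \<cdot> i \<in> hom C a c" "k \<cdot> j \<in> hom C b c"
    using assms(3) t by (auto simp: hom_def)
  have "\<exists>!h. h \<in> hom C s c \<and> h \<cdot> i = k \<cdot> i \<and> h \<cdot> j = k \<cdot> j"
    using assms(1) 2 unfolding is_coproduct_def by blast
  then show ?thesis using assms by blast
qed

lemma coproductI:
  assumes "i \<in> hom C a s" "j \<in> hom C b s"
    and ex: "\<And>c f g. f \<in> hom C a c \<Longrightarrow> g \<in> hom C b c \<Longrightarrow> \<exists>h. h \<in> hom C s c \<and> h \<cdot> i = f \<and> h \<cdot> j = g"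
    and un: "\<And>c h k. h \<in> hom C s c \<Longrightarrow> k \<in> hom C s c \<Longrightarrow> h \<cdot> i = k \<cdot> i \<Longrightarrow> h \<cdot> j = k \<cdot> j \<Longrightarrow> h = k"
  shows "is_coproduct C a b s i j"
  unfolding is_coproduct_def
proof (intro conjI ballI)
  show "s \<in> Obj C" using assms(1) hom_obj by blast
  fix c f g assume "f \<in> hom C a c" "g \<in> hom C b c"
  with ex obtain h where "h \<in> hom C s c \<and> h \<cdot> i = f \<and> h \<cdot> j = g" by blast
  then show "\<exists>!h. h \<in> hom C s c \<and> h \<cdot> i = f \<and> h \<cdot> j = g" using un by (metis (no_types, lifting))
qed (use assms in auto)

lemma coproduct_iso:
  assumes c: "is_coproduct C a b s i j" and e: "e \<in> hom C s s'" "e' \<in> hom C s' s"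
    "e' \<cdot> e = Ident C s" "e \<cdot> e' = Ident C s'"
  shows "is_coproduct C a b s' (e \<cdot> i) (e \<cdot> j)"
proof -
  note t = coproductD[OF c] homD[OF e(1)] homD[OF e(2)]
  have e'i: "e' \<cdot> (e \<cdot> i) = i" "e' \<cdot> (e \<cdot> j) = j"
    using comp_eq_comp[OF e(3), of i] comp_eq_comp[OF e(3), of j] t by auto
  show ?thesis
  proof (rule coproductI)
    fix d f g assume f: "f \<in> hom C a d" and g: "g \<in> hom C b d"
    obtain h where h: "h \<in> hom C s d" "h \<cdot> i = f" "h \<cdot> j = g" using coproduct_factor[OF c f g] .
    have "h \<cdot> e' \<in> hom C s' d \<and> (h \<cdot> e') \<cdot> (e \<cdot> i) = f \<and> (h \<cdot> e') \<cdot> (e \<cdot> j) = g"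
      using h t e'i by (auto simp: hom_def)
    then show "\<exists>h. h \<in> hom C s' d \<and> h \<cdot> (e \<cdot> i) = f \<and> h \<cdot> (e \<cdot> j) = g" by blast
  next
    fix d h k assume a: "h \<in> hom C s' d" "k \<in> hom C s' d"
      "h \<cdot> (e \<cdot> i) = k \<cdot> (e \<cdot> i)" "h \<cdot> (e \<cdot> j) = k \<cdot> (e \<cdot> j)"
    have "h \<cdot> e = k \<cdot> e" by (rule coproduct_unique[OF c]) (use a t in \<open>auto simp: hom_def\<close>)
    then have "(h \<cdot> e) \<cdot> e' = (k \<cdot> e) \<cdot> e'" by simp
    then show "h = k" using a t e by (auto simp: hom_def)
  qed (use t in \<open>auto simp: hom_def\<close>)
qed

end

section \<open>Equivalences and extensivity\<close>

lemma (in category) iso_cancel_left: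
  assumes "iso C m" "f \<in> Arr C" "g \<in> Arr C" "Cod C f = Dom C m" "Cod C g = Dom C m" "m \<cdot> f = m \<cdot> g"
  shows "f = g"
proof -
  obtain n where n: "m \<in> Arr C" "n \<in> hom C (Cod C m) (Dom C m)" "n \<cdot> m = Ident C (Dom C m)"
    using assms(1) by (auto simp: iso_def)
  have "n \<cdot> (m \<cdot> f) = f" "n \<cdot> (m \<cdot> g) = g"
    using comp_eq_comp[OF n(3), of f] comp_eq_comp[OF n(3), of g] n(1,3) homD[OF n(2)] assms(2-5) by simp_all
  then show ?thesis using assms(6) by metis
qed

lemma (in category) iso_cancel_right:
  assumes "iso C m" "f \<in> Arr C" "g \<in> Arr C" "Dom C f = Cod C m" "Dom C g = Cod C m" "f \<cdot> m = g \<cdot> m"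
  shows "f = g"
proof -
  obtain n where n: "m \<in> Arr C" "n \<in> hom C (Cod C m) (Dom C m)" "m \<cdot> n = Ident C (Cod C m)"
    using assms(1) by (auto simp: iso_def)
  have "(f \<cdot> m) \<cdot> n = f" "(g \<cdot> m) \<cdot> n = g"
    using n(1,3) homD[OF n(2)] assms(2-5) by simp_all
  then show ?thesis using assms(6) by metis
qed

lemma is_functorD:
  assumes "is_functor C D F"
  shows "a \<in> Obj C \<Longrightarrow> FObj F a \<in> Obj D"
    and "f \<in> Arr C \<Longrightarrow> FArr F f \<in> Arr D"
    and "f \<in> Arr C \<Longrightarrow> Dom D (FArr F f) = FObj F (Dom C f)"
    and "f \<in> Arr C \<Longrightarrow> Cod D (FArr F f) = FObj F (Cod C f)"
    and "f \<in> Arr C \<Longrightarrow> g \<in> Arr C \<Longrightarrow> Cod C f = Dom C g \<Longrightarrow>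
      FArr F (g \<cdot>\<^bsub>C\<^esub> f) = FArr F g \<cdot>\<^bsub>D\<^esub> FArr F f"
  using assms by (auto simp: is_functor_def hom_def)

lemma natural_isoD:
  assumes "natural_iso C D F G \<eta>" "category C"
  shows "a \<in> Obj C \<Longrightarrow> \<eta> a \<in> Arr D"
    and "a \<in> Obj C \<Longrightarrow> Dom D (\<eta> a) = FObj F a"
    and "a \<in> Obj C \<Longrightarrow> Cod D (\<eta> a) = FObj G a"
    and "a \<in> Obj C \<Longrightarrow> iso D (\<eta> a)"
    and "f \<in> Arr C \<Longrightarrow> FArr G f \<cdot>\<^bsub>D\<^esub> \<eta> (Dom C f) = \<eta> (Cod C f) \<cdot>\<^bsub>D\<^esub> FArr F f"
  using assms by (auto simp: natural_iso_def hom_def)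

text \<open>The naturality square at \<open>f\<close> expresses \<open>f\<close>, up to the
  invertible component at its codomain, through \<open>G (F f)\<close>.\<close>

lemma retract_faithful:
  assumes C: "category C" and \<eta>: "natural_iso C C id_functor (comp_functor G F) \<eta>"
    and "f \<in> Arr C" "g \<in> Arr C" "Dom C f = Dom C g" "Cod C f = Cod C g" "FArr F f = FArr F g"
  shows "f = g"
proof -
  interpret category C by (rule C)
  have "\<eta> (Cod C f) \<cdot>\<^bsub>C\<^esub> f = \<eta> (Cod C f) \<cdot>\<^bsub>C\<^esub> g"
    using natural_isoD(5)[OF \<eta> C, of f] natural_isoD(5)[OF \<eta> C, of g] assms(3-7)
    by (simp add: id_functor_def comp_functor_def)
  then show ?thesis
    by (rule iso_cancel_left[rotated -1])
      (use natural_isoD(1-4)[OF \<eta> C] assms(3-6) in \<open>auto simp: id_functor_def\<close>)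
qed

text \<open>The same argument with the isomorphism in the other direction, so that the component at
  the domain is cancelled. In \<open>equivalence_full\<close> it is applied to the
  quasi-inverse.\<close>

lemma section_faithful:
  assumes C: "category C" and \<eta>: "natural_iso C C (comp_functor G F) id_functor \<eta>"
    and "f \<in> Arr C" "g \<in> Arr C" "Dom C f = Dom C g" "Cod C f = Cod C g" "FArr F f = FArr F g"
  shows "f = g"
proof -
  interpret category C by (rule C)
  have "f \<cdot>\<^bsub>C\<^esub> \<eta> (Dom C f) = g \<cdot>\<^bsub>C\<^esub> \<eta> (Dom C f)"
    using natural_isoD(5)[OF \<eta> C, of f] natural_isoD(5)[OF \<eta> C, of g] assms(3-7)
    by (simp add: id_functor_def comp_functor_def)
  then show ?thesis
    by (rule iso_cancel_right[rotated -1])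
      (use natural_isoD(1-4)[OF \<eta> C] assms(3-6) in \<open>auto simp: id_functor_def\<close>)
qed

lemma equivalence_faithful:
  assumes "category C" "equivalence C D F"
    and "f \<in> Arr C" "g \<in> Arr C" "Dom C f = Dom C g" "Cod C f = Cod C g" "FArr F f = FArr F g"
  shows "f = g"
  using assms retract_faithful[OF assms(1)] unfolding equivalence_def by blast

lemma equivalence_full:
  assumes C: "category C" and D: "category D" and e: "equivalence C D F"
    and a: "a \<in> Obj C" and b: "b \<in> Obj C" and d: "d \<in> hom D (FObj F a) (FObj F b)"
  obtains c where "c \<in> hom C a b" "FArr F c = d"
proof -
  interpret category C by (rule C)
  from e obtain G \<eta> \<epsilon> where F: "is_functor C D F" and G: "is_functor D C G"
    and \<eta>: "natural_iso C C id_functor (comp_functor G F) \<eta>"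
    and \<epsilon>: "natural_iso D D (comp_functor F G) id_functor \<epsilon>"
    unfolding equivalence_def by blast
  note t = natural_isoD[OF \<eta> C, unfolded id_functor_def comp_functor_def, simplified]
  have d': "d \<in> Arr D" "Dom D d = FObj F a" "Cod D d = FObj F b" using d by (auto simp: hom_def)
  have Gd: "FArr G d \<in> Arr C" "Dom C (FArr G d) = FObj G (FObj F a)" "Cod C (FArr G d) = FObj G (FObj F b)"
    using is_functorD[OF G] d' by auto
  obtain n where n: "n \<in> hom C (FObj G (FObj F b)) b" "\<eta> b \<cdot>\<^bsub>C\<^esub> n = Ident C (FObj G (FObj F b))"
    using t(2-4)[OF b] unfolding iso_def by auto
  \<comment> \<open>The only possible preimage: naturality of \<open>\<eta>\<close> at
    \<open>c\<close> forces \<open>c\<close> to be \<open>G d\<close> conjugated by the unit, and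
    \<open>n\<close> is the inverse of \<open>\<eta> b\<close>.\<close>
  define c where "c = n \<cdot>\<^bsub>C\<^esub> (FArr G d \<cdot>\<^bsub>C\<^esub> \<eta> a)"
  have c: "c \<in> Arr C" "Dom C c = a" "Cod C c = b"
    using n Gd t a b by (auto simp: c_def hom_def)
  have "\<eta> b \<cdot>\<^bsub>C\<^esub> c = FArr G d \<cdot>\<^bsub>C\<^esub> \<eta> a"
    using comp_eq_comp[OF n(2), of "FArr G d \<cdot>\<^bsub>C\<^esub> \<eta> a"] n Gd t a b by (simp add: c_def hom_def)
  then have "FArr G (FArr F c) \<cdot>\<^bsub>C\<^esub> \<eta> a = FArr G d \<cdot>\<^bsub>C\<^esub> \<eta> a"
    using t(5)[of c] c by simp
  then have "FArr G (FArr F c) = FArr G d"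
    using iso_cancel_right[of "\<eta> a" "FArr G (FArr F c)" "FArr G d"] is_functorD[OF F] is_functorD[OF G] c t a Gd
    by simp
  then have "FArr F c = d"
    using section_faithful[OF D \<epsilon>, of "FArr F c" d] is_functorD[OF F] c d' by simp
  then show ?thesis using that c by (auto simp: hom_def)
qed

lemma equivalence_surj:
  assumes "equivalence C D F" "d \<in> Obj D" "category D"
  obtains c e where "c \<in> Obj C" "e \<in> hom D (FObj F c) d" "iso D e"
proof -
  from assms(1) obtain G \<epsilon> where G: "is_functor D C G"
    and \<epsilon>: "natural_iso D D (comp_functor F G) id_functor \<epsilon>"
    unfolding equivalence_def by blast
  show ?thesis
    using that[of "FObj G d" "\<epsilon> d"] assms(2) is_functorD(1)[OF G]
      natural_isoD[OF \<epsilon> assms(3), unfolded id_functor_def comp_functor_def, simplified]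
    by (auto simp: hom_def)
qed

section \<open>Slices and products of categories\<close>

lemma slice_simps [simp]:
  "Obj (slice C y) = {b \<in> Arr C. Cod C b = y}"
  "Dom (slice C y) (b, h, b') = b" "Cod (slice C y) (b, h, b') = b'"
  "Ident (slice C y) b = (b, Ident C (Dom C b), b)"
  "(c, k, c') \<cdot>\<^bsub>slice C y\<^esub> (b, h, b') = (b, k \<cdot>\<^bsub>C\<^esub> h, c')"
  by (simp_all add: slice_def)

lemma slice_Arr:
  "(b, h, b') \<in> Arr (slice C y) \<longleftrightarrow> b \<in> Arr C \<and> Cod C b = y \<and> b' \<in> Arr C \<and> Cod C b' = y \<and>
     h \<in> hom C (Dom C b) (Dom C b') \<and> b' \<cdot>\<^bsub>C\<^esub> h = b"
  by (simp add: slice_def)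

lemma slice_hom:
  "u \<in> hom (slice C y) b b' \<longleftrightarrow> (\<exists>h. u = (b, h, b') \<and> b \<in> Arr C \<and> Cod C b = y \<and> b' \<in> Arr C \<and>
     Cod C b' = y \<and> h \<in> hom C (Dom C b) (Dom C b') \<and> b' \<cdot>\<^bsub>C\<^esub> h = b)"
  by (cases u) (auto simp: hom_def slice_Arr)

lemma category_slice:
  assumes "category C"
  shows "category (slice C y)"
proof -
  interpret category C by (rule assms)
  show ?thesis
  proof unfold_locales
    fix u v b b' b'' assume "u \<in> hom (slice C y) b b'" "v \<in> hom (slice C y) b' b''"
    then obtain h k where h: "u = (b, h, b')" "v = (b', k, b'')"
      "b \<in> Arr C" "b' \<in> Arr C" "b'' \<in> Arr C" "Cod C b = y" "Cod C b' = y" "Cod C b'' = y"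
      "h \<in> hom C (Dom C b) (Dom C b')" "k \<in> hom C (Dom C b') (Dom C b'')"
      "b' \<cdot>\<^bsub>C\<^esub> h = b" "b'' \<cdot>\<^bsub>C\<^esub> k = b'"
      unfolding slice_hom by blast
    have "b'' \<cdot>\<^bsub>C\<^esub> (k \<cdot>\<^bsub>C\<^esub> h) = b"
      unfolding h(11)[symmetric] by (rule comp_eq_comp) (use h homD[OF h(9)] homD[OF h(10)] in auto)
    then show "v \<cdot>\<^bsub>slice C y\<^esub> u \<in> hom (slice C y) b b''"
      using h Comp_in_hom[OF h(9,10)] by (auto simp: slice_hom)
  next
    fix u v w b b' b'' d
    assume "u \<in> hom (slice C y) b b'" "v \<in> hom (slice C y) b' b''" "w \<in> hom (slice C y) b'' d"
    then show "w \<cdot>\<^bsub>slice C y\<^esub> v \<cdot>\<^bsub>slice C y\<^esub> u = w \<cdot>\<^bsub>slice C y\<^esub> (v \<cdot>\<^bsub>slice C y\<^esub> u)"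
      using Comp_assoc by (auto simp: slice_hom)
  qed (auto simp: slice_Arr slice_hom Comp_Ident Ident_Comp Ident_in_hom)
qed

lemma product_cat_simps [simp]:
  "Obj (product_cat C D) = Obj C \<times> Obj D"
  "Arr (product_cat C D) = Arr C \<times> Arr D"
  "Dom (product_cat C D) (f, g) = (Dom C f, Dom D g)" "Cod (product_cat C D) (f, g) = (Cod C f, Cod D g)"
  "Ident (product_cat C D) (a, b) = (Ident C a, Ident D b)"
  "(f', g') \<cdot>\<^bsub>product_cat C D\<^esub> (f, g) = (f' \<cdot>\<^bsub>C\<^esub> f, g' \<cdot>\<^bsub>D\<^esub> g)"
  by (simp_all add: product_cat_def)

lemma product_hom:
  "(f, g) \<in> hom (product_cat C D) (a, b) (a', b') \<longleftrightarrow> f \<in> hom C a a' \<and> g \<in> hom D b b'"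
  by (auto simp: hom_def)

lemma category_product:
  assumes "category C" "category D"
  shows "category (product_cat C D)"
proof -
  interpret C: category C by (rule assms)
  interpret D: category D by (rule assms)
  show ?thesis
    by unfold_locales (auto simp: product_hom C.Comp_in_hom D.Comp_in_hom C.Ident_in_hom D.Ident_in_hom
      C.Comp_Ident D.Comp_Ident C.Ident_Comp D.Ident_Comp C.Comp_assoc D.Comp_assoc)
qed

section \<open>Pullbacks of sums in an extensive category\<close>

locale extensive_category = category C for C :: "('o, 'm) cat" (structure) +
  assumes extensive: "extensive C"
    and pullbacks: "has_pullbacks C"
    and terminal: "has_terminal C"
begin

abbreviation cp :: "'o \<Rightarrow> 'o \<Rightarrow> 'o" (infixl "\<oplus>" 65) where "a \<oplus> b \<equiv> coprod_ob C a b"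

lemma coprod_is_coproduct:
  assumes "a \<in> Obj C" "b \<in> Obj C"
  shows "is_coproduct C a b (a \<oplus> b) (inj1 C a b) (inj2 C a b)"
proof -
  have "\<exists>x. (\<lambda>(s, i, j). is_coproduct C a b s i j) x"
    using extensive assms unfolding extensive_def has_finite_coproducts_def by fastforce
  from someI_ex[OF this] show ?thesis
    by (auto simp: coprod_ob_def inj1_def inj2_def coprod_def split_def)
qed

lemma inj_type [simp]:
  assumes "a \<in> Obj C" "b \<in> Obj C"
  shows "a \<oplus> b \<in> Obj C"
    "inj1 C a b \<in> Arr C" "Dom C (inj1 C a b) = a" "Cod C (inj1 C a b) = a \<oplus> b"
    "inj2 C a b \<in> Arr C" "Dom C (inj2 C a b) = b" "Cod C (inj2 C a b) = a \<oplus> b"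
  using coproductD[OF coprod_is_coproduct[OF assms]] by auto

definition copair :: "'m \<Rightarrow> 'm \<Rightarrow> 'm" where
  "copair f g = (THE h. h \<in> hom C (Dom C f \<oplus> Dom C g) (Cod C f) \<and>
     h \<cdot> inj1 C (Dom C f) (Dom C g) = f \<and> h \<cdot> inj2 C (Dom C f) (Dom C g) = g)"

lemma copair:
  assumes "f \<in> Arr C" "g \<in> Arr C" "Cod C f = Cod C g"
  shows "copair f g \<in> hom C (Dom C f \<oplus> Dom C g) (Cod C f)"
    "copair f g \<cdot> inj1 C (Dom C f) (Dom C g) = f"
    "copair f g \<cdot> inj2 C (Dom C f) (Dom C g) = g"
proof -
  have "f \<in> hom C (Dom C f) (Cod C f)" "g \<in> hom C (Dom C g) (Cod C f)" "Cod C f \<in> Obj C"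
    using assms by (auto simp: hom_def)
  then have "\<exists>!h. h \<in> hom C (Dom C f \<oplus> Dom C g) (Cod C f) \<and>
     h \<cdot> inj1 C (Dom C f) (Dom C g) = f \<and> h \<cdot> inj2 C (Dom C f) (Dom C g) = g"
    using coprod_is_coproduct[of "Dom C f" "Dom C g"] assms unfolding is_coproduct_def by auto
  from theI'[OF this] show
    "copair f g \<in> hom C (Dom C f \<oplus> Dom C g) (Cod C f)"
    "copair f g \<cdot> inj1 C (Dom C f) (Dom C g) = f"
    "copair f g \<cdot> inj2 C (Dom C f) (Dom C g) = g"
    unfolding copair_def by blast+
qed

lemma copair_type [simp]:
  assumes "f \<in> Arr C" "g \<in> Arr C" "Cod C f = Cod C g"
  shows "copair f g \<in> Arr C" "Dom C (copair f g) = Dom C f \<oplus> Dom C g" "Cod C (copair f g) = Cod C g"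
  using copair(1)[OF assms] assms(3) by (auto simp: hom_def)

lemma copair_inj [simp]:
  assumes "f \<in> Arr C" "g \<in> Arr C" "Cod C f = Cod C g" "Dom C f = a" "Dom C g = b"
  shows "copair f g \<cdot> inj1 C a b = f" "copair f g \<cdot> inj2 C a b = g"
  using copair(2,3)[OF assms(1-3)] assms(4,5) by auto

lemma copair_inj_comp [simp]:
  assumes "f \<in> Arr C" "g \<in> Arr C" "Cod C f = Cod C g" "Dom C f = a" "Dom C g = b" "x \<in> Arr C"
  shows "Cod C x = a \<Longrightarrow> copair f g \<cdot> (inj1 C a b \<cdot> x) = f \<cdot> x"
    "Cod C x = b \<Longrightarrow> copair f g \<cdot> (inj2 C a b \<cdot> x) = g \<cdot> x"
  using assms by (auto intro!: comp_eq_comp)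

lemma copair_eqI:
  assumes "a \<in> Obj C" "b \<in> Obj C" "h \<in> Arr C" "k \<in> Arr C" "Dom C h = a \<oplus> b" "Dom C k = a \<oplus> b"
    "Cod C h = Cod C k" "h \<cdot> inj1 C a b = k \<cdot> inj1 C a b" "h \<cdot> inj2 C a b = k \<cdot> inj2 C a b"
  shows "h = k"
  by (rule coproduct_unique[OF coprod_is_coproduct[OF assms(1,2)], of _ "Cod C k"])
    (use assms in \<open>auto simp: hom_def\<close>)

lemma coprod_arr_copair:
  assumes "f \<in> Arr C" "g \<in> Arr C"
  shows "coprod_arr C f g =
    copair (inj1 C (Cod C f) (Cod C g) \<cdot> f) (inj2 C (Cod C f) (Cod C g) \<cdot> g)"
  using assms by (simp add: coprod_arr_def copair_def)

lemma coprod_arr_type [simp]: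
  assumes "f \<in> Arr C" "g \<in> Arr C"
  shows "coprod_arr C f g \<in> Arr C" "Dom C (coprod_arr C f g) = Dom C f \<oplus> Dom C g"
    "Cod C (coprod_arr C f g) = Cod C f \<oplus> Cod C g"
  using assms by (auto simp: coprod_arr_copair)

lemma coprod_arr_inj [simp]:
  assumes "f \<in> Arr C" "g \<in> Arr C" "Dom C f = a" "Dom C g = b"
  shows "coprod_arr C f g \<cdot> inj1 C a b = inj1 C (Cod C f) (Cod C g) \<cdot> f"
    "coprod_arr C f g \<cdot> inj2 C a b = inj2 C (Cod C f) (Cod C g) \<cdot> g"
  using assms by (auto simp: coprod_arr_copair)

lemma coprod_arr_inj_comp [simp]:
  assumes "f \<in> Arr C" "g \<in> Arr C" "Dom C f = a" "Dom C g = b" "x \<in> Arr C"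
  shows "Cod C x = a \<Longrightarrow> coprod_arr C f g \<cdot> (inj1 C a b \<cdot> x) = inj1 C (Cod C f) (Cod C g) \<cdot> (f \<cdot> x)"
    "Cod C x = b \<Longrightarrow> coprod_arr C f g \<cdot> (inj2 C a b \<cdot> x) = inj2 C (Cod C f) (Cod C g) \<cdot> (g \<cdot> x)"
  using assms by (auto simp: coprod_arr_copair)

lemma coprod_equivalence:
  assumes "a \<in> Obj C" "b \<in> Obj C"
  shows "equivalence (product_cat (slice C a) (slice C b)) (slice C (a \<oplus> b)) (coprod_functor C)"
  using extensive assms by (simp add: extensive_def)

lemma category_slices: "category (product_cat (slice C a) (slice C b))"
  by (intro category_product category_slice category_axioms)

text \<open>Full faithfulness of the coproduct functor, evaluated at the object \<open>(0 \<rightarrow> A, v : W \<rightarrow> B)\<close>.\<close>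

lemma chosen_injection_pullback:
  assumes f: "f \<in> Arr C" and g: "g \<in> Arr C"
  shows "is_pullback C (coprod_arr C f g) (inj2 C (Cod C f) (Cod C g)) (Dom C g)
    (inj2 C (Dom C f) (Dom C g)) g"
proof -
  let ?A = "Cod C f" and ?B = "Cod C g" and ?a = "Dom C f" and ?b = "Dom C g"
  obtain z where z: "is_initial C z"
    using extensive by (auto simp: extensive_def has_finite_coproducts_def)
  have z_ex: "\<exists>k. k \<in> hom C z c" if "c \<in> Obj C" for c using z that unfolding is_initial_def by blast
  have z_un: "k = k'" if "k \<in> hom C z c" "k' \<in> hom C z c" for k k' c
    using z that hom_obj(2)[OF that(1)] unfolding is_initial_def by blast
  have [simp]: "z \<in> Obj C" using z by (simp add: is_initial_def)
  let ?F = "coprod_functor C" and ?P = "product_cat (slice C ?A) (slice C ?B)"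
  have eq: "equivalence ?P (slice C (?A \<oplus> ?B)) ?F"
    using coprod_equivalence f g by simp
  show ?thesis
  proof (rule pullbackI)
    fix w u v
    assume u: "u \<in> hom C w (Dom C (coprod_arr C f g))" and v: "v \<in> hom C w (Dom C (inj2 C ?A ?B))"
      and e: "coprod_arr C f g \<cdot> u = inj2 C ?A ?B \<cdot> v"
    have [simp]: "w \<in> Obj C" using hom_obj u by blast
    obtain i where i: "i \<in> hom C z ?A" using z_ex[of ?A] f by auto
    obtain j where j: "j \<in> hom C z (?a \<oplus> ?b)" using z_ex[of "?a \<oplus> ?b"] f g by auto
    note t = homD[OF i] homD[OF j] homD[OF u] homD[OF v]
    \<comment> \<open>Fullness concerns only arrows between values of the coproduct functor. Adding
      the initial object as an empty first summand of \<open>W\<close> turns \<open>u\<close> into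
      such an arrow.\<close>
    have "(coprod_arr C i v, copair j u, coprod_arr C f g) \<in>
      hom (slice C (?A \<oplus> ?B)) (FObj ?F (i, v)) (FObj ?F (f, g))"
    proof -
      have "coprod_arr C f g \<cdot> copair j u = coprod_arr C i v"
      proof (rule copair_eqI[of z w])
        show "(coprod_arr C f g \<cdot> copair j u) \<cdot> inj1 C z w = coprod_arr C i v \<cdot> inj1 C z w"
          by (rule z_un[of _ "?A \<oplus> ?B"]) (use t f g in \<open>auto simp: hom_def\<close>)
      qed (use t f g e in auto)
      then show ?thesis using t f g by (auto simp: coprod_functor_def slice_hom homI)
    qed
    then obtain c where c: "c \<in> hom ?P (i, v) (f, g)"
      "FArr ?F c = (coprod_arr C i v, copair j u, coprod_arr C f g)"
      by (rule equivalence_full[OF category_slices category_slice[OF category_axioms] eq, rotated 2])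
        (use t f g in auto)
    obtain i1 h i2 v1 k v2 where ck: "c = ((i1, h, i2), (v1, k, v2))" by (metis surj_pair)
    have h: "h \<in> hom C z ?a" and k: "k \<in> hom C w ?b" "g \<cdot> k = v"
      using c(1) t by (auto simp: ck product_hom slice_hom)
    have "coprod_arr C h k = copair j u" using c(2) by (simp add: ck coprod_functor_def)
    then have "coprod_arr C h k \<cdot> inj2 C z w = copair j u \<cdot> inj2 C z w" by simp
    then have "inj2 C ?a ?b \<cdot> k = u" using h k t f g by (simp add: hom_def)
    then show "\<exists>h. h \<in> hom C w ?b \<and> inj2 C ?a ?b \<cdot> h = u \<and> g \<cdot> h = v" using k by blast
  next
    fix w h k assume h: "h \<in> hom C w ?b" and k: "k \<in> hom C w ?b"
      and e: "inj2 C ?a ?b \<cdot> h = inj2 C ?a ?b \<cdot> k" "g \<cdot> h = g \<cdot> k"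
    obtain i where i: "i \<in> hom C z ?a" using z_ex[of ?a] f by auto
    have w: "w \<in> Obj C" using hom_obj h by blast
    note t = homD[OF i] homD[OF h] homD[OF k] w
    \<comment> \<open>Again the initial object fills the first summand: \<open>h\<close> and
      \<open>k\<close> become parallel arrows of the product of slices with equal images.\<close>
    have "coprod_arr C i h = coprod_arr C i k"
      by (rule copair_eqI[of z w]) (use t f g e in auto)
    then have "((f \<cdot> i, i, f), (g \<cdot> h, h, g)) = ((f \<cdot> i, i, f), (g \<cdot> k, k, g))"
      using t f g e
      by (intro equivalence_faithful[OF category_slices eq])
        (auto simp: coprod_functor_def slice_Arr hom_def)
    then show "h = k" by simp
  qed (use f g in \<open>auto simp: hom_def\<close>)
qed

lemma coproduct_comparison:
  assumes c: "is_coproduct C a b s i j" and c': "is_coproduct C a b s' i' j'"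
  obtains e e' where "e \<in> hom C s s'" "e' \<in> hom C s' s" "e' \<cdot> e = Ident C s" "e \<cdot> e' = Ident C s'"
    "e \<cdot> i = i'" "e \<cdot> j = j'" "e' \<cdot> i' = i" "e' \<cdot> j' = j"
proof -
  note t = coproductD[OF c] coproductD[OF c']
  obtain e where e: "e \<in> hom C s s'" "e \<cdot> i = i'" "e \<cdot> j = j'"
    using coproduct_factor[OF c, of i' s' j'] t by (auto simp: hom_def)
  obtain e' where e': "e' \<in> hom C s' s" "e' \<cdot> i' = i" "e' \<cdot> j' = j"
    using coproduct_factor[OF c', of i s j] t by (auto simp: hom_def)
  have "e' \<cdot> e = Ident C s"
    by (rule coproduct_unique[OF c]) (use e e' t in \<open>auto simp: hom_def\<close>)
  moreover have "e \<cdot> e' = Ident C s'"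
    by (rule coproduct_unique[OF c']) (use e e' t in \<open>auto simp: hom_def\<close>)
  ultimately show ?thesis using that e e' by blast
qed

text \<open>The comparison isomorphisms \<open>e\<close> and \<open>d\<close> move the square for
  the chosen sums to arbitrary coproduct cocones. That freedom matters because
  \<open>arrows X\<close> is used with two decompositions, of which only one is the chosen
  sum.\<close>

lemma injection_pullback:
  assumes c: "is_coproduct C a b s i j" and c': "is_coproduct C a' b' s' i' j'"
    and h: "h \<in> hom C s s'" and f: "f \<in> hom C a a'" and g: "g \<in> hom C b b'"
    and hi: "h \<cdot> i = i' \<cdot> f" and hj: "h \<cdot> j = j' \<cdot> g"
  shows "is_pullback C h j' b j g"
proof -
  note t = coproductD[OF c] coproductD[OF c'] homD[OF h] homD[OF f] homD[OF g]
  have ch: "is_coproduct C a b (a \<oplus> b) (inj1 C a b) (inj2 C a b)"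
    "is_coproduct C a' b' (a' \<oplus> b') (inj1 C a' b') (inj2 C a' b')"
    using coprod_is_coproduct t by auto
  obtain e e' where e: "e \<in> hom C s (a \<oplus> b)" "e' \<in> hom C (a \<oplus> b) s" "e' \<cdot> e = Ident C s"
    "e \<cdot> e' = Ident C (a \<oplus> b)" "e \<cdot> i = inj1 C a b" "e \<cdot> j = inj2 C a b"
    "e' \<cdot> inj1 C a b = i" "e' \<cdot> inj2 C a b = j"
    by (rule coproduct_comparison[OF c ch(1)]) auto
  obtain d d' where d: "d \<in> hom C s' (a' \<oplus> b')" "d' \<in> hom C (a' \<oplus> b') s'" "d' \<cdot> d = Ident C s'"
    "d \<cdot> d' = Ident C (a' \<oplus> b')" "d \<cdot> i' = inj1 C a' b'" "d \<cdot> j' = inj2 C a' b'"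
    "d' \<cdot> inj1 C a' b' = i'" "d' \<cdot> inj2 C a' b' = j'"
    by (rule coproduct_comparison[OF c' ch(2)]) auto
  note t' = t homD[OF e(1)] homD[OF e(2)] homD[OF d(1)] homD[OF d(2)]
  have pb: "is_pullback C (coprod_arr C f g) (inj2 C a' b') b (inj2 C a b) g"
    using chosen_injection_pullback[of f g] t by simp
  have dh: "d \<cdot> h = coprod_arr C f g \<cdot> e"
  proof (rule coproduct_unique[OF c])
    show "(d \<cdot> h) \<cdot> i = (coprod_arr C f g \<cdot> e) \<cdot> i" using t' d e comp_eq_comp[OF d(5), of f] by (simp add: hi)
    show "(d \<cdot> h) \<cdot> j = (coprod_arr C f g \<cdot> e) \<cdot> j" using t' d e comp_eq_comp[OF d(6), of g] by (simp add: hj)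
  qed (use t' in \<open>auto simp: hom_def\<close>)
  show ?thesis
  proof (rule pullbackI)
    fix w u v assume u: "u \<in> hom C w (Dom C h)" and v: "v \<in> hom C w (Dom C j')" and eq: "h \<cdot> u = j' \<cdot> v"
    note uv = homD[OF u] homD[OF v]
    have "coprod_arr C f g \<cdot> (e \<cdot> u) = inj2 C a' b' \<cdot> v"
      using comp_eq_comp[OF dh[symmetric], of u] comp_eq_comp[OF d(6), of v] uv t' eq by simp
    then obtain k where k: "k \<in> hom C w b" "inj2 C a b \<cdot> k = e \<cdot> u" "g \<cdot> k = v"
      using pullback_factor[OF pb, of "e \<cdot> u" w v] uv t' by (auto simp: hom_def)
    have "e' \<cdot> (e \<cdot> u) = u" using comp_eq_comp[OF e(3), of u] uv t' by simp
    then have "j \<cdot> k = u" using comp_eq_comp[OF e(8), of k] k t' by (simp add: hom_def)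
    then show "\<exists>h. h \<in> hom C w b \<and> j \<cdot> h = u \<and> g \<cdot> h = v" using k by blast
  next
    fix w k k' assume a: "k \<in> hom C w b" "k' \<in> hom C w b" "j \<cdot> k = j \<cdot> k'" "g \<cdot> k = g \<cdot> k'"
    have "inj2 C a b \<cdot> k = inj2 C a b \<cdot> k'"
      using comp_eq_comp[OF e(6), of k] comp_eq_comp[OF e(6), of k'] a t' by (simp add: hom_def)
    then show "k = k'" using pullback_unique[OF pb] a by blast
  qed (use t hj in \<open>auto simp: hom_def\<close>)
qed

lemma coprod_arr_injection_pullback:
  assumes f: "f \<in> Arr C" and g: "g \<in> Arr C"
  shows "is_pullback C (coprod_arr C f g) (inj1 C (Cod C f) (Cod C g)) (Dom C f)
    (inj1 C (Dom C f) (Dom C g)) f"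
  by (rule injection_pullback[OF coproduct_sym[OF coprod_is_coproduct] coproduct_sym[OF coprod_is_coproduct]])
    (use f g in \<open>auto simp: hom_def\<close>)

text \<open>Essential surjectivity of the coproduct functor: \<open>w\<close>, as an object of the
  slice over the sum, is isomorphic to some \<open>f + g\<close>, and the isomorphism carries the
  coproduct cocone over to the domain of \<open>w\<close>. This permits case distinctions on
  generalised elements of a sum.\<close>

lemma coproduct_decompose:
  assumes "w \<in> Arr C" "Cod C w = a \<oplus> b" "a \<in> Obj C" "b \<in> Obj C"
  obtains x y i j f g where "is_coproduct C x y (Dom C w) i j" "f \<in> hom C x a" "g \<in> hom C y b"
    "w \<cdot> i = inj1 C a b \<cdot> f" "w \<cdot> j = inj2 C a b \<cdot> g"
proof -
  have "w \<in> Obj (slice C (a \<oplus> b))" using assms by simp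
  from equivalence_surj[OF coprod_equivalence[OF assms(3,4)] this category_slice[OF category_axioms]]
  obtain c e where c: "c \<in> Obj (product_cat (slice C a) (slice C b))"
    and e: "e \<in> hom (slice C (a \<oplus> b)) (FObj (coprod_functor C) c) w" "iso (slice C (a \<oplus> b)) e" .
  obtain f g where fg: "c = (f, g)" "f \<in> Arr C" "Cod C f = a" "g \<in> Arr C" "Cod C g = b"
    using c by (cases c) auto
  have "\<exists>m n. m \<in> hom C (Dom C f \<oplus> Dom C g) (Dom C w) \<and> n \<in> hom C (Dom C w) (Dom C f \<oplus> Dom C g) \<and>
    n \<cdot> m = Ident C (Dom C f \<oplus> Dom C g) \<and> m \<cdot> n = Ident C (Dom C w) \<and> w \<cdot> m = coprod_arr C f g"
    using e fg unfolding iso_def by (fastforce simp: slice_hom coprod_functor_def)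
  then obtain m n where m: "m \<in> hom C (Dom C f \<oplus> Dom C g) (Dom C w)" "n \<in> hom C (Dom C w) (Dom C f \<oplus> Dom C g)"
    "n \<cdot> m = Ident C (Dom C f \<oplus> Dom C g)" "m \<cdot> n = Ident C (Dom C w)" and wm: "w \<cdot> m = coprod_arr C f g"
    by blast
  note t = homD[OF m(1)] homD[OF m(2)]
  show ?thesis
  proof (rule that)
    show "is_coproduct C (Dom C f) (Dom C g) (Dom C w)
      (m \<cdot> inj1 C (Dom C f) (Dom C g)) (m \<cdot> inj2 C (Dom C f) (Dom C g))"
      by (rule coproduct_iso[OF coprod_is_coproduct m]) (use fg in auto)
    show "w \<cdot> (m \<cdot> inj1 C (Dom C f) (Dom C g)) = inj1 C a b \<cdot> f"
      "w \<cdot> (m \<cdot> inj2 C (Dom C f) (Dom C g)) = inj2 C a b \<cdot> g"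
      using comp_eq_comp[OF wm] fg t assms by auto
  qed (use fg in \<open>auto simp: hom_def\<close>)
qed

text \<open>Universality of sums. A test object splits into the part lying over the first summand
  and the part lying over the second; each part is handled by its own pullback and the results are
  glued.\<close>

lemma copair_pullback:
  assumes p: "is_pullback C h a x p q" and p': "is_pullback C h b x' p' q'"
  shows "is_pullback C h (copair a b) (x \<oplus> x') (copair p p') (coprod_arr C q q')"
proof -
  note t = pullbackD[OF p] pullbackD[OF p']
  let ?A = "Dom C a" and ?B = "Dom C b"
  have AB: "?A \<in> Obj C" "?B \<in> Obj C" using t by auto
  have q1: "is_pullback C (coprod_arr C q q') (inj2 C ?A ?B) x' (inj2 C x x') q'"
    using chosen_injection_pullback[of q q'] t by simp
  have q2: "is_pullback C (coprod_arr C q q') (inj1 C ?A ?B) x (inj1 C x x') q"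
    using coprod_arr_injection_pullback[of q q'] t by simp
  show ?thesis
  proof (rule pullbackI)
    show "h \<cdot> copair p p' = copair a b \<cdot> coprod_arr C q q'"
      by (rule copair_eqI[of x x']) (use t in auto)
  next
    fix w u v assume u: "u \<in> hom C w (Dom C h)" and v: "v \<in> hom C w (Dom C (copair a b))"
      and e: "h \<cdot> u = copair a b \<cdot> v"
    have w: "w \<in> Obj C" using hom_obj u by blast
    have v': "v \<in> Arr C" "Cod C v = ?A \<oplus> ?B" "Dom C v = w" using v t by (auto simp: hom_def)
    obtain y z i j f g where d: "is_coproduct C y z w i j" "f \<in> hom C y ?A" "g \<in> hom C z ?B"
      "v \<cdot> i = inj1 C ?A ?B \<cdot> f" "v \<cdot> j = inj2 C ?A ?B \<cdot> g"
      using coproduct_decompose[OF v'(1,2) AB, unfolded v'(3)] by blast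
    note dt = coproductD[OF d(1)] homD[OF d(2)] homD[OF d(3)] homD[OF u]
    have "h \<cdot> (u \<cdot> i) = (copair a b \<cdot> v) \<cdot> i" "h \<cdot> (u \<cdot> j) = (copair a b \<cdot> v) \<cdot> j"
      using dt t by (auto intro: comp_eq_comp[OF e])
    moreover have "(copair a b \<cdot> v) \<cdot> i = copair a b \<cdot> (v \<cdot> i)" "(copair a b \<cdot> v) \<cdot> j = copair a b \<cdot> (v \<cdot> j)"
      by (rule comp_assoc; use dt t v' in simp)+
    moreover have "copair a b \<cdot> (inj1 C ?A ?B \<cdot> f) = a \<cdot> f" "copair a b \<cdot> (inj2 C ?A ?B \<cdot> g) = b \<cdot> g"
      using dt(10-15) t by simp_all
    ultimately have huv: "h \<cdot> (u \<cdot> i) = a \<cdot> f" "h \<cdot> (u \<cdot> j) = b \<cdot> g"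
      using d(4,5) by simp_all
    have ui: "u \<cdot> i \<in> hom C y (Dom C h)" "u \<cdot> j \<in> hom C z (Dom C h)"
      using dt by (auto intro!: homI)
    obtain k1 where k1: "k1 \<in> hom C y x" "p \<cdot> k1 = u \<cdot> i" "q \<cdot> k1 = f"
      using pullback_factor[OF p ui(1) d(2) huv(1)] .
    obtain k2 where k2: "k2 \<in> hom C z x'" "p' \<cdot> k2 = u \<cdot> j" "q' \<cdot> k2 = g"
      using pullback_factor[OF p' ui(2) d(3) huv(2)] .
    obtain k where k: "k \<in> hom C w (x \<oplus> x')" "k \<cdot> i = inj1 C x x' \<cdot> k1" "k \<cdot> j = inj2 C x x' \<cdot> k2"
      by (rule coproduct_factor[OF d(1), of "inj1 C x x' \<cdot> k1" "x \<oplus> x'" "inj2 C x x' \<cdot> k2"])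
        (use k1 k2 t in \<open>auto simp: hom_def\<close>)
    note kt = homD[OF k1(1)] homD[OF k2(1)] homD[OF k(1)]
    have "copair p p' \<cdot> k = u"
      by (rule coproduct_unique[OF d(1)]) (use k1 k2 k kt dt t in \<open>auto simp: hom_def\<close>)
    moreover have "coprod_arr C q q' \<cdot> k = v"
      by (rule coproduct_unique[OF d(1)]) (use k1 k2 k kt dt t v' d in \<open>auto simp: hom_def\<close>)
    ultimately show "\<exists>k. k \<in> hom C w (x \<oplus> x') \<and> copair p p' \<cdot> k = u \<and> coprod_arr C q q' \<cdot> k = v"
      using k by blast
  next
    fix w k k' assume k: "k \<in> hom C w (x \<oplus> x')" and k': "k' \<in> hom C w (x \<oplus> x')"
      and e: "copair p p' \<cdot> k = copair p p' \<cdot> k'" "coprod_arr C q q' \<cdot> k = coprod_arr C q q' \<cdot> k'"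
    have w: "w \<in> Obj C" using hom_obj k by blast
    \<comment> \<open>\<open>k\<close> and \<open>k'\<close> have the same composite with
      \<open>coprod_arr C q q'\<close>, so a single splitting of the test object serves
      both.\<close>
    let ?v = "coprod_arr C q q' \<cdot> k"
    note kt = homD[OF k] homD[OF k']
    have v': "?v \<in> Arr C" "Cod C ?v = ?A \<oplus> ?B" "Dom C ?v = w" using kt t by auto
    obtain y z i j f g where d: "is_coproduct C y z w i j" "f \<in> hom C y ?A" "g \<in> hom C z ?B"
      "?v \<cdot> i = inj1 C ?A ?B \<cdot> f" "?v \<cdot> j = inj2 C ?A ?B \<cdot> g"
      using coproduct_decompose[OF v'(1,2) AB, unfolded v'(3)] by blast
    note dt = coproductD[OF d(1)] homD[OF d(2)] homD[OF d(3)]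
    have a: "coprod_arr C q q' \<cdot> (k \<cdot> i) = inj1 C ?A ?B \<cdot> f" "coprod_arr C q q' \<cdot> (k' \<cdot> i) = inj1 C ?A ?B \<cdot> f"
      "coprod_arr C q q' \<cdot> (k \<cdot> j) = inj2 C ?A ?B \<cdot> g" "coprod_arr C q q' \<cdot> (k' \<cdot> j) = inj2 C ?A ?B \<cdot> g"
      using d(4,5) dt kt t comp_eq_comp[OF e(2), of i] comp_eq_comp[OF e(2), of j] by auto
    have b: "copair p p' \<cdot> (k \<cdot> i) = copair p p' \<cdot> (k' \<cdot> i)" "copair p p' \<cdot> (k \<cdot> j) = copair p p' \<cdot> (k' \<cdot> j)"
      using comp_eq_comp[OF e(1), of i] comp_eq_comp[OF e(1), of j] dt kt t by auto
    show "k = k'"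
    proof (rule coproduct_unique[OF d(1) k k'])
      \<comment> \<open>By the injection square \<open>q2\<close>, a map lying over the first
        summand factors through \<open>x\<close>, and there \<open>p\<close> and \<open>q\<close>
        detect equality.\<close>
      obtain l where l: "l \<in> hom C y x" "inj1 C x x' \<cdot> l = k \<cdot> i" "q \<cdot> l = f"
        using pullback_factor[OF q2, of "k \<cdot> i" y f] a dt kt t by (auto simp: hom_def)
      obtain l' where l': "l' \<in> hom C y x" "inj1 C x x' \<cdot> l' = k' \<cdot> i" "q \<cdot> l' = f"
        using pullback_factor[OF q2, of "k' \<cdot> i" y f] a dt kt t by (auto simp: hom_def)
      have "copair p p' \<cdot> (inj1 C x x' \<cdot> l) = copair p p' \<cdot> (inj1 C x x' \<cdot> l')" using b l l' by simp
      then have "p \<cdot> l = p \<cdot> l'" using l(1) l'(1) t by (simp add: hom_def)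
      then show "k \<cdot> i = k' \<cdot> i" using pullback_unique[OF p l(1) l'(1)] l l' by auto
    next
      obtain l where l: "l \<in> hom C z x'" "inj2 C x x' \<cdot> l = k \<cdot> j" "q' \<cdot> l = g"
        using pullback_factor[OF q1, of "k \<cdot> j" z g] a dt kt t by (auto simp: hom_def)
      obtain l' where l': "l' \<in> hom C z x'" "inj2 C x x' \<cdot> l' = k' \<cdot> j" "q' \<cdot> l' = g"
        using pullback_factor[OF q1, of "k' \<cdot> j" z g] a dt kt t by (auto simp: hom_def)
      have "copair p p' \<cdot> (inj2 C x x' \<cdot> l) = copair p p' \<cdot> (inj2 C x x' \<cdot> l')" using b l l' by simp
      then have "p' \<cdot> l = p' \<cdot> l'" using l(1) l'(1) t by (simp add: hom_def)
      then show "k \<cdot> j = k' \<cdot> j" using pullback_unique[OF p' l(1) l'(1)] l l' by auto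
    qed
  qed (use t in \<open>auto simp: hom_def\<close>)
qed

text \<open>Each of the two squares is pasted onto the pullback square of its injection, and
  \<open>copair_pullback\<close> joins the results.\<close>

lemma coprod_arr_pullback:
  assumes p: "is_pullback C f g x p q" and p': "is_pullback C f' g' x' p' q'"
  shows "is_pullback C (coprod_arr C f f') (coprod_arr C g g') (x \<oplus> x') (coprod_arr C p p') (coprod_arr C q q')"
proof -
  note t = pullbackD[OF p] pullbackD[OF p']
  have 1: "is_pullback C (coprod_arr C f f') (inj1 C (Cod C f) (Cod C f') \<cdot> g) x
      (inj1 C (Dom C f) (Dom C f') \<cdot> p) q"
    using pullback_paste[OF coprod_arr_injection_pullback[of f f', unfolded t] p] t by simp
  have 2: "is_pullback C (coprod_arr C f f') (inj2 C (Cod C f) (Cod C f') \<cdot> g') x'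
      (inj2 C (Dom C f) (Dom C f') \<cdot> p') q'"
    using pullback_paste[OF chosen_injection_pullback[of f f', unfolded t] p'] t by simp
  show ?thesis
    using copair_pullback[OF 1 2] t by (simp add: coprod_arr_copair)
qed

end

section \<open>The category of internal categories\<close>

lemma Cat_simps [simp]:
  "Obj (Cat E) = {A. internal_category E A}" "Arr (Cat E) = {F. internal_functor E F}"
  "Dom (Cat E) = fdom" "Cod (Cat E) = fcod" "Ident (Cat E) = id_ifun E" "Comp (Cat E) = comp_ifun E"
  "Cell (Cat E) = {\<alpha>. internal_nat_trans E \<alpha>}" "Src (Cat E) = tsrc" "Trg (Cat E) = ttrg"
  "Ident2 (Cat E) = id_inat E" "HComp (Cat E) = hcomp_inat E"
  by (simp_all add: Cat_def)

lemma comp_ifun_simps [simp]: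
  "fdom (comp_ifun E G F) = fdom F" "fcod (comp_ifun E G F) = fcod G"
  "F0 (comp_ifun E G F) = F0 G \<cdot>\<^bsub>E\<^esub> F0 F" "F1 (comp_ifun E G F) = F1 G \<cdot>\<^bsub>E\<^esub> F1 F"
  by (simp_all add: comp_ifun_def)

lemma id_ifun_simps [simp]:
  "fdom (id_ifun E A) = A" "fcod (id_ifun E A) = A"
  "F0 (id_ifun E A) = Ident E (I0 A)" "F1 (id_ifun E A) = Ident E (I1 A)"
  by (simp_all add: id_ifun_def)

lemma ifun_eqI:
  fixes F G :: "('o, 'm) ifun"
  assumes "fdom F = fdom G" "fcod F = fcod G" "F0 F = F0 G" "F1 F = F1 G"
  shows "F = G"
  using assms by simp

context category
begin

section \<open>Composition of generalised elements of an internal category\<close>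

definition composable :: "('o, 'm) icat \<Rightarrow> 'm \<Rightarrow> 'm \<Rightarrow> bool" where
  "composable A g f \<longleftrightarrow> g \<in> Arr C \<and> f \<in> Arr C \<and> Cod C g = I1 A \<and> Cod C f = I1 A \<and> Dom C g = Dom C f \<and>
     isrc A \<cdot> g = itrg A \<cdot> f"

text \<open>Associativity is left out because proving it for \<open>two X\<close> uses the lemmas on composites below.\<close>

definition unital :: "('o, 'm) icat \<Rightarrow> bool" where
  "unital A \<longleftrightarrow> I0 A \<in> Obj C \<and> I1 A \<in> Obj C \<and>
     isrc A \<in> hom C (I1 A) (I0 A) \<and> itrg A \<in> hom C (I1 A) (I0 A) \<and> iid A \<in> hom C (I0 A) (I1 A) \<and>
     is_pullback C (isrc A) (itrg A) (I2 A) (ipr1 A) (ipr2 A) \<and> icomp A \<in> hom C (I2 A) (I1 A) \<and>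
     isrc A \<cdot> iid A = Ident C (I0 A) \<and> itrg A \<cdot> iid A = Ident C (I0 A) \<and>
     isrc A \<cdot> icomp A = isrc A \<cdot> ipr2 A \<and> itrg A \<cdot> icomp A = itrg A \<cdot> ipr1 A \<and>
     ecomp C A (Ident C (I1 A)) (iid A \<cdot> isrc A) = Ident C (I1 A) \<and>
     ecomp C A (iid A \<cdot> itrg A) (Ident C (I1 A)) = Ident C (I1 A)"

lemma internal_category_unital: "internal_category C A \<Longrightarrow> unital A"
  by (simp add: internal_category_def unital_def)

lemma internal_categoryI:
  assumes A: "unital A"
    and "\<And>f g h. composable A g f \<Longrightarrow> composable A h g \<Longrightarrow>
      ecomp C A (ecomp C A h g) f = ecomp C A h (ecomp C A g f)"
  shows "internal_category C A"
  unfolding internal_category_def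
proof (intro conjI ballI impI)
  fix T f g h
  assume "f \<in> hom C T (I1 A)" "g \<in> hom C T (I1 A)" "h \<in> hom C T (I1 A)"
    "isrc A \<cdot> g = itrg A \<cdot> f \<and> isrc A \<cdot> h = itrg A \<cdot> g"
  then show "ecomp C A (ecomp C A h g) f = ecomp C A h (ecomp C A g f)"
    by (intro assms(2)) (auto simp: composable_def hom_def)
qed (use A in \<open>simp_all add: unital_def\<close>)

lemma icat_type:
  assumes "unital A"
  shows "I0 A \<in> Obj C" "I1 A \<in> Obj C"
    "isrc A \<in> Arr C" "Dom C (isrc A) = I1 A" "Cod C (isrc A) = I0 A"
    "itrg A \<in> Arr C" "Dom C (itrg A) = I1 A" "Cod C (itrg A) = I0 A"
    "iid A \<in> Arr C" "Dom C (iid A) = I0 A" "Cod C (iid A) = I1 A"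
    "icomp A \<in> Arr C" "Dom C (icomp A) = I2 A" "Cod C (icomp A) = I1 A"
    "I2 A \<in> Obj C" "ipr1 A \<in> Arr C" "Dom C (ipr1 A) = I2 A" "Cod C (ipr1 A) = I1 A"
    "ipr2 A \<in> Arr C" "Dom C (ipr2 A) = I2 A" "Cod C (ipr2 A) = I1 A"
  using assms by (auto simp: unital_def hom_def is_pullback_def)

lemma icat_eq:
  assumes "unital A"
  shows "isrc A \<cdot> iid A = Ident C (I0 A)" "itrg A \<cdot> iid A = Ident C (I0 A)"
    "isrc A \<cdot> icomp A = isrc A \<cdot> ipr2 A" "itrg A \<cdot> icomp A = itrg A \<cdot> ipr1 A"
    "isrc A \<cdot> ipr1 A = itrg A \<cdot> ipr2 A"
    "ecomp C A (Ident C (I1 A)) (iid A \<cdot> isrc A) = Ident C (I1 A)"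
    "ecomp C A (iid A \<cdot> itrg A) (Ident C (I1 A)) = Ident C (I1 A)"
  using assms by (auto simp: unital_def is_pullback_def)

lemma icat_pullback:
  assumes "unital A"
  shows "is_pullback C (isrc A) (itrg A) (I2 A) (ipr1 A) (ipr2 A)"
  using assms by (auto simp: unital_def)

text \<open>The hypotheses are only the pullback and the domains of its cospan, so that pairings can
  be computed while \<open>unital (two X)\<close> is still being proved.\<close>

lemma ipair_general:
  assumes A: "is_pullback C (isrc A) (itrg A) (I2 A) (ipr1 A) (ipr2 A)"
    and "Dom C (isrc A) = I1 A" "Dom C (itrg A) = I1 A" and c: "composable A g f"
  shows "ipair C A g f \<in> Arr C" "Dom C (ipair C A g f) = Dom C f" "Cod C (ipair C A g f) = I2 A"
    "ipr1 A \<cdot> ipair C A g f = g" "ipr2 A \<cdot> ipair C A g f = f"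
proof -
  have "Dom C f \<in> Obj C" using c by (auto simp: composable_def)
  then have "\<exists>!h. h \<in> hom C (Dom C g) (I2 A) \<and> ipr1 A \<cdot> h = g \<and> ipr2 A \<cdot> h = f"
    using A c assms(2,3) unfolding is_pullback_def composable_def by (auto simp: hom_def)
  from theI'[OF this] show "ipair C A g f \<in> Arr C" "Dom C (ipair C A g f) = Dom C f" "Cod C (ipair C A g f) = I2 A"
    "ipr1 A \<cdot> ipair C A g f = g" "ipr2 A \<cdot> ipair C A g f = f"
    using c unfolding ipair_def composable_def hom_def by auto
qed

lemmas ipair = ipair_general[OF icat_pullback icat_type(4,7)]

lemma ipair_eqI:
  assumes A: "is_pullback C (isrc A) (itrg A) (I2 A) (ipr1 A) (ipr2 A)"
    and "Dom C (isrc A) = I1 A" "Dom C (itrg A) = I1 A" and c: "composable A g f"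
    and h: "h \<in> Arr C" "Cod C h = I2 A" "ipr1 A \<cdot> h = g" "ipr2 A \<cdot> h = f"
  shows "ipair C A g f = h"
proof -
  note t = pullbackD[OF A]
  have "Dom C (ipr2 A \<cdot> h) = Dom C h" by (rule comp_type) (use t h(1,2) in simp_all)
  then have "Dom C h = Dom C f" by (simp add: h(4))
  then have "ipair C A g f \<in> hom C (Dom C f) (I2 A)" "h \<in> hom C (Dom C f) (I2 A)"
    using ipair_general[OF A assms(2,3) c] h(1,2) by (simp_all add: hom_def)
  then show ?thesis
    by (rule pullback_unique[OF A, of _ "Dom C f"])
      (simp_all only: ipair_general(4,5)[OF A assms(2,3) c] h(3,4))
qed

lemma ecomp_type:
  assumes A: "unital A" and c: "composable A g f"
  shows "ecomp C A g f \<in> Arr C" "Dom C (ecomp C A g f) = Dom C f" "Cod C (ecomp C A g f) = I1 A"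
    "isrc A \<cdot> ecomp C A g f = isrc A \<cdot> f" "itrg A \<cdot> ecomp C A g f = itrg A \<cdot> g"
proof -
  note t = icat_type[OF A] ipair[OF A A A c]
  show "ecomp C A g f \<in> Arr C" "Dom C (ecomp C A g f) = Dom C f" "Cod C (ecomp C A g f) = I1 A"
    using t by (auto simp: ecomp_def)
  have "isrc A \<cdot> (icomp A \<cdot> ipair C A g f) = (isrc A \<cdot> ipr2 A) \<cdot> ipair C A g f"
    "itrg A \<cdot> (icomp A \<cdot> ipair C A g f) = (itrg A \<cdot> ipr1 A) \<cdot> ipair C A g f"
    by (rule comp_eq_comp; simp add: t icat_eq(3,4)[OF A])+
  then show "isrc A \<cdot> ecomp C A g f = isrc A \<cdot> f" "itrg A \<cdot> ecomp C A g f = itrg A \<cdot> g"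
    using t by (auto simp: ecomp_def)
qed

text \<open>A pairing is determined by its projections, hence stable under reindexing. Laws stated
  at the identity of \<open>I1 A\<close> or at the generic composable pair therefore hold at every
  generalised element.\<close>

lemma ecomp_comp:
  assumes A: "unital A" and c: "composable A g f" and w: "w \<in> Arr C" "Cod C w = Dom C f"
  shows "composable A (g \<cdot> w) (f \<cdot> w)" "ecomp C A g f \<cdot> w = ecomp C A (g \<cdot> w) (f \<cdot> w)"
proof -
  note t = icat_type[OF A] ipair[OF A A A c] w
  have c': "g \<in> Arr C" "f \<in> Arr C" "Cod C g = I1 A" "Cod C f = I1 A" "Dom C g = Dom C f" "isrc A \<cdot> g = itrg A \<cdot> f"
    using c by (auto simp: composable_def)
  have "isrc A \<cdot> (g \<cdot> w) = (itrg A \<cdot> f) \<cdot> w" by (rule comp_eq_comp) (use t c' in auto)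
  then show cw: "composable A (g \<cdot> w) (f \<cdot> w)" using t c' by (simp add: composable_def)
  have "ipr1 A \<cdot> (ipair C A g f \<cdot> w) = g \<cdot> w" "ipr2 A \<cdot> (ipair C A g f \<cdot> w) = f \<cdot> w"
    by (rule comp_eq_comp; simp add: t c')+
  then have "ipair C A (g \<cdot> w) (f \<cdot> w) = ipair C A g f \<cdot> w"
    using t by (intro ipair_eqI[OF icat_pullback[OF A] _ _ cw]) auto
  then show "ecomp C A g f \<cdot> w = ecomp C A (g \<cdot> w) (f \<cdot> w)"
    using t by (simp add: ecomp_def)
qed

lemma ecomp_ident:
  assumes A: "unital A" and w: "w \<in> Arr C" "Cod C w = I1 A"
  shows "ecomp C A w (iid A \<cdot> (isrc A \<cdot> w)) = w" "ecomp C A (iid A \<cdot> (itrg A \<cdot> w)) w = w"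
proof -
  note t = icat_type[OF A] w
  have "isrc A \<cdot> Ident C (I1 A) = itrg A \<cdot> (iid A \<cdot> isrc A)"
    using comp_eq_comp[OF icat_eq(2)[OF A], of "isrc A"] t by simp
  then have 1: "composable A (Ident C (I1 A)) (iid A \<cdot> isrc A)"
    using t by (simp add: composable_def)
  show "ecomp C A w (iid A \<cdot> (isrc A \<cdot> w)) = w"
    using ecomp_comp(2)[OF A 1, of w] t by (simp add: icat_eq(6)[OF A])
  have "isrc A \<cdot> (iid A \<cdot> itrg A) = itrg A \<cdot> Ident C (I1 A)"
    using comp_eq_comp[OF icat_eq(1)[OF A], of "itrg A"] t by simp
  then have 2: "composable A (iid A \<cdot> itrg A) (Ident C (I1 A))"
    using t by (simp add: composable_def)
  show "ecomp C A (iid A \<cdot> (itrg A \<cdot> w)) w = w"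
    using ecomp_comp(2)[OF A 2, of w] t by (simp add: icat_eq(7)[OF A])
qed

lemma composable_projections:
  assumes "unital A"
  shows "composable A (ipr1 A) (ipr2 A)"
  using icat_type[OF assms] icat_eq[OF assms] by (simp add: composable_def)

lemma ecomp_projections:
  assumes A: "unital A"
  shows "ecomp C A (ipr1 A) (ipr2 A) = icomp A"
proof -
  have "ipair C A (ipr1 A) (ipr2 A) = Ident C (I2 A)"
    by (rule ipair_eqI[OF icat_pullback[OF A] icat_type(4,7)[OF A] composable_projections[OF A]])
      (simp_all add: icat_type[OF A])
  then show ?thesis using icat_type[OF A] by (simp add: ecomp_def)
qed

text \<open>\<open>F2\<close> unfolds to the pairing of the images of the two projections, so
  preservation of composition becomes an equation between generalised composites.\<close>

lemma internal_functorI: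
  assumes "internal_category C (fdom F)" "internal_category C (fcod F)"
    "F0 F \<in> Arr C" "Dom C (F0 F) = I0 (fdom F)" "Cod C (F0 F) = I0 (fcod F)"
    "F1 F \<in> Arr C" "Dom C (F1 F) = I1 (fdom F)" "Cod C (F1 F) = I1 (fcod F)"
    "isrc (fcod F) \<cdot> F1 F = F0 F \<cdot> isrc (fdom F)"
    "itrg (fcod F) \<cdot> F1 F = F0 F \<cdot> itrg (fdom F)"
    "F1 F \<cdot> iid (fdom F) = iid (fcod F) \<cdot> F0 F"
    "F1 F \<cdot> icomp (fdom F) = ecomp C (fcod F) (F1 F \<cdot> ipr1 (fdom F)) (F1 F \<cdot> ipr2 (fdom F))"
  shows "internal_functor C F"
  using assms by (simp add: internal_functor_def hom_def F2_def ecomp_def)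

lemma ifunD:
  assumes "internal_functor C F"
  shows "unital (fdom F)" "unital (fcod F)"
    "F0 F \<in> Arr C" "Dom C (F0 F) = I0 (fdom F)" "Cod C (F0 F) = I0 (fcod F)"
    "F1 F \<in> Arr C" "Dom C (F1 F) = I1 (fdom F)" "Cod C (F1 F) = I1 (fcod F)"
    "isrc (fcod F) \<cdot> F1 F = F0 F \<cdot> isrc (fdom F)"
    "itrg (fcod F) \<cdot> F1 F = F0 F \<cdot> itrg (fdom F)"
    "F1 F \<cdot> iid (fdom F) = iid (fcod F) \<cdot> F0 F"
    "F1 F \<cdot> icomp (fdom F) = ecomp C (fcod F) (F1 F \<cdot> ipr1 (fdom F)) (F1 F \<cdot> ipr2 (fdom F))"
    "internal_category C (fdom F)" "internal_category C (fcod F)"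
  using assms by (auto simp: internal_functor_def hom_def F2_def ecomp_def internal_category_unital)

lemma ifun_composable:
  assumes F: "internal_functor C F" and c: "composable (fdom F) g f"
  shows "composable (fcod F) (F1 F \<cdot> g) (F1 F \<cdot> f)"
proof -
  note d = ifunD[OF F]
  note t = icat_type[OF d(1)] icat_type[OF d(2)] d(3-8)
  have c': "g \<in> Arr C" "f \<in> Arr C" "Cod C g = I1 (fdom F)" "Cod C f = I1 (fdom F)" "Dom C g = Dom C f"
    "isrc (fdom F) \<cdot> g = itrg (fdom F) \<cdot> f"
    using c by (auto simp: composable_def)
  have "isrc (fcod F) \<cdot> (F1 F \<cdot> g) = (F0 F \<cdot> isrc (fdom F)) \<cdot> g"
    "itrg (fcod F) \<cdot> (F1 F \<cdot> f) = (F0 F \<cdot> itrg (fdom F)) \<cdot> f"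
    by (rule comp_eq_comp; simp add: t c' d(9,10))+
  then show ?thesis using t c' by (simp add: composable_def)
qed

text \<open>Preservation of composition at the generic composable pair, reindexed along
  \<open>ipair C (fdom F) g f\<close>.\<close>

lemma ifun_ecomp:
  assumes F: "internal_functor C F" and c: "composable (fdom F) g f"
  shows "F1 F \<cdot> ecomp C (fdom F) g f = ecomp C (fcod F) (F1 F \<cdot> g) (F1 F \<cdot> f)"
proof -
  note d = ifunD[OF F] and A = ifunD(1)[OF F]
  note t = icat_type[OF d(1)] icat_type[OF d(2)] d(3-8)
  note p = ipair[OF A A A c]
  have "F1 F \<cdot> ecomp C (fdom F) g f = (F1 F \<cdot> icomp (fdom F)) \<cdot> ipair C (fdom F) g f"
    by (simp add: ecomp_def t p)
  also have "\<dots> = ecomp C (fcod F) (F1 F \<cdot> ipr1 (fdom F)) (F1 F \<cdot> ipr2 (fdom F)) \<cdot> ipair C (fdom F) g f"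
    by (simp only: d(12))
  also have "\<dots> = ecomp C (fcod F) ((F1 F \<cdot> ipr1 (fdom F)) \<cdot> ipair C (fdom F) g f)
      ((F1 F \<cdot> ipr2 (fdom F)) \<cdot> ipair C (fdom F) g f)"
    by (rule ecomp_comp[OF d(2) ifun_composable[OF F composable_projections[OF A]]]) (simp_all add: t p)
  also have "\<dots> = ecomp C (fcod F) (F1 F \<cdot> g) (F1 F \<cdot> f)"
    by (simp add: t p)
  finally show ?thesis .
qed

lemma id_ifun_functor:
  assumes A: "internal_category C A"
  shows "internal_functor C (id_ifun C A)"
  using internal_category_unital[OF A] A
  by (intro internal_functorI) (simp_all add: icat_type ecomp_projections)

lemma comp_ifun_functor:
  assumes F: "internal_functor C F" and G: "internal_functor C G" and FG: "fcod F = fdom G"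
  shows "internal_functor C (comp_ifun C G F)"
proof -
  note d = ifunD[OF F, unfolded FG] and e = ifunD[OF G]
  note t = icat_type[OF d(1)] icat_type[OF e(1)] icat_type[OF e(2)] d(3-8) e(3-8)
  have c: "composable (fdom G) (F1 F \<cdot> ipr1 (fdom F)) (F1 F \<cdot> ipr2 (fdom F))"
    using ifun_composable[OF F composable_projections[OF d(1)]] by (simp add: FG)
  have "isrc (fcod G) \<cdot> (F1 G \<cdot> F1 F) = (F0 G \<cdot> isrc (fdom G)) \<cdot> F1 F"
    "itrg (fcod G) \<cdot> (F1 G \<cdot> F1 F) = (F0 G \<cdot> itrg (fdom G)) \<cdot> F1 F"
    by (rule comp_eq_comp; simp add: t e(9,10))+
  moreover have "F1 G \<cdot> (iid (fdom G) \<cdot> F0 F) = (iid (fcod G) \<cdot> F0 G) \<cdot> F0 F"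
    by (rule comp_eq_comp; simp add: t e(11))
  ultimately show ?thesis
    by (intro internal_functorI) (simp_all add: FG ifun_ecomp[OF G c] t d(9-14) e(14))
qed

lemma category_Cat: "category (Cat C)"
proof
  fix F G H a b c d
  assume "F \<in> hom (Cat C) a b" "G \<in> hom (Cat C) b c" "H \<in> hom (Cat C) c d"
  then have F: "internal_functor C F" "internal_functor C G" "internal_functor C H"
    "fcod F = fdom G" "fcod G = fdom H" by (auto simp: hom_def)
  show "H \<cdot>\<^bsub>Cat C\<^esub> G \<cdot>\<^bsub>Cat C\<^esub> F = H \<cdot>\<^bsub>Cat C\<^esub> (G \<cdot>\<^bsub>Cat C\<^esub> F)"
    by (intro ifun_eqI) (simp_all add: ifunD(3-8)[OF F(1)] ifunD(3-8)[OF F(2)] ifunD(3-8)[OF F(3)] F(4,5))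
next
  fix F a b assume "F \<in> hom (Cat C) a b"
  then have F: "internal_functor C F" "fdom F = a" "fcod F = b" by (auto simp: hom_def)
  show "F \<cdot>\<^bsub>Cat C\<^esub> Ident (Cat C) a = F" "Ident (Cat C) b \<cdot>\<^bsub>Cat C\<^esub> F = F"
    using ifunD(3-8)[OF F(1)] F(2,3) by (auto intro!: ifun_eqI)
qed (auto simp: hom_def id_ifun_functor comp_ifun_functor ifunD)

end

section \<open>The internal category generated by an object of arrows\<close>

context extensive_category
begin

definition one :: 'o where "one = (SOME t. is_terminal C t)"

definition bang :: "'o \<Rightarrow> 'm" where "bang a = (THE f. f \<in> hom C a one)"

lemma one_terminal: "is_terminal C one"
  using terminal someI_ex[of "is_terminal C"] by (simp add: one_def has_terminal_def)

lemma one_obj [simp]: "one \<in> Obj C"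
  using one_terminal by (simp add: is_terminal_def)

lemma bang_unique:
  assumes "f \<in> Arr C" "Cod C f = one"
  shows "f = bang (Dom C f)"
proof -
  have "\<exists>!g. g \<in> hom C (Dom C f) one" using one_terminal assms by (simp add: is_terminal_def)
  then show ?thesis
    unfolding bang_def by (rule the1_equality[symmetric]) (use assms in \<open>simp add: hom_def\<close>)
qed

lemma bang_type [simp]:
  assumes "a \<in> Obj C"
  shows "bang a \<in> Arr C" "Dom C (bang a) = a" "Cod C (bang a) = one"
proof -
  have "\<exists>!g. g \<in> hom C a one" using one_terminal assms by (simp add: is_terminal_def)
  from theI'[OF this] show "bang a \<in> Arr C" "Dom C (bang a) = a" "Cod C (bang a) = one"
    by (simp_all add: bang_def hom_def)
qed

lemma bang_comp [simp]:
  assumes "w \<in> Arr C" "Cod C w = a"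
  shows "bang a \<cdot> w = bang (Dom C w)"
  using bang_unique[of "bang a \<cdot> w"] assms dom_cod_obj(2)[OF assms(1)] by simp

lemma bang_one [simp]: "bang one = Ident C one"
  using bang_unique[of "Ident C one"] by simp

text \<open>The arrows of \<open>two X\<close> are the identities \<open>e0\<close>, \<open>e1\<close> of its two objects \<open>d0\<close>, \<open>d1\<close> and the members of
  \<open>edge X\<close>; \<open>into0\<close> and \<open>into1\<close> embed \<open>cone X = 1 + X\<close> as the edges together with \<open>e0\<close>, respectively \<open>e1\<close>.\<close>

definition ob2 where "ob2 = one \<oplus> one"
definition d0 where "d0 = inj1 C one one"
definition d1 where "d1 = inj2 C one one"
definition cone where "cone X = one \<oplus> X"
definition apex where "apex X = inj1 C one X"
definition base where "base X = inj2 C one X"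
definition arrows where "arrows X = one \<oplus> cone X"
definition e0 where "e0 X = inj1 C one (cone X)"
definition into1 where "into1 X = inj2 C one (cone X)"
definition e1 where "e1 X = into1 X \<cdot> apex X"
definition edge where "edge X = into1 X \<cdot> base X"
definition into0 where "into0 X = copair (e0 X) (edge X)"
definition src where "src X = copair d0 (copair d1 (d0 \<cdot> bang X))"
text \<open>A single \<open>copair\<close> over \<open>one \<oplus> cone X\<close>, since everything
  but \<open>e0\<close> ends at \<open>d1\<close>; in this shape it is a leg to which
  \<open>copair_pullback\<close> applies.\<close>

definition trg where "trg X = copair d0 (d1 \<cdot> bang (cone X))"

text \<open>In a composable pair, one of the two arrows is an identity: the first summand \<open>cone X\<close> of the
  object of pairs consists of the pairs whose second component is \<open>e0\<close>, the second summand of those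
  whose first component is \<open>e1\<close>.\<close>

definition two :: "'o \<Rightarrow> ('o, 'm) icat" where
  "two X = \<lparr>I0 = ob2, I1 = arrows X, I2 = cone X \<oplus> cone X, isrc = src X, itrg = trg X,
    iid = copair (e0 X) (e1 X),
    ipr1 = copair (into0 X) (e1 X \<cdot> bang (cone X)),
    ipr2 = copair (e0 X \<cdot> bang (cone X)) (into1 X),
    icomp = copair (into0 X) (into1 X)\<rparr>"

lemma two_simps [simp]:
  "I0 (two X) = ob2" "I1 (two X) = arrows X" "I2 (two X) = cone X \<oplus> cone X"
  "isrc (two X) = src X" "itrg (two X) = trg X" "iid (two X) = copair (e0 X) (e1 X)"
  "ipr1 (two X) = copair (into0 X) (e1 X \<cdot> bang (cone X))"
  "ipr2 (two X) = copair (e0 X \<cdot> bang (cone X)) (into1 X)"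
  "icomp (two X) = copair (into0 X) (into1 X)"
  by (simp_all add: two_def)

lemma ob2_type [simp]:
  "ob2 \<in> Obj C" "d0 \<in> Arr C" "Dom C d0 = one" "Cod C d0 = ob2"
  "d1 \<in> Arr C" "Dom C d1 = one" "Cod C d1 = ob2"
  by (simp_all add: ob2_def d0_def d1_def)

lemma two_type [simp]:
  assumes "X \<in> Obj C"
  shows "cone X \<in> Obj C" "arrows X \<in> Obj C"
    "apex X \<in> Arr C" "Dom C (apex X) = one" "Cod C (apex X) = cone X"
    "base X \<in> Arr C" "Dom C (base X) = X" "Cod C (base X) = cone X"
    "e0 X \<in> Arr C" "Dom C (e0 X) = one" "Cod C (e0 X) = arrows X"
    "e1 X \<in> Arr C" "Dom C (e1 X) = one" "Cod C (e1 X) = arrows X"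
    "edge X \<in> Arr C" "Dom C (edge X) = X" "Cod C (edge X) = arrows X"
    "into1 X \<in> Arr C" "Dom C (into1 X) = cone X" "Cod C (into1 X) = arrows X"
    "into0 X \<in> Arr C" "Dom C (into0 X) = cone X" "Cod C (into0 X) = arrows X"
    "src X \<in> Arr C" "Dom C (src X) = arrows X" "Cod C (src X) = ob2"
    "trg X \<in> Arr C" "Dom C (trg X) = arrows X" "Cod C (trg X) = ob2"
  using assms
  by (simp_all add: cone_def arrows_def apex_def base_def e0_def e1_def edge_def into1_def into0_def
      src_def trg_def)

lemma into_eqs [simp]:
  assumes "X \<in> Obj C"
  shows "into1 X \<cdot> apex X = e1 X" "into1 X \<cdot> base X = edge X"
    "into0 X \<cdot> apex X = e0 X" "into0 X \<cdot> base X = edge X"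
proof -
  show "into1 X \<cdot> apex X = e1 X" "into1 X \<cdot> base X = edge X" by (simp_all add: e1_def edge_def)
  show "into0 X \<cdot> apex X = e0 X" "into0 X \<cdot> base X = edge X"
    unfolding into0_def apex_def base_def by (rule copair_inj; simp add: assms)+
qed

lemma d_copair [simp]:
  assumes "f \<in> Arr C" "g \<in> Arr C" "Cod C f = Cod C g" "Dom C f = one" "Dom C g = one"
  shows "copair f g \<cdot> d0 = f" "copair f g \<cdot> d1 = g"
    "w \<in> Arr C \<Longrightarrow> Cod C w = one \<Longrightarrow> copair f g \<cdot> (d0 \<cdot> w) = f \<cdot> w"
    "w \<in> Arr C \<Longrightarrow> Cod C w = one \<Longrightarrow> copair f g \<cdot> (d1 \<cdot> w) = g \<cdot> w"
  using assms by (simp_all add: d0_def d1_def)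

lemma arrows_copair [simp]:
  assumes "X \<in> Obj C" "f \<in> Arr C" "g \<in> Arr C" "h \<in> Arr C" "Dom C f = one" "Dom C g = one" "Dom C h = X"
    "Cod C f = Cod C h" "Cod C g = Cod C h"
  shows "copair f (copair g h) \<in> Arr C" "Dom C (copair f (copair g h)) = arrows X"
    "copair f (copair g h) \<cdot> e0 X = f" "copair f (copair g h) \<cdot> e1 X = g"
    "copair f (copair g h) \<cdot> edge X = h"
  using assms
  by (simp_all add: arrows_def cone_def e0_def e1_def edge_def into1_def apex_def base_def)

lemma arrows_fold [simp]: "one \<oplus> (one \<oplus> X) = arrows X"
  by (simp add: arrows_def cone_def)

lemma src_eqs [simp]:
  assumes "X \<in> Obj C"
  shows "src X \<cdot> e0 X = d0" "src X \<cdot> e1 X = d1" "src X \<cdot> edge X = d0 \<cdot> bang X"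
  using assms unfolding src_def by simp_all

lemma trg_into1 [simp]: "X \<in> Obj C \<Longrightarrow> trg X \<cdot> into1 X = d1 \<cdot> bang (cone X)"
  unfolding trg_def into1_def by (rule copair_inj) simp_all

lemma trg_eqs [simp]:
  assumes "X \<in> Obj C"
  shows "trg X \<cdot> e0 X = d0" "trg X \<cdot> e1 X = d1" "trg X \<cdot> edge X = d1 \<cdot> bang X"
proof -
  show "trg X \<cdot> e0 X = d0" unfolding trg_def e0_def by (rule copair_inj) (simp_all add: assms)
  show "trg X \<cdot> e1 X = d1" "trg X \<cdot> edge X = d1 \<cdot> bang X"
    using comp_eq_comp[OF trg_into1[OF assms], of "apex X"] comp_eq_comp[OF trg_into1[OF assms], of "base X"]
      assms by simp_all
qed

lemma cone_eqI:
  assumes "X \<in> Obj C" "h \<in> Arr C" "k \<in> Arr C" "Dom C h = cone X" "Dom C k = cone X" "Cod C h = Cod C k"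
    "h \<cdot> apex X = k \<cdot> apex X" "h \<cdot> base X = k \<cdot> base X"
  shows "h = k"
  by (rule copair_eqI[of one X]) (use assms in \<open>simp_all add: cone_def apex_def base_def\<close>)

lemma arrows_eqI:
  assumes "X \<in> Obj C" "h \<in> Arr C" "k \<in> Arr C" "Dom C h = arrows X" "Dom C k = arrows X" "Cod C h = Cod C k"
    "h \<cdot> e0 X = k \<cdot> e0 X" "h \<cdot> e1 X = k \<cdot> e1 X" "h \<cdot> edge X = k \<cdot> edge X"
  shows "h = k"
proof (rule copair_eqI[of one "cone X"])
  show "h \<cdot> inj2 C one (cone X) = k \<cdot> inj2 C one (cone X)"
    unfolding into1_def[symmetric]
    by (rule cone_eqI[OF assms(1)]) (use assms in simp_all)
  show "Dom C h = one \<oplus> cone X" "Dom C k = one \<oplus> cone X"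
    using assms(4,5) by (simp_all add: arrows_def)
  show "h \<cdot> inj1 C one (cone X) = k \<cdot> inj1 C one (cone X)"
    using assms(7) by (simp add: e0_def)
qed (use assms in simp_all)

lemma ob2_eqI:
  assumes "h \<in> Arr C" "k \<in> Arr C" "Dom C h = ob2" "Dom C k = ob2" "Cod C h = Cod C k"
    "h \<cdot> d0 = k \<cdot> d0" "h \<cdot> d1 = k \<cdot> d1"
  shows "h = k"
  by (rule copair_eqI[of one one]) (use assms in \<open>simp_all add: ob2_def d0_def d1_def\<close>)

lemma src_into0 [simp]: "X \<in> Obj C \<Longrightarrow> src X \<cdot> into0 X = d0 \<cdot> bang (cone X)"
  by (rule cone_eqI[of X]) simp_all

lemma structure_comp [simp]:
  assumes "X \<in> Obj C" "w \<in> Arr C"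
  shows "Cod C w = one \<Longrightarrow> src X \<cdot> (e0 X \<cdot> w) = d0 \<cdot> w"
    "Cod C w = one \<Longrightarrow> src X \<cdot> (e1 X \<cdot> w) = d1 \<cdot> w"
    "Cod C w = X \<Longrightarrow> src X \<cdot> (edge X \<cdot> w) = d0 \<cdot> bang (Dom C w)"
    "Cod C w = one \<Longrightarrow> trg X \<cdot> (e0 X \<cdot> w) = d0 \<cdot> w"
    "Cod C w = one \<Longrightarrow> trg X \<cdot> (e1 X \<cdot> w) = d1 \<cdot> w"
    "Cod C w = X \<Longrightarrow> trg X \<cdot> (edge X \<cdot> w) = d1 \<cdot> bang (Dom C w)"
    "Cod C w = cone X \<Longrightarrow> trg X \<cdot> (into1 X \<cdot> w) = d1 \<cdot> bang (Dom C w)"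
    "Cod C w = cone X \<Longrightarrow> src X \<cdot> (into0 X \<cdot> w) = d0 \<cdot> bang (Dom C w)"
    "Cod C w = one \<Longrightarrow> into1 X \<cdot> (apex X \<cdot> w) = e1 X \<cdot> w"
    "Cod C w = X \<Longrightarrow> into1 X \<cdot> (base X \<cdot> w) = edge X \<cdot> w"
    "Cod C w = one \<Longrightarrow> into0 X \<cdot> (apex X \<cdot> w) = e0 X \<cdot> w"
    "Cod C w = X \<Longrightarrow> into0 X \<cdot> (base X \<cdot> w) = edge X \<cdot> w"
  using assms
  by (simp_all add: comp_eq_comp[OF src_eqs(1)] comp_eq_comp[OF src_eqs(2)] comp_eq_comp[OF src_eqs(3)]
      comp_eq_comp[OF trg_eqs(1)] comp_eq_comp[OF trg_eqs(2)] comp_eq_comp[OF trg_eqs(3)]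
      comp_eq_comp[OF trg_into1] comp_eq_comp[OF src_into0]
      comp_eq_comp[OF into_eqs(1)] comp_eq_comp[OF into_eqs(2)]
      comp_eq_comp[OF into_eqs(3)] comp_eq_comp[OF into_eqs(4)])

lemma ob2_coproduct: "is_coproduct C one one ob2 d0 d1"
  unfolding ob2_def d0_def d1_def by (rule coprod_is_coproduct) simp_all

lemma cone_coproduct: "X \<in> Obj C \<Longrightarrow> is_coproduct C one X (cone X) (apex X) (base X)"
  unfolding cone_def apex_def base_def by (rule coprod_is_coproduct) simp_all

lemma arrows_coproduct1: "X \<in> Obj C \<Longrightarrow> is_coproduct C one (cone X) (arrows X) (e0 X) (into1 X)"
  unfolding arrows_def e0_def into1_def by (rule coprod_is_coproduct) simp_all

text \<open>The same three pieces regrouped: \<open>e1\<close> against \<open>e0\<close> and the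
  edges. This grouping sorts the arrows by source, while the defining one of \<open>arrows X\<close>
  sorts them by target.\<close>

lemma arrows_coproduct0:
  assumes "X \<in> Obj C"
  shows "is_coproduct C one (cone X) (arrows X) (e1 X) (into0 X)"
proof (rule coproductI)
  fix c f g assume f: "f \<in> hom C one c" and g: "g \<in> hom C (cone X) c"
  note t = homD[OF f] homD[OF g] assms
  let ?h = "copair (g \<cdot> apex X) (copair f (g \<cdot> base X))"
  have h: "?h \<in> Arr C" "Dom C ?h = arrows X" "Cod C ?h = c" "?h \<cdot> e0 X = g \<cdot> apex X"
    "?h \<cdot> e1 X = f" "?h \<cdot> edge X = g \<cdot> base X"
    using t by simp_all
  moreover have "?h \<cdot> into0 X = g"
    by (rule cone_eqI[of X]) (simp_all add: t h)
  ultimately show "\<exists>h. h \<in> hom C (arrows X) c \<and> h \<cdot> e1 X = f \<and> h \<cdot> into0 X = g"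
    by (auto simp: hom_def)
next
  fix c h k assume a: "h \<in> hom C (arrows X) c" "k \<in> hom C (arrows X) c"
    "h \<cdot> e1 X = k \<cdot> e1 X" "h \<cdot> into0 X = k \<cdot> into0 X"
  note t = homD[OF a(1)] homD[OF a(2)] assms
  have "(h \<cdot> into0 X) \<cdot> apex X = (k \<cdot> into0 X) \<cdot> apex X" "(h \<cdot> into0 X) \<cdot> base X = (k \<cdot> into0 X) \<cdot> base X"
    by (simp_all only: a(4))
  then have "h \<cdot> e0 X = k \<cdot> e0 X" "h \<cdot> edge X = k \<cdot> edge X" by (simp_all add: t)
  with a(3) show "h = k" by (rule_tac arrows_eqI[of X]) (simp_all only: t simp_thms)
qed (use assms in \<open>simp_all add: hom_def\<close>)

lemma pullback_Ident:
  assumes "f \<in> Arr C" "Dom C f = a" "Cod C f = b"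
  shows "is_pullback C (Ident C b) f a f (Ident C a)"
proof -
  have "a \<in> Obj C" "b \<in> Obj C" using assms by auto
  then show ?thesis
    by (intro pullbackI) (use assms in \<open>auto simp: hom_def\<close>)
qed

section \<open>Fibres of source and target over the two objects\<close>

lemma src_d0_pullback:
  assumes "X \<in> Obj C"
  shows "is_pullback C (src X) d0 (cone X) (into0 X) (bang (cone X))"
  by (rule injection_pullback[OF arrows_coproduct0[OF assms] coproduct_sym[OF ob2_coproduct],
      of _ "Ident C one"]) (use assms in \<open>simp_all add: hom_def\<close>)

lemma src_d1_pullback:
  assumes "X \<in> Obj C"
  shows "is_pullback C (src X) d1 one (e1 X) (Ident C one)"
  by (rule injection_pullback[OF coproduct_sym[OF arrows_coproduct0[OF assms]] ob2_coproduct,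
      of _ "bang (cone X)"]) (use assms in \<open>simp_all add: hom_def\<close>)

lemma trg_d1_pullback:
  assumes "X \<in> Obj C"
  shows "is_pullback C (trg X) d1 (cone X) (into1 X) (bang (cone X))"
  by (rule injection_pullback[OF arrows_coproduct1[OF assms] ob2_coproduct,
      of _ "Ident C one"]) (use assms in \<open>simp_all add: hom_def\<close>)

text \<open>Second of the two cuts that isolate the edges: among the arrows with target
  \<open>d1\<close>, embedded by \<open>into1\<close>, those with source \<open>d0\<close>.\<close>

lemma cone_d0_pullback:
  assumes "X \<in> Obj C"
  shows "is_pullback C (src X \<cdot> into1 X) d0 X (base X) (bang X)"
  by (rule injection_pullback[OF cone_coproduct[OF assms] coproduct_sym[OF ob2_coproduct],
      of _ "Ident C one"]) (use assms in \<open>simp_all add: hom_def\<close>)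

text \<open>\<open>into1\<close> and \<open>base\<close> are pullbacks of the points
  \<open>d1\<close> and \<open>d0\<close>; maps to the terminal object being unique, such a
  projection is monic.\<close>

lemma edge_mono:
  assumes "X \<in> Obj C" "k \<in> hom C w X" "k' \<in> hom C w X" "edge X \<cdot> k = edge X \<cdot> k'"
  shows "k = k'"
proof (rule pullback_unique[OF cone_d0_pullback[OF assms(1)] assms(2,3)])
  note t = homD[OF assms(2)] homD[OF assms(3)] assms(1)
  show "base X \<cdot> k = base X \<cdot> k'"
    by (rule pullback_unique[OF trg_d1_pullback[OF assms(1)], of _ w])
      (use assms(4) in \<open>simp_all add: t hom_def\<close>)
  show "bang X \<cdot> k = bang X \<cdot> k'" by (simp add: t)
qed

text \<open>Target \<open>d1\<close> gives a factorisation through \<open>into1\<close>, then source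
  \<open>d0\<close> one through \<open>base\<close>. With \<open>edge_mono\<close> this identifies
  \<open>X\<close> as the object of arrows from \<open>d0\<close> to \<open>d1\<close> in
  \<open>two X\<close>, which is what makes \<open>two_map\<close> full and faithful.\<close>

lemma edge_factor:
  assumes X: "X \<in> Obj C" and w: "w \<in> Arr C" "Cod C w = arrows X"
    and s: "src X \<cdot> w = d0 \<cdot> bang (Dom C w)" and t: "trg X \<cdot> w = d1 \<cdot> bang (Dom C w)"
  obtains k where "k \<in> hom C (Dom C w) X" "edge X \<cdot> k = w"
proof -
  obtain w' where w': "w' \<in> hom C (Dom C w) (cone X)" "into1 X \<cdot> w' = w"
    by (rule pullback_factor[OF trg_d1_pullback[OF X], of w "Dom C w" "bang (Dom C w)"])
      (use X w t in \<open>simp_all add: hom_def\<close>)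
  note t' = homD[OF w'(1)] X
  have "src X \<cdot> (into1 X \<cdot> w') = d0 \<cdot> bang (Dom C w)" using w' s by simp
  then obtain k where k: "k \<in> hom C (Dom C w) X" "base X \<cdot> k = w'"
    by (rule_tac pullback_factor[OF cone_d0_pullback[OF X], of w' "Dom C w" "bang (Dom C w)"])
      (use w in \<open>simp_all add: t' hom_def\<close>)
  have "edge X \<cdot> k = into1 X \<cdot> (base X \<cdot> k)" using k(1) X by (simp add: hom_def)
  then show ?thesis using that k w' by simp
qed

text \<open>\<open>trg X\<close> is constant on each summand of \<open>arrows X\<close>. If the
  second component of a pair is \<open>e0\<close>, the first is any arrow with source
  \<open>d0\<close>; if it lies in \<open>cone X\<close>, the first must be
  \<open>e1\<close>.\<close>

lemma two_pullback:
  assumes "X \<in> Obj C"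
  shows "is_pullback C (src X) (trg X) (cone X \<oplus> cone X)
    (copair (into0 X) (e1 X \<cdot> bang (cone X))) (copair (e0 X \<cdot> bang (cone X)) (into1 X))"
proof -
  have 1: "is_pullback C (src X) (d1 \<cdot> bang (cone X)) (cone X) (e1 X \<cdot> bang (cone X)) (Ident C (cone X))"
    by (rule pullback_paste[OF src_d1_pullback[OF assms] pullback_Ident]) (use assms in simp_all)
  show ?thesis
    using copair_pullback[OF src_d0_pullback[OF assms] 1] assms
    by (simp add: trg_def coprod_arr_copair e0_def into1_def)
qed

lemma two_unital:
  assumes X: "X \<in> Obj C"
  shows "unital (two X)"
proof -
  let ?K = "cone X"
  let ?l = "inj1 C ?K ?K" and ?r = "inj2 C ?K ?K"
  \<comment> \<open>\<open>?u\<close> pairs an arrow with the identity at its source,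
    \<open>?v\<close> with the identity at its target. They differ only on edges:
    \<open>(edge, e0)\<close> lies in the first summand of the object of pairs,
    \<open>(e1, edge)\<close> in the second.\<close>
  let ?u = "copair (?l \<cdot> apex X) (copair (?r \<cdot> apex X) (?l \<cdot> base X))"
  let ?v = "copair (?l \<cdot> apex X) (copair (?r \<cdot> apex X) (?r \<cdot> base X))"
  have pb: "is_pullback C (isrc (two X)) (itrg (two X)) (I2 (two X)) (ipr1 (two X)) (ipr2 (two X))"
    using two_pullback[OF X] by simp
  have u: "?u \<in> Arr C" "Dom C ?u = arrows X" "Cod C ?u = ?K \<oplus> ?K" "?u \<cdot> e0 X = ?l \<cdot> apex X"
    "?u \<cdot> e1 X = ?r \<cdot> apex X" "?u \<cdot> edge X = ?l \<cdot> base X"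
    and v: "?v \<in> Arr C" "Dom C ?v = arrows X" "Cod C ?v = ?K \<oplus> ?K" "?v \<cdot> e0 X = ?l \<cdot> apex X"
    "?v \<cdot> e1 X = ?r \<cdot> apex X" "?v \<cdot> edge X = ?r \<cdot> base X"
    using X by simp_all
  have iid: "copair (e0 X) (e1 X) \<in> Arr C" "Dom C (copair (e0 X) (e1 X)) = ob2"
    "Cod C (copair (e0 X) (e1 X)) = arrows X"
    using X by (simp_all add: ob2_def)
  have s: "src X \<cdot> Ident C (arrows X) = trg X \<cdot> (copair (e0 X) (e1 X) \<cdot> src X)"
    by (rule arrows_eqI[of X]) (simp_all add: X iid)
  have t: "src X \<cdot> (copair (e0 X) (e1 X) \<cdot> trg X) = trg X \<cdot> Ident C (arrows X)"
    by (rule arrows_eqI[of X]) (simp_all add: X iid)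
  have c1: "composable (two X) (Ident C (arrows X)) (copair (e0 X) (e1 X) \<cdot> src X)"
    and c2: "composable (two X) (copair (e0 X) (e1 X) \<cdot> trg X) (Ident C (arrows X))"
    using X s t iid by (simp_all add: composable_def)
  have e1: "ipair C (two X) (Ident C (arrows X)) (copair (e0 X) (e1 X) \<cdot> src X) = ?u"
  proof (rule ipair_eqI[OF pb _ _ c1])
    show "ipr1 (two X) \<cdot> ?u = Ident C (arrows X)" "ipr2 (two X) \<cdot> ?u = copair (e0 X) (e1 X) \<cdot> src X"
      by (rule arrows_eqI[of X]; simp add: X u iid)+
  qed (use X u in simp_all)
  have e2: "ipair C (two X) (copair (e0 X) (e1 X) \<cdot> trg X) (Ident C (arrows X)) = ?v"
  proof (rule ipair_eqI[OF pb _ _ c2])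
    show "ipr1 (two X) \<cdot> ?v = copair (e0 X) (e1 X) \<cdot> trg X" "ipr2 (two X) \<cdot> ?v = Ident C (arrows X)"
      by (rule arrows_eqI[of X]; simp add: X v iid)+
  qed (use X v in simp_all)
  have "icomp (two X) \<cdot> ?u = Ident C (arrows X)" "icomp (two X) \<cdot> ?v = Ident C (arrows X)"
    by (rule arrows_eqI[of X]; simp add: X u v)+
  moreover have "src X \<cdot> copair (e0 X) (e1 X) = Ident C ob2" "trg X \<cdot> copair (e0 X) (e1 X) = Ident C ob2"
    by (rule ob2_eqI; simp add: X iid)+
  moreover have
    "src X \<cdot> copair (into0 X) (into1 X) = src X \<cdot> copair (e0 X \<cdot> bang (cone X)) (into1 X)"
    "trg X \<cdot> copair (into0 X) (into1 X) = trg X \<cdot> copair (into0 X) (e1 X \<cdot> bang (cone X))"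
    by (rule copair_eqI[of ?K ?K]; simp add: X)+
  ultimately show ?thesis
    unfolding unital_def ecomp_def using X e1 e2 pb iid by (simp add: hom_def)
qed

text \<open>In a composable pair \<open>(g, f)\<close> either \<open>f\<close> is the identity
  \<open>e0\<close> or \<open>g\<close> is the identity \<open>e1\<close>. Once the common domain is
  split accordingly, associativity on each part follows from the unit laws.\<close>

lemma two_category:
  assumes X: "X \<in> Obj C"
  shows "internal_category C (two X)"
proof (rule internal_categoryI[OF two_unital[OF X]])
  note A = two_unital[OF X]
  fix f g h assume gf: "composable (two X) g f" and hg: "composable (two X) h g"
  let ?P = "ipair C (two X) g f" and ?T = "Dom C f" and ?K = "cone X"
  note c = gf[unfolded composable_def] hg[unfolded composable_def]
  note P = ipair[OF A A A gf]
  have t: "f \<in> Arr C" "g \<in> Arr C" "h \<in> Arr C" "Cod C f = arrows X" "Cod C g = arrows X" "Cod C h = arrows X"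
    "Dom C g = ?T" "Dom C h = ?T" "src X \<cdot> h = trg X \<cdot> g"
    using c by simp_all
  obtain y z i j a b where d: "is_coproduct C y z (Dom C ?P) i j" "a \<in> hom C y ?K" "b \<in> hom C z ?K"
    "?P \<cdot> i = inj1 C ?K ?K \<cdot> a" "?P \<cdot> j = inj2 C ?K ?K \<cdot> b"
    by (rule coproduct_decompose[of ?P ?K ?K]) (use P X in simp_all)
  note d1 = d(1)[unfolded P(2)]
  note dt = coproductD[OF d1] homD[OF d(2)] homD[OF d(3)]
  have 1: "f \<cdot> w = ipr2 (two X) \<cdot> (?P \<cdot> w)" "g \<cdot> w = ipr1 (two X) \<cdot> (?P \<cdot> w)"
    if "w \<in> Arr C" "Cod C w = ?T" for w
    using that P t icat_type[OF A] comp_eq_comp[OF P(4), of w] comp_eq_comp[OF P(5), of w] by simp_all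
  have fi: "f \<cdot> i = e0 X \<cdot> bang y" and gi: "g \<cdot> i = into0 X \<cdot> a"
    and fj: "f \<cdot> j = into1 X \<cdot> b" and gj: "g \<cdot> j = e1 X \<cdot> bang z"
    using 1[of i] 1[of j] dt X by (simp_all add: d(4,5))
  have i': "composable (two X) (g \<cdot> i) (f \<cdot> i)" "composable (two X) (h \<cdot> i) (g \<cdot> i)"
    using ecomp_comp(1)[OF A gf, of i] ecomp_comp(1)[OF A hg, of i] dt t by simp_all
  have j': "composable (two X) (g \<cdot> j) (f \<cdot> j)" "composable (two X) (h \<cdot> j) (g \<cdot> j)"
    using ecomp_comp(1)[OF A gf, of j] ecomp_comp(1)[OF A hg, of j] dt t by simp_all
  have hgt: "ecomp C (two X) h g \<in> Arr C" "Dom C (ecomp C (two X) h g) = ?T"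
    "Cod C (ecomp C (two X) h g) = arrows X" "src X \<cdot> ecomp C (two X) h g = src X \<cdot> g"
    and gft: "ecomp C (two X) g f \<in> Arr C" "Dom C (ecomp C (two X) g f) = ?T"
    "Cod C (ecomp C (two X) g f) = arrows X" "trg X \<cdot> ecomp C (two X) g f = trg X \<cdot> g"
    using ecomp_type[OF A hg] ecomp_type[OF A gf] t by simp_all
  have c3: "composable (two X) (ecomp C (two X) h g) f" "composable (two X) h (ecomp C (two X) g f)"
    using hgt gft c t by (simp_all add: composable_def)
  let ?l = "ecomp C (two X) (ecomp C (two X) h g) f" and ?r = "ecomp C (two X) h (ecomp C (two X) g f)"
  have expand: "?l \<cdot> w = ecomp C (two X) (ecomp C (two X) (h \<cdot> w) (g \<cdot> w)) (f \<cdot> w)"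
    "?r \<cdot> w = ecomp C (two X) (h \<cdot> w) (ecomp C (two X) (g \<cdot> w) (f \<cdot> w))"
    if "w \<in> Arr C" "Cod C w = ?T" for w
    using that t hgt gft ecomp_comp(2)[OF A c3(1), of w] ecomp_comp(2)[OF A c3(2), of w]
      ecomp_comp(2)[OF A hg, of w] ecomp_comp(2)[OF A gf, of w] by simp_all
  show "?l = ?r"
  proof (rule coproduct_unique[OF d1])
    \<comment> \<open>On this part \<open>f\<close> is an identity: the one at the source of
      \<open>g\<close>, and so also at the source of the composite of \<open>h\<close> after
      \<open>g\<close>.\<close>
    have 1: "f \<cdot> i = iid (two X) \<cdot> (isrc (two X) \<cdot> (g \<cdot> i))"
      using X dt by (simp add: fi gi)
    have 2: "isrc (two X) \<cdot> (g \<cdot> i) = isrc (two X) \<cdot> ecomp C (two X) (h \<cdot> i) (g \<cdot> i)"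
      using ecomp_type(4)[OF A i'(2)] by simp
    have "ecomp C (two X) (g \<cdot> i) (f \<cdot> i) = g \<cdot> i"
      unfolding 1 by (rule ecomp_ident(1)[OF A]) (simp_all add: t dt)
    moreover have "ecomp C (two X) (ecomp C (two X) (h \<cdot> i) (g \<cdot> i)) (f \<cdot> i) = ecomp C (two X) (h \<cdot> i) (g \<cdot> i)"
      unfolding 1 2 by (rule ecomp_ident(1)[OF A]) (use ecomp_type[OF A i'(2)] in simp_all)
    ultimately show "?l \<cdot> i = ?r \<cdot> i" using expand[of i] dt by simp
  next
    \<comment> \<open>On this part \<open>g\<close> is an identity, both at the target of
      \<open>f\<close> and at the source of \<open>h\<close>.\<close>
    have "src X \<cdot> (h \<cdot> j) = trg X \<cdot> (g \<cdot> j)" using j'(2) by (simp add: composable_def)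
    then have "g \<cdot> j = iid (two X) \<cdot> (itrg (two X) \<cdot> (f \<cdot> j))" "g \<cdot> j = iid (two X) \<cdot> (isrc (two X) \<cdot> (h \<cdot> j))"
      using X dt by (simp_all add: fj gj)
    then have "ecomp C (two X) (g \<cdot> j) (f \<cdot> j) = f \<cdot> j" "ecomp C (two X) (h \<cdot> j) (g \<cdot> j) = h \<cdot> j"
      using ecomp_ident(2)[OF A, of "f \<cdot> j"] ecomp_ident(1)[OF A, of "h \<cdot> j"] t dt X by simp_all
    then show "?l \<cdot> j = ?r \<cdot> j" using expand[of j] dt by simp
  qed (use ecomp_type[OF A c3(1)] ecomp_type[OF A c3(2)] gft in \<open>simp_all add: hom_def\<close>)
qed

end

section \<open>Functors out of the generated category\<close>

context extensive_category
begin

lemma iid_two_type [simp]: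
  assumes "X \<in> Obj C"
  shows "copair (e0 X) (e1 X) \<in> Arr C" "Dom C (copair (e0 X) (e1 X)) = ob2"
    "Cod C (copair (e0 X) (e1 X)) = arrows X"
  using assms by (simp_all add: ob2_def)

lemma ob2_fold [simp]: "one \<oplus> one = ob2"
  by (simp add: ob2_def)

lemma functor_values:
  assumes G: "internal_functor C G" and X: "X \<in> Obj C" and d: "fdom G = two X"
  shows "F1 G \<cdot> e0 X = iid (fcod G) \<cdot> (F0 G \<cdot> d0)" "F1 G \<cdot> e1 X = iid (fcod G) \<cdot> (F0 G \<cdot> d1)"
    "isrc (fcod G) \<cdot> (F1 G \<cdot> edge X) = F0 G \<cdot> (d0 \<cdot> bang X)"
    "itrg (fcod G) \<cdot> (F1 G \<cdot> edge X) = F0 G \<cdot> (d1 \<cdot> bang X)"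
proof -
  note t = ifunD(3-8)[OF G, unfolded d two_simps] icat_type[OF ifunD(2)[OF G]]
  note e = ifunD(9-11)[OF G, unfolded d two_simps]
  show "F1 G \<cdot> e0 X = iid (fcod G) \<cdot> (F0 G \<cdot> d0)" "F1 G \<cdot> e1 X = iid (fcod G) \<cdot> (F0 G \<cdot> d1)"
    using comp_eq_comp[OF e(3), of d0] comp_eq_comp[OF e(3), of d1] X by (simp_all add: t)
  show "isrc (fcod G) \<cdot> (F1 G \<cdot> edge X) = F0 G \<cdot> (d0 \<cdot> bang X)"
    "itrg (fcod G) \<cdot> (F1 G \<cdot> edge X) = F0 G \<cdot> (d1 \<cdot> bang X)"
    using comp_eq_comp[OF e(1), of "edge X"] comp_eq_comp[OF e(2), of "edge X"] X by (simp_all add: t)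
qed

text \<open>On the identities \<open>e0\<close> and \<open>e1\<close> the arrow part is forced by
  the object part, and the edges are the only remaining summand of \<open>arrows X\<close>.\<close>

lemma functor_eqI:
  assumes G: "internal_functor C G" and H: "internal_functor C H" and X: "X \<in> Obj C"
    and d: "fdom G = two X" "fdom H = two X" "fcod G = fcod H"
    and e: "F0 G = F0 H" "F1 G \<cdot> edge X = F1 H \<cdot> edge X"
  shows "G = H"
proof (rule ifun_eqI)
  show "F1 G = F1 H"
    by (rule arrows_eqI[OF X])
      (simp_all add: ifunD(3-8)[OF G] ifunD(3-8)[OF H] d e functor_values[OF G X d(1)] functor_values[OF H X d(2)])
qed (use d e in simp_all)

definition path :: "'o \<Rightarrow> ('o, 'm) icat \<Rightarrow> 'm \<Rightarrow> 'm \<Rightarrow> 'm \<Rightarrow> ('o, 'm) ifun" where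
  "path X D a b y = \<lparr>fdom = two X, fcod = D, F0 = copair a b,
     F1 = copair (iid D \<cdot> a) (copair (iid D \<cdot> b) y)\<rparr>"

lemma path_simps [simp]:
  "fdom (path X D a b y) = two X" "fcod (path X D a b y) = D" "F0 (path X D a b y) = copair a b"
  by (simp_all add: path_def)

text \<open>On each summand of the object of pairs one component is sent to an identity of
  \<open>D\<close>, so preservation of composition is there a unit law of \<open>D\<close>
  (\<open>i0\<close> and \<open>i1\<close>).\<close>

lemma path_functor:
  assumes X: "X \<in> Obj C" and D: "internal_category C D"
    and a: "a \<in> hom C one (I0 D)" and b: "b \<in> hom C one (I0 D)" and y: "y \<in> hom C X (I1 D)"
    and s: "isrc D \<cdot> y = a \<cdot> bang X" and t: "itrg D \<cdot> y = b \<cdot> bang X"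
  shows "internal_functor C (path X D a b y)" "F1 (path X D a b y) \<cdot> edge X = y"
proof -
  note U = internal_category_unital[OF D]
  note ty = homD[OF a] homD[OF b] homD[OF y] icat_type[OF U] X
  let ?F0 = "copair a b" and ?F1 = "copair (iid D \<cdot> a) (copair (iid D \<cdot> b) y)"
  let ?K = "cone X"
  have 0: "?F0 \<in> Arr C" "Dom C ?F0 = ob2" "Cod C ?F0 = I0 D" "?F0 \<cdot> d0 = a" "?F0 \<cdot> d1 = b"
    by (simp_all add: ty)
  have 1: "?F1 \<in> Arr C" "Dom C ?F1 = arrows X" "Cod C ?F1 = I1 D" "?F1 \<cdot> e0 X = iid D \<cdot> a"
    "?F1 \<cdot> e1 X = iid D \<cdot> b" "?F1 \<cdot> edge X = y"
    by (simp_all add: ty)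
  have F1c: "?F1 \<cdot> (e0 X \<cdot> w) = iid D \<cdot> (a \<cdot> w)" "?F1 \<cdot> (e1 X \<cdot> w) = iid D \<cdot> (b \<cdot> w)"
    if "w \<in> Arr C" "Cod C w = one" for w
    using comp_eq_comp[OF 1(4), of w] comp_eq_comp[OF 1(5), of w] that 1(1,2,3) by (simp_all add: ty)
  have si: "isrc D \<cdot> (iid D \<cdot> w) = w" "itrg D \<cdot> (iid D \<cdot> w) = w" if "w \<in> Arr C" "Cod C w = I0 D" for w
    using comp_eq_comp[OF icat_eq(1)[OF U], of w] comp_eq_comp[OF icat_eq(2)[OF U], of w] that
    by (simp_all add: ty)
  have src: "isrc D \<cdot> ?F1 = ?F0 \<cdot> src X" "itrg D \<cdot> ?F1 = ?F0 \<cdot> trg X"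
    by (rule arrows_eqI[OF X]; simp add: ty 0(1-3) 1 si s t comp_eq_comp[OF 0(4)] comp_eq_comp[OF 0(5)])+
  have src': "isrc D \<cdot> (?F1 \<cdot> w) = ?F0 \<cdot> (src X \<cdot> w)" "itrg D \<cdot> (?F1 \<cdot> w) = ?F0 \<cdot> (trg X \<cdot> w)"
    if "w \<in> Arr C" "Cod C w = arrows X" for w
    using comp_eq_comp[OF src(1), of w] comp_eq_comp[OF src(2), of w] that 1(1-3) 0(1-3) by (simp_all add: ty)
  note P = icat_type[OF two_unital[OF X], unfolded two_simps] icat_eq(5)[OF two_unital[OF X], unfolded two_simps]
  let ?p1 = "copair (into0 X) (e1 X \<cdot> bang ?K)" and ?p2 = "copair (e0 X \<cdot> bang ?K) (into1 X)"
  have c: "composable D (?F1 \<cdot> ?p1) (?F1 \<cdot> ?p2)"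
    using P src'[of ?p1] src'[of ?p2] 1(1-3) by (simp add: composable_def ty)
  have i0: "ecomp C D (?F1 \<cdot> into0 X) (iid D \<cdot> (a \<cdot> bang ?K)) = ?F1 \<cdot> into0 X"
  proof -
    have "isrc D \<cdot> (?F1 \<cdot> into0 X) = a \<cdot> bang ?K" by (simp add: src' X ty)
    then show ?thesis using ecomp_ident(1)[OF U, of "?F1 \<cdot> into0 X"] 1(1-3) X by simp
  qed
  have i1: "ecomp C D (iid D \<cdot> (b \<cdot> bang ?K)) (?F1 \<cdot> into1 X) = ?F1 \<cdot> into1 X"
  proof -
    have "itrg D \<cdot> (?F1 \<cdot> into1 X) = b \<cdot> bang ?K" by (simp add: src' X ty)
    then show ?thesis using ecomp_ident(2)[OF U, of "?F1 \<cdot> into1 X"] 1(1-3) X by simp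
  qed
  have comp: "?F1 \<cdot> copair (into0 X) (into1 X) = ecomp C D (?F1 \<cdot> ?p1) (?F1 \<cdot> ?p2)"
  proof (rule copair_eqI[of ?K ?K])
    have "ecomp C D (?F1 \<cdot> ?p1) (?F1 \<cdot> ?p2) \<cdot> inj1 C ?K ?K = ecomp C D (?F1 \<cdot> into0 X) (iid D \<cdot> (a \<cdot> bang ?K))"
      using ecomp_comp(2)[OF U c, of "inj1 C ?K ?K"] X 1(1-3) P by (simp add: F1c)
    then show "(?F1 \<cdot> copair (into0 X) (into1 X)) \<cdot> inj1 C ?K ?K = ecomp C D (?F1 \<cdot> ?p1) (?F1 \<cdot> ?p2) \<cdot> inj1 C ?K ?K"
      using X 1(1-3) P by (simp add: i0)
    have "ecomp C D (?F1 \<cdot> ?p1) (?F1 \<cdot> ?p2) \<cdot> inj2 C ?K ?K = ecomp C D (iid D \<cdot> (b \<cdot> bang ?K)) (?F1 \<cdot> into1 X)"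
      using ecomp_comp(2)[OF U c, of "inj2 C ?K ?K"] X 1(1-3) P by (simp add: F1c)
    then show "(?F1 \<cdot> copair (into0 X) (into1 X)) \<cdot> inj2 C ?K ?K = ecomp C D (?F1 \<cdot> ?p1) (?F1 \<cdot> ?p2) \<cdot> inj2 C ?K ?K"
      using X 1(1-3) P by (simp add: i1)
  qed (use X 1(1-3) P ecomp_type[OF U c] in simp_all)
  have ids: "?F1 \<cdot> copair (e0 X) (e1 X) = iid D \<cdot> ?F0"
    by (rule ob2_eqI) (use 0 in \<open>simp_all add: ty 1 del: arrows_copair\<close>)
  show "internal_functor C (path X D a b y)"
    by (rule internal_functorI)
      (simp_all add: path_def D U two_unital[OF X] two_category[OF X] 0(1-3) 1(1-3) src comp ids ty
        del: arrows_copair copair_type)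
  show "F1 (path X D a b y) \<cdot> edge X = y" by (simp only: path_def ifun.simps 1(6))
qed

text \<open>Written as a sum of arrows rather than as a \<open>path\<close>: in this form
  \<open>coprod_arr_pullback\<close> yields the pullback squares of arrow parts directly.\<close>

definition two_map :: "'m \<Rightarrow> ('o, 'm) ifun" where
  "two_map k = \<lparr>fdom = two (Dom C k), fcod = two (Cod C k), F0 = Ident C ob2,
     F1 = coprod_arr C (Ident C one) (coprod_arr C (Ident C one) k)\<rparr>"

lemma two_map_simps [simp]:
  "fdom (two_map k) = two (Dom C k)" "fcod (two_map k) = two (Cod C k)" "F0 (two_map k) = Ident C ob2"
  by (simp_all add: two_map_def)

lemma two_map_F1 [simp]:
  assumes "k \<in> Arr C"
  shows "F1 (two_map k) \<in> Arr C" "Dom C (F1 (two_map k)) = arrows (Dom C k)"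
    "Cod C (F1 (two_map k)) = arrows (Cod C k)"
    "Dom C k = X \<Longrightarrow> F1 (two_map k) \<cdot> e0 X = e0 (Cod C k)"
    "Dom C k = X \<Longrightarrow> F1 (two_map k) \<cdot> e1 X = e1 (Cod C k)"
    "Dom C k = X \<Longrightarrow> F1 (two_map k) \<cdot> edge X = edge (Cod C k) \<cdot> k"
  using assms dom_cod_obj(1)[OF assms]
  by (simp_all add: two_map_def arrows_def cone_def e0_def e1_def edge_def into1_def apex_def base_def
      del: arrows_fold)

lemma two_map_F1_comp [simp]:
  assumes "k \<in> Arr C" "w \<in> Arr C" "Dom C k = X"
  shows "Cod C w = one \<Longrightarrow> F1 (two_map k) \<cdot> (e0 X \<cdot> w) = e0 (Cod C k) \<cdot> w"
    "Cod C w = one \<Longrightarrow> F1 (two_map k) \<cdot> (e1 X \<cdot> w) = e1 (Cod C k) \<cdot> w"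
    "Cod C w = X \<Longrightarrow> F1 (two_map k) \<cdot> (edge X \<cdot> w) = edge (Cod C k) \<cdot> (k \<cdot> w)"
  using comp_eq_comp[OF two_map_F1(4)[OF assms(1,3)], of w] comp_eq_comp[OF two_map_F1(5)[OF assms(1,3)], of w]
    comp_eq_comp[OF two_map_F1(6)[OF assms(1,3)], of w] assms dom_cod_obj[OF assms(1)] by auto

text \<open>Recognised as the \<open>path\<close> with endpoints \<open>d0\<close>,
  \<open>d1\<close> and family \<open>edge (Cod C k) \<cdot> k\<close>, whose functoriality is
  already known.\<close>

lemma two_map_functor:
  assumes k: "k \<in> Arr C"
  shows "internal_functor C (two_map k)"
proof -
  have Z: "Dom C k \<in> Obj C" "Cod C k \<in> Obj C" using k by auto
  let ?p = "path (Dom C k) (two (Cod C k)) d0 d1 (edge (Cod C k) \<cdot> k)"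
  have p: "internal_functor C ?p" "F1 ?p \<cdot> edge (Dom C k) = edge (Cod C k) \<cdot> k"
    by (rule path_functor; use k Z two_category in \<open>simp add: hom_def\<close>)+
  have 0: "copair d0 d1 = Ident C ob2" by (rule ob2_eqI) simp_all
  have "F1 ?p = F1 (two_map k)"
    by (rule arrows_eqI[OF Z(1)])
      (simp_all add: p(2) k Z functor_values(1,2)[OF p(1) Z(1)] ifunD(6-8)[OF p(1)] 0)
  then have "?p = two_map k" using 0 by (intro ifun_eqI) simp_all
  then show ?thesis using p by simp
qed

lemma two_map_comp:
  assumes "k \<in> Arr C" "l \<in> Arr C" "Cod C l = Dom C k"
  shows "comp_ifun C (two_map k) (two_map l) = two_map (k \<cdot> l)"
proof -
  have Z: "Dom C k \<in> Obj C" "Cod C k \<in> Obj C" "Dom C l \<in> Obj C" using assms by auto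
  note f = two_map_functor[OF assms(1)] two_map_functor[OF assms(2)]
  show ?thesis
    by (rule functor_eqI[OF _ _ Z(3)]) (use assms Z f comp_ifun_functor two_map_functor in simp_all)
qed

lemma two_map_Ident:
  assumes "X \<in> Obj C"
  shows "two_map (Ident C X) = id_ifun C (two X)"
  by (rule functor_eqI[OF _ _ assms]) (use assms id_ifun_functor two_category two_map_functor in simp_all)

lemma two_map_inj:
  assumes "k \<in> Arr C" "l \<in> Arr C" "Dom C k = Dom C l" "Cod C k = Cod C l" "two_map k = two_map l"
  shows "k = l"
proof (rule edge_mono)
  show "Cod C k \<in> Obj C" using assms by simp
  show "edge (Cod C k) \<cdot> k = edge (Cod C k) \<cdot> l"
    using two_map_F1(6)[OF assms(1) refl] two_map_F1(6)[OF assms(2) refl] assms(3-5) by simp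
qed (use assms in \<open>simp_all add: hom_def\<close>)

text \<open>\<open>G\<close> fixes the two objects, so it sends edges to arrows from
  \<open>d0\<close> to \<open>d1\<close>, and these are edges by \<open>edge_factor\<close>.\<close>

lemma two_map_full:
  assumes G: "internal_functor C G" and X: "X \<in> Obj C" and Z: "Z \<in> Obj C"
    and d: "fdom G = two X" "fcod G = two Z" and i: "F0 G = Ident C ob2"
  obtains k where "k \<in> hom C X Z" "G = two_map k"
proof -
  note t = ifunD(3-8)[OF G, unfolded d two_simps] X Z
  note v = functor_values(3,4)[OF G X d(1), unfolded d(2) i two_simps]
  obtain k where k: "k \<in> hom C (Dom C (F1 G \<cdot> edge X)) Z" "edge Z \<cdot> k = F1 G \<cdot> edge X"
    by (rule edge_factor[OF Z, of "F1 G \<cdot> edge X"]) (simp_all add: t v)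
  have k': "k \<in> Arr C" "Dom C k = X" "Cod C k = Z" using homD[OF k(1)] by (simp_all add: t)
  have "F1 (two_map k) \<cdot> edge X = F1 G \<cdot> edge X"
    using two_map_F1(6)[OF k'(1,2)] k' k(2) by simp
  then have "G = two_map k"
    by (intro functor_eqI[OF G two_map_functor[OF k'(1)] X]) (simp_all add: d k' i)
  then show ?thesis using that k' by (simp add: hom_def)
qed

end

section \<open>Existence of coequalisers\<close>

lemma coequaliser2_factor:
  assumes "is_2coequaliser K f g q" "h \<in> hom K (Cod K f) z" "h \<cdot>\<^bsub>K\<^esub> f = h \<cdot>\<^bsub>K\<^esub> g" "z \<in> Obj K"
  obtains k where "k \<in> hom K (Cod K q) z" "k \<cdot>\<^bsub>K\<^esub> q = h"
  using assms unfolding is_2coequaliser_def by blast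

lemma coequaliser2_unique:
  assumes "is_2coequaliser K f g q" "category K" "k \<in> hom K (Cod K q) z" "k' \<in> hom K (Cod K q) z"
    "k \<cdot>\<^bsub>K\<^esub> q = k' \<cdot>\<^bsub>K\<^esub> q"
  shows "k = k'"
proof -
  interpret category K by (rule assms(2))
  note q = assms(1)[unfolded is_2coequaliser_def parallel_def] and t = homD[OF assms(3)] homD[OF assms(4)]
  have z: "z \<in> Obj K" using hom_obj assms(3) by blast
  have "k' \<cdot>\<^bsub>K\<^esub> q \<in> hom K (Cod K f) z" using q t by (auto simp: hom_def)
  moreover have "(k' \<cdot>\<^bsub>K\<^esub> q) \<cdot>\<^bsub>K\<^esub> f = (k' \<cdot>\<^bsub>K\<^esub> q) \<cdot>\<^bsub>K\<^esub> g" using q t by simp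
  ultimately have "\<exists>!l. l \<in> hom K (Cod K q) z \<and> l \<cdot>\<^bsub>K\<^esub> q = k' \<cdot>\<^bsub>K\<^esub> q" using q z by blast
  then show ?thesis using assms by blast
qed

lemma coequaliser_factor:
  assumes "is_coequaliser K f g q" "h \<in> hom K (Cod K f) z" "h \<cdot>\<^bsub>K\<^esub> f = h \<cdot>\<^bsub>K\<^esub> g" "z \<in> Obj K"
  obtains k where "k \<in> hom K (Cod K q) z" "k \<cdot>\<^bsub>K\<^esub> q = h"
  using assms unfolding is_coequaliser_def by blast

lemma coequaliser_unique:
  assumes "is_coequaliser K f g q" "category K" "k \<in> hom K (Cod K q) z" "k' \<in> hom K (Cod K q) z"
    "k \<cdot>\<^bsub>K\<^esub> q = k' \<cdot>\<^bsub>K\<^esub> q"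
  shows "k = k'"
proof -
  interpret category K by (rule assms(2))
  note q = assms(1)[unfolded is_coequaliser_def parallel_def] and t = homD[OF assms(3)] homD[OF assms(4)]
  have z: "z \<in> Obj K" using hom_obj assms(3) by blast
  have "k' \<cdot>\<^bsub>K\<^esub> q \<in> hom K (Cod K f) z" using q t by (auto simp: hom_def)
  moreover have "(k' \<cdot>\<^bsub>K\<^esub> q) \<cdot>\<^bsub>K\<^esub> f = (k' \<cdot>\<^bsub>K\<^esub> q) \<cdot>\<^bsub>K\<^esub> g" using q t by simp
  ultimately have "\<exists>!l. l \<in> hom K (Cod K q) z \<and> l \<cdot>\<^bsub>K\<^esub> q = k' \<cdot>\<^bsub>K\<^esub> q" using q z by blast
  then show ?thesis using assms by blast
qed

lemma coequaliserI:
  assumes "parallel C f g" "q \<in> Arr C" "Dom C q = Cod C f" "q \<cdot>\<^bsub>C\<^esub> f = q \<cdot>\<^bsub>C\<^esub> g"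
    and ex: "\<And>z h. h \<in> hom C (Cod C f) z \<Longrightarrow> h \<cdot>\<^bsub>C\<^esub> f = h \<cdot>\<^bsub>C\<^esub> g \<Longrightarrow> \<exists>k. k \<in> hom C (Cod C q) z \<and> k \<cdot>\<^bsub>C\<^esub> q = h"
    and un: "\<And>z k k'. k \<in> hom C (Cod C q) z \<Longrightarrow> k' \<in> hom C (Cod C q) z \<Longrightarrow> k \<cdot>\<^bsub>C\<^esub> q = k' \<cdot>\<^bsub>C\<^esub> q \<Longrightarrow> k = k'"
  shows "is_coequaliser C f g q"
  unfolding is_coequaliser_def
proof (intro conjI ballI impI)
  fix z h assume "h \<in> hom C (Cod C f) z" "h \<cdot>\<^bsub>C\<^esub> f = h \<cdot>\<^bsub>C\<^esub> g"
  with ex obtain k where "k \<in> hom C (Cod C q) z \<and> k \<cdot>\<^bsub>C\<^esub> q = h" by blast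
  then show "\<exists>!k. k \<in> hom C (Cod C q) z \<and> k \<cdot>\<^bsub>C\<^esub> q = h" using un by (metis (no_types, lifting))
qed (use assms in auto)

lemma (in category) comp_ifun_assoc:
  assumes "internal_functor C F" "internal_functor C G" "internal_functor C H" "fcod F = fdom G" "fcod G = fdom H"
  shows "comp_ifun C (comp_ifun C H G) F = comp_ifun C H (comp_ifun C G F)"
  using category.comp_assoc[OF category_Cat, of F G H] assms by simp

lemma (in category) comp_ifun_Ident:
  assumes "internal_functor C F"
  shows "fdom F = A \<Longrightarrow> comp_ifun C F (id_ifun C A) = F" "fcod F = A \<Longrightarrow> comp_ifun C (id_ifun C A) F = F"
  using category.comp_ident[OF category_Cat, of F A] assms by simp_all

context extensive_category
begin

text \<open>Two successive pullbacks, along \<open>a\<close> and then along \<open>b\<close>. The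
  conclusion hides the intermediate object: \<open>m\<close> is the universal family of arrows of
  \<open>D\<close> from \<open>a\<close> to \<open>b\<close>, with its universal property split into
  existence of factorisations and monicity of \<open>m\<close>.\<close>

lemma hom_object:
  assumes D: "unital D" and a: "a \<in> hom C one (I0 D)" and b: "b \<in> hom C one (I0 D)"
  obtains H m where "m \<in> hom C H (I1 D)" "isrc D \<cdot> m = a \<cdot> bang H" "itrg D \<cdot> m = b \<cdot> bang H"
    "\<forall>w \<in> Arr C. Cod C w = I1 D \<and> isrc D \<cdot> w = a \<cdot> bang (Dom C w) \<and>
      itrg D \<cdot> w = b \<cdot> bang (Dom C w) \<longrightarrow> (\<exists>k. k \<in> hom C (Dom C w) H \<and> m \<cdot> k = w)"
    "\<forall>w. \<forall>k \<in> hom C w H. \<forall>k' \<in> hom C w H. m \<cdot> k = m \<cdot> k' \<longrightarrow> k = k'"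
proof -
  note t = icat_type[OF D] homD[OF a] homD[OF b]
  obtain P p p' where p: "is_pullback C (isrc D) a P p p'"
    using pullbacks t unfolding has_pullbacks_def by metis
  note pt = pullbackD[OF p]
  have "itrg D \<cdot> p \<in> Arr C" "Cod C (itrg D \<cdot> p) = Cod C b" using t pt by simp_all
  then obtain H r r' where r: "is_pullback C (itrg D \<cdot> p) b H r r'"
    using pullbacks t(23) unfolding has_pullbacks_def using t by metis
  note rt = pullbackD[OF r]
  have bang: "u = bang (Dom C u)" if "u \<in> Arr C" "Cod C u = one" for u using bang_unique that .
  have p': "p' = bang P" and r': "r' = bang H" using bang[of p'] bang[of r'] pt rt t by simp_all
  show ?thesis
  proof (rule that)
    show "p \<cdot> r \<in> hom C H (I1 D)" using pt rt t by (simp add: hom_def)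
    show "isrc D \<cdot> (p \<cdot> r) = a \<cdot> bang H"
      using comp_eq_comp[OF pt(11), of r] pt rt t p' by simp
    show "itrg D \<cdot> (p \<cdot> r) = b \<cdot> bang H"
      using rt(11) r' pt rt t by simp
    show "\<forall>w \<in> Arr C. Cod C w = I1 D \<and> isrc D \<cdot> w = a \<cdot> bang (Dom C w) \<and>
      itrg D \<cdot> w = b \<cdot> bang (Dom C w) \<longrightarrow> (\<exists>k. k \<in> hom C (Dom C w) H \<and> (p \<cdot> r) \<cdot> k = w)"
    proof (intro ballI impI)
      fix w assume w': "w \<in> Arr C" "Cod C w = I1 D \<and> isrc D \<cdot> w = a \<cdot> bang (Dom C w) \<and> itrg D \<cdot> w = b \<cdot> bang (Dom C w)"
      then have w: "w \<in> Arr C" "Cod C w = I1 D" "isrc D \<cdot> w = a \<cdot> bang (Dom C w)" "itrg D \<cdot> w = b \<cdot> bang (Dom C w)"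
        by blast+
      obtain u where u: "u \<in> hom C (Dom C w) P" "p \<cdot> u = w"
        by (rule pullback_factor[OF p, of w "Dom C w" "bang (Dom C w)"])
          (use w t in \<open>simp_all add: hom_def\<close>)
      note ut = homD[OF u(1)]
      have "(itrg D \<cdot> p) \<cdot> u = b \<cdot> bang (Dom C w)" using u(2) w(4) ut pt t by simp
      then obtain k where k: "k \<in> hom C (Dom C w) H" "r \<cdot> k = u"
        by (rule_tac pullback_factor[OF r, of u "Dom C w" "bang (Dom C w)"])
          (use w(1) t ut pt in \<open>simp_all add: hom_def\<close>)
      have "(p \<cdot> r) \<cdot> k = p \<cdot> (r \<cdot> k)" by (rule comp_assoc) (use k(1) rt pt t in \<open>simp_all add: hom_def\<close>)
      then show "\<exists>k. k \<in> hom C (Dom C w) H \<and> (p \<cdot> r) \<cdot> k = w" using k u(2) by metis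
    qed
    show "\<forall>w. \<forall>k \<in> hom C w H. \<forall>k' \<in> hom C w H. (p \<cdot> r) \<cdot> k = (p \<cdot> r) \<cdot> k' \<longrightarrow> k = k'"
    proof (intro allI ballI impI)
      fix w k k' assume k: "k \<in> hom C w H" "k' \<in> hom C w H" "(p \<cdot> r) \<cdot> k = (p \<cdot> r) \<cdot> k'"
      note kt = homD[OF k(1)] homD[OF k(2)]
      have w: "w \<in> Obj C" using hom_obj k(1) by blast
      have b1: "p' \<cdot> (r \<cdot> k) = p' \<cdot> (r \<cdot> k')" using kt pt(4-10) rt(5-10) w t by (simp add: p')
      have b2: "r' \<cdot> k = r' \<cdot> k'" using kt w rt(4) by (simp add: r')
      have "r \<cdot> k = r \<cdot> k'"
        by (rule pullback_unique[OF p _ _ _ b1, of w]) (use k(3) kt pt rt t in \<open>simp_all add: hom_def\<close>)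
      then show "k = k'" using pullback_unique[OF r k(1,2)] b2 by blast
    qed
  qed
qed

lemma coequaliser_of_2coequaliser:
  assumes fg: "parallel C f g" and Q: "is_2coequaliser (Cat C) (two_map f) (two_map g) Q"
  shows "\<exists>q. is_coequaliser C f g q"
proof -
  let ?X = "Dom C f" and ?Y = "Cod C f"
  have fgt: "f \<in> Arr C" "g \<in> Arr C" "Dom C g = ?X" "Cod C g = ?Y" "?X \<in> Obj C" "?Y \<in> Obj C"
    using fg by (simp_all add: parallel_def)
  define D where "D = fcod Q"
  have Qt: "internal_functor C Q" "fdom Q = two ?Y" "fcod Q = D"
    and Qe: "comp_ifun C Q (two_map f) = comp_ifun C Q (two_map g)"
    using Q by (auto simp: is_2coequaliser_def D_def)
  note D = ifunD(2)[OF Qt(1), unfolded Qt] and DC = ifunD(14)[OF Qt(1), unfolded Qt]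
  note QT = ifunD(3-8)[OF Qt(1), unfolded Qt two_simps]
  have factor: "\<exists>K. internal_functor C K \<and> fdom K = D \<and> fcod K = z \<and> comp_ifun C K Q = h"
    if "internal_functor C h" "fdom h = two ?Y" "fcod h = z" "comp_ifun C h (two_map f) = comp_ifun C h (two_map g)"
    for h z
    using coequaliser2_factor[OF Q, of h z] that ifunD(14)[OF that(1)] Qt by (auto simp: hom_def)
  have unique: "k = k'" if "internal_functor C k" "internal_functor C k'" "fdom k = D" "fdom k' = D" "fcod k = fcod k'"
    "comp_ifun C k Q = comp_ifun C k' Q" for k k'
    using coequaliser2_unique[OF Q category_Cat, of k "fcod k" k'] that Qt by (simp add: hom_def)
  let ?c0 = "F0 Q \<cdot> d0" and ?c1 = "F0 Q \<cdot> d1" and ?y = "F1 Q \<cdot> edge ?Y"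
  have c: "?c0 \<in> hom C one (I0 D)" "?c1 \<in> hom C one (I0 D)" using QT by (simp_all add: hom_def)
  obtain H m where m: "m \<in> hom C H (I1 D)" "isrc D \<cdot> m = ?c0 \<cdot> bang H" "itrg D \<cdot> m = ?c1 \<cdot> bang H"
    and m_ex: "\<forall>w \<in> Arr C. Cod C w = I1 D \<and> isrc D \<cdot> w = ?c0 \<cdot> bang (Dom C w) \<and>
      itrg D \<cdot> w = ?c1 \<cdot> bang (Dom C w) \<longrightarrow> (\<exists>k. k \<in> hom C (Dom C w) H \<and> m \<cdot> k = w)"
    and m_inj: "\<forall>w. \<forall>k \<in> hom C w H. \<forall>k' \<in> hom C w H. m \<cdot> k = m \<cdot> k' \<longrightarrow> k = k'"
    by (rule hom_object[OF D c])
  have m_mono: "k = k'" if "k \<in> hom C w H" "k' \<in> hom C w H" "m \<cdot> k = m \<cdot> k'" for w k k'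
    using m_inj that by blast
  note mt = homD[OF m(1)]
  have H: "H \<in> Obj C" using hom_obj m(1) by blast
  have "isrc D \<cdot> ?y = ?c0 \<cdot> bang ?Y" "itrg D \<cdot> ?y = ?c1 \<cdot> bang ?Y"
    using functor_values(3,4)[OF Qt(1) fgt(6) Qt(2)] QT fgt by (simp_all add: Qt)
  then obtain q where q: "q \<in> hom C ?Y H" "m \<cdot> q = ?y"
    using m_ex[rule_format, of ?y] QT fgt by auto
  note qt = homD[OF q(1)]
  have yk: "F1 (comp_ifun C Q (two_map k)) \<cdot> edge ?X = m \<cdot> (q \<cdot> k)" if "k \<in> hom C ?X ?Y" for k
    using that QT fgt mt qt comp_eq_comp[OF q(2), of k] by (simp add: hom_def)
  \<comment> \<open>Read on edges, the equation between the composites of \<open>Q\<close> with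
    \<open>two_map f\<close> and \<open>two_map g\<close> becomes one between
    \<open>m \<cdot> (q \<cdot> f)\<close> and \<open>m \<cdot> (q \<cdot> g)\<close>, and
    \<open>m\<close> is monic.\<close>
  have qfg: "q \<cdot> f = q \<cdot> g"
    by (rule m_mono[of _ ?X]) (use yk[of f] yk[of g] Qe fgt qt in \<open>simp_all add: hom_def\<close>)
  define I where "I = path H D ?c0 ?c1 m"
  have I: "internal_functor C I" "fdom I = two H" "fcod I = D" "F1 I \<cdot> edge H = m"
    unfolding I_def using path_functor[OF H DC c m] by simp_all
  have I0: "F0 I = F0 Q"
    unfolding I_def by (rule ob2_eqI) (use QT in simp_all)
  note IT = ifunD(3-8)[OF I(1), unfolded I two_simps]
  have Iedge: "F1 (comp_ifun C I (two_map k)) \<cdot> edge (Dom C k) = m \<cdot> k" if "k \<in> Arr C" "Cod C k = H" for k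
    using that IT H I(4) comp_eq_comp[OF I(4), of k] by simp
  have IQ: "comp_ifun C I (two_map q) = Q"
  proof (rule functor_eqI[OF _ Qt(1) fgt(6)])
    show "F1 (comp_ifun C I (two_map q)) \<cdot> edge ?Y = F1 Q \<cdot> edge ?Y"
      using Iedge[of q] q qt by simp
  qed (use comp_ifun_functor[OF two_map_functor I(1), of q] Qt I qt I0 QT in simp_all)
  \<comment> \<open>\<open>I\<close> and \<open>Q\<close> have the same object part, so a functor on
    \<open>D\<close> that is the identity on objects after \<open>Q\<close> is so after
    \<open>I\<close>; fullness then turns its restriction along \<open>I\<close> into an arrow out
    of \<open>H\<close>.\<close>
  have desc: "\<exists>k. k \<in> hom C H Z \<and> comp_ifun C K I = two_map k"
    if "internal_functor C K" "fdom K = D" "fcod K = two Z" "F0 (comp_ifun C K Q) = Ident C ob2" "Z \<in> Obj C" for K Z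
    using two_map_full[OF comp_ifun_functor[OF I(1) that(1)] H that(5)] that I I0 by auto
  have "is_coequaliser C f g q"
  proof (rule coequaliserI[OF fg])
    fix z h assume h: "h \<in> hom C ?Y z" and hfg: "h \<cdot> f = h \<cdot> g"
    note ht = homD[OF h]
    have z: "z \<in> Obj C" using hom_obj h by blast
    obtain K where K: "internal_functor C K" "fdom K = D" "fcod K = two z" "comp_ifun C K Q = two_map h"
      using factor[of "two_map h" "two z"] two_map_functor two_map_comp fgt ht hfg by auto
    obtain k where k: "k \<in> hom C H z" "comp_ifun C K I = two_map k"
      using desc[OF K(1-3) _ z] K(4) by auto
    note kt = homD[OF k(1)]
    have "two_map (k \<cdot> q) = comp_ifun C (two_map k) (two_map q)" using two_map_comp kt qt by simp
    also have "\<dots> = comp_ifun C K (comp_ifun C I (two_map q))"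
      unfolding k(2)[symmetric] by (rule comp_ifun_assoc) (use K I qt two_map_functor in simp_all)
    also have "\<dots> = two_map h" using IQ K(4) by simp
    finally have "k \<cdot> q = h" by (rule two_map_inj[rotated -1]) (use kt qt ht in simp_all)
    then show "\<exists>k. k \<in> hom C (Cod C q) z \<and> k \<cdot> q = h" using k qt by auto
  next
    fix z k k' assume k: "k \<in> hom C (Cod C q) z" "k' \<in> hom C (Cod C q) z" and e: "k \<cdot> q = k' \<cdot> q"
    note kt = homD[OF k(1)] homD[OF k(2)]
    \<comment> \<open>\<open>R\<close> will be the inverse of \<open>I\<close>. Uniqueness for
      \<open>Q\<close> makes \<open>R\<close> followed by \<open>I\<close> the identity; the other
      composite is \<open>two_map r\<close> for some \<open>r\<close>, and
      \<open>m \<cdot> r = m\<close> forces \<open>r\<close> to be an identity.\<close>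
    obtain R where R: "internal_functor C R" "fdom R = D" "fcod R = two H" "comp_ifun C R Q = two_map q"
      using factor[of "two_map q" "two H"] two_map_functor two_map_comp fgt qt qfg by auto
    have "comp_ifun C I R = id_ifun C D"
    proof (rule unique)
      have "comp_ifun C (comp_ifun C I R) Q = comp_ifun C I (comp_ifun C R Q)"
        by (rule comp_ifun_assoc) (use R I Qt in simp_all)
      then show "comp_ifun C (comp_ifun C I R) Q = comp_ifun C (id_ifun C D) Q"
        using R(4) IQ comp_ifun_Ident(2)[OF Qt(1,3)] by simp
    qed (use comp_ifun_functor[OF R(1) I(1)] id_ifun_functor[OF DC] R I in simp_all)
    then have IRI: "comp_ifun C I (comp_ifun C R I) = I"
      using comp_ifun_assoc[OF I(1) R(1) I(1)] R I comp_ifun_Ident(2)[OF I(1,3)] by simp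
    obtain r where r: "r \<in> hom C H H" "comp_ifun C R I = two_map r"
      using desc[OF R(1-3) _ H] R(4) by auto
    note rt = homD[OF r(1)]
    have "comp_ifun C I (two_map r) = I" using IRI r(2) by simp
    then have "m \<cdot> r = m \<cdot> Ident C H" using Iedge[OF rt(1,3), unfolded rt(2)] I(4) mt H by simp
    then have "r = Ident C H" by (rule m_mono[rotated -1]) (use rt H in \<open>simp_all add: hom_def\<close>)
    then have RI: "comp_ifun C R I = id_ifun C (two H)" using r(2) two_map_Ident[OF H] by simp
    \<comment> \<open>Since \<open>R\<close> is inverse to \<open>I\<close>, the functor
      \<open>two_map l\<close> can be recovered from \<open>R\<close> followed by
      \<open>two_map l\<close>, and that functor is determined by its composite with
      \<open>Q\<close>, hence by \<open>l \<cdot> q\<close>.\<close>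
    have l: "comp_ifun C (comp_ifun C (two_map l) R) Q = two_map (l \<cdot> q)"
      "comp_ifun C (comp_ifun C (two_map l) R) I = two_map l"
      if "l \<in> hom C H z" for l
      using homD[OF that] comp_ifun_assoc[of Q R "two_map l"] comp_ifun_assoc[of I R "two_map l"] two_map_functor[of l]
        R Qt I RI two_map_comp[of l q] qt comp_ifun_Ident(1)[of "two_map l"] by simp_all
    have lk: "k \<in> hom C H z" "k' \<in> hom C H z" using k qt by simp_all
    have "comp_ifun C (two_map k) R = comp_ifun C (two_map k') R"
    proof (rule unique)
      show "comp_ifun C (comp_ifun C (two_map k) R) Q = comp_ifun C (comp_ifun C (two_map k') R) Q"
        by (simp only: l(1)[OF lk(1)] l(1)[OF lk(2)] e)
    qed (use comp_ifun_functor[OF R(1) two_map_functor] kt qt R in simp_all)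
    then have "two_map k = two_map k'" using l(2)[OF lk(1)] l(2)[OF lk(2)] by metis
    then show "k = k'" by (rule two_map_inj[rotated -1]) (use kt in simp_all)
  qed (use qt qfg in simp_all)
  then show ?thesis by blast
qed

end

section \<open>Pullbacks of internal categories\<close>

lemma slice2_simps [simp]:
  "Obj (slice2 K y) = Obj (slice K y)" "Arr (slice2 K y) = Arr (slice K y)"
  "Dom (slice2 K y) = Dom (slice K y)" "Cod (slice2 K y) = Cod (slice K y)"
  "Ident (slice2 K y) = Ident (slice K y)" "Comp (slice2 K y) = Comp (slice K y)"
  "Ident2 (slice2 K y) u = (u, Ident2 K (slice_arrow u), u)"
  "HComp (slice2 K y) (u', \<beta>, v') (u, \<alpha>, v) =
    (u' \<cdot>\<^bsub>slice K y\<^esub> u, HComp K \<beta> \<alpha>, v' \<cdot>\<^bsub>slice K y\<^esub> v)"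
  by (simp_all add: slice2_def two_cat.defs cat.defs)

lemma slice2_hom [simp]: "hom (slice2 K y) = hom (slice K y)"
  by (auto simp: hom_def fun_eq_iff)

lemma slice2_parallel [simp]: "parallel (slice2 K y) = parallel (slice K y)"
  by (auto simp: parallel_def fun_eq_iff)

lemma slice2_cells:
  "\<gamma> \<in> cells (slice2 K y) u v \<longleftrightarrow> (\<exists>\<alpha>. \<gamma> = (u, \<alpha>, v) \<and> parallel (slice K y) u v \<and>
     \<alpha> \<in> cells K (slice_arrow u) (slice_arrow v) \<and>
     HComp K (Ident2 K (Cod (slice K y) u)) \<alpha> = Ident2 K (Dom (slice K y) u))"
  by (cases \<gamma>) (auto simp: cells_def slice2_def two_cat.defs cat.defs)

lemma category_slice2:
  assumes "category K"
  shows "category (slice2 K y)"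
  using category_slice[OF assms, of y] by (simp add: category_def)

lemma inat_eqI:
  fixes \<alpha> \<beta> :: "('o, 'm) inat"
  assumes "tsrc \<alpha> = tsrc \<beta>" "ttrg \<alpha> = ttrg \<beta>" "tcomp \<alpha> = tcomp \<beta>"
  shows "\<alpha> = \<beta>"
  using assms by simp

context category
begin

text \<open>Pullbacks in \<open>Cat C\<close> are computed on objects and on arrows. The mediating
  functor consists of the two mediating arrows in \<open>C\<close>, and each functor law holds for
  it because it holds after both projections.\<close>

lemma Cat_pullbackI:
  assumes F: "internal_functor C F" "internal_functor C G" "fcod F = fcod G"
    and P: "internal_functor C P" "internal_functor C P'" "fdom P = R" "fdom P' = R" "fcod P = fdom F" "fcod P' = fdom G"
    and p0: "is_pullback C (F0 F) (F0 G) (I0 R) (F0 P) (F0 P')"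
    and p1: "is_pullback C (F1 F) (F1 G) (I1 R) (F1 P) (F1 P')"
  shows "is_pullback (Cat C) F G R P P'"
proof (rule category.pullbackI[OF category_Cat])
  show "F \<in> Arr (Cat C)" "G \<in> Arr (Cat C)" "Cod (Cat C) F = Cod (Cat C) G"
    "P \<in> hom (Cat C) R (Dom (Cat C) F)" "P' \<in> hom (Cat C) R (Dom (Cat C) G)"
    using F P by (simp_all add: hom_def)
  show "F \<cdot>\<^bsub>Cat C\<^esub> P = G \<cdot>\<^bsub>Cat C\<^esub> P'"
    using F P pullbackD(11)[OF p0] pullbackD(11)[OF p1] by (auto intro: ifun_eqI)
next
  fix W h k
  assume a: "h \<in> hom (Cat C) W R" "k \<in> hom (Cat C) W R"
    and e: "P \<cdot>\<^bsub>Cat C\<^esub> h = P \<cdot>\<^bsub>Cat C\<^esub> k" "P' \<cdot>\<^bsub>Cat C\<^esub> h = P' \<cdot>\<^bsub>Cat C\<^esub> k"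
  have hk: "internal_functor C h" "internal_functor C k" "fdom h = W" "fdom k = W" "fcod h = R" "fcod k = R"
    using a by (simp_all add: hom_def)
  have e0: "F0 P \<cdot> F0 h = F0 P \<cdot> F0 k" "F0 P' \<cdot> F0 h = F0 P' \<cdot> F0 k"
    and e1: "F1 P \<cdot> F1 h = F1 P \<cdot> F1 k" "F1 P' \<cdot> F1 h = F1 P' \<cdot> F1 k"
    using arg_cong[OF e(1), of F0] arg_cong[OF e(2), of F0] arg_cong[OF e(1), of F1] arg_cong[OF e(2), of F1]
    by simp_all
  note t = ifunD(3-8)[OF hk(1), unfolded hk] ifunD(3-8)[OF hk(2), unfolded hk]
  have "F0 h = F0 k" by (rule pullback_unique[OF p0 _ _ e0]) (simp_all add: hom_def t)
  moreover have "F1 h = F1 k" by (rule pullback_unique[OF p1 _ _ e1]) (simp_all add: hom_def t)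
  ultimately show "h = k" using hk by (intro ifun_eqI) simp_all
next
  fix W U V assume a: "U \<in> hom (Cat C) W (Dom (Cat C) F)" "V \<in> hom (Cat C) W (Dom (Cat C) G)"
    and e: "F \<cdot>\<^bsub>Cat C\<^esub> U = G \<cdot>\<^bsub>Cat C\<^esub> V"
  have UV: "internal_functor C U" "internal_functor C V" "fdom U = W" "fdom V = W" "fcod U = fdom F" "fcod V = fdom G"
    using a by (simp_all add: hom_def)
  have e01: "F0 F \<cdot> F0 U = F0 G \<cdot> F0 V" "F1 F \<cdot> F1 U = F1 G \<cdot> F1 V"
    using arg_cong[OF e, of F0] arg_cong[OF e, of F1] by simp_all
  note w = ifunD(13)[OF UV(1), unfolded UV] ifunD(1)[OF UV(1), unfolded UV]
    and r = ifunD(13)[OF P(1), unfolded P] ifunD(1)[OF P(1), unfolded P]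
  note t = ifunD(3-8)[OF UV(1), unfolded UV] ifunD(3-8)[OF UV(2), unfolded UV]
    ifunD(3-8)[OF F(1)] ifunD(3-8)[OF F(2)] ifunD(3-8)[OF P(1), unfolded P] ifunD(3-8)[OF P(2), unfolded P]
  obtain K0 where K0: "K0 \<in> hom C (I0 W) (I0 R)" "F0 P \<cdot> K0 = F0 U" "F0 P' \<cdot> K0 = F0 V"
    by (rule pullback_factor[OF p0 _ _ e01(1)]) (simp_all add: hom_def t)
  obtain K1 where K1: "K1 \<in> hom C (I1 W) (I1 R)" "F1 P \<cdot> K1 = F1 U" "F1 P' \<cdot> K1 = F1 V"
    by (rule pullback_factor[OF p1 _ _ e01(2)]) (simp_all add: hom_def t)
  note k = homD[OF K0(1)] homD[OF K1(1)] icat_type[OF w(2)] icat_type[OF r(2)]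
  \<comment> \<open>\<open>S\<close> stands for one of the projections \<open>P\<close>,
    \<open>P'\<close>, and \<open>T\<close> for the corresponding leg \<open>U\<close>,
    \<open>V\<close> of the test cone.\<close>
  have st: "F0 S \<cdot> (isrc R \<cdot> K1) = F0 S \<cdot> (K0 \<cdot> isrc W)" "F0 S \<cdot> (itrg R \<cdot> K1) = F0 S \<cdot> (K0 \<cdot> itrg W)"
    "F1 S \<cdot> (K1 \<cdot> iid W) = F1 S \<cdot> (iid R \<cdot> K0)"
    if S: "internal_functor C S" "fdom S = R" and T: "internal_functor C T" "fdom T = W" "fcod T = fcod S"
      and eq: "F0 S \<cdot> K0 = F0 T" "F1 S \<cdot> K1 = F1 T" for S T
  proof -
    note s = ifunD(3-8)[OF S(1), unfolded S] ifunD(3-8)[OF T(1), unfolded T] icat_type[OF ifunD(2)[OF S(1)]]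
    note es = ifunD(9-11)[OF S(1), unfolded S(2)] and et = ifunD(9-11)[OF T(1), unfolded T(2,3)]
    have "F0 S \<cdot> (isrc R \<cdot> K1) = (isrc (fcod S) \<cdot> F1 S) \<cdot> K1" "F0 S \<cdot> (itrg R \<cdot> K1) = (itrg (fcod S) \<cdot> F1 S) \<cdot> K1"
      "F1 S \<cdot> (iid R \<cdot> K0) = (iid (fcod S) \<cdot> F0 S) \<cdot> K0"
      by (rule comp_eq_comp; simp add: s k es)+
    moreover have "F0 S \<cdot> (K0 \<cdot> isrc W) = F0 T \<cdot> isrc W" "F0 S \<cdot> (K0 \<cdot> itrg W) = F0 T \<cdot> itrg W"
      "F1 S \<cdot> (K1 \<cdot> iid W) = F1 T \<cdot> iid W"
      by (rule comp_eq_comp; simp add: s k eq)+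
    ultimately show "F0 S \<cdot> (isrc R \<cdot> K1) = F0 S \<cdot> (K0 \<cdot> isrc W)"
      "F0 S \<cdot> (itrg R \<cdot> K1) = F0 S \<cdot> (K0 \<cdot> itrg W)" "F1 S \<cdot> (K1 \<cdot> iid W) = F1 S \<cdot> (iid R \<cdot> K0)"
      by (simp_all add: s k eq et)
  qed
  note stP = st[OF P(1,3) UV(1,3) _ K0(2) K1(2)] and stP' = st[OF P(2,4) UV(2,4) _ K0(3) K1(3)]
  have sK: "isrc R \<cdot> K1 = K0 \<cdot> isrc W"
    by (rule pullback_unique[OF p0 _ _ stP(1) stP'(1)]) (simp_all add: hom_def k UV P)
  have tK: "itrg R \<cdot> K1 = K0 \<cdot> itrg W"
    by (rule pullback_unique[OF p0 _ _ stP(2) stP'(2)]) (simp_all add: hom_def k UV P)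
  have iK: "K1 \<cdot> iid W = iid R \<cdot> K0"
    by (rule pullback_unique[OF p1 _ _ stP(3) stP'(3)]) (simp_all add: hom_def k UV P)
  have "isrc R \<cdot> (K1 \<cdot> ipr1 W) = (K0 \<cdot> isrc W) \<cdot> ipr1 W" "itrg R \<cdot> (K1 \<cdot> ipr2 W) = (K0 \<cdot> itrg W) \<cdot> ipr2 W"
    by (rule comp_eq_comp; simp add: k sK tK)+
  then have c: "composable R (K1 \<cdot> ipr1 W) (K1 \<cdot> ipr2 W)"
    by (simp add: composable_def k icat_eq(5)[OF w(2)])
  have m: "F1 S \<cdot> (K1 \<cdot> icomp W) = F1 S \<cdot> ecomp C R (K1 \<cdot> ipr1 W) (K1 \<cdot> ipr2 W)"
    if S: "internal_functor C S" "fdom S = R" and T: "internal_functor C T" "fdom T = W" "fcod T = fcod S"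
      and eq: "F1 S \<cdot> K1 = F1 T" for S T
  proof -
    note s = ifunD(3-8)[OF S(1), unfolded S] ifunD(3-8)[OF T(1), unfolded T]
    have "F1 S \<cdot> (K1 \<cdot> x) = F1 T \<cdot> x" if "x \<in> Arr C" "Cod C x = I1 W" for x
      by (rule comp_eq_comp) (simp_all add: s k eq that)
    then show ?thesis
      using ifun_ecomp[OF S(1), unfolded S(2), OF c] ifunD(12)[OF T(1), unfolded T(2,3)] by (simp add: k)
  qed
  have mK: "K1 \<cdot> icomp W = ecomp C R (K1 \<cdot> ipr1 W) (K1 \<cdot> ipr2 W)"
    by (rule pullback_unique[OF p1 _ _ m[OF P(1,3) UV(1,3) _ K1(2)] m[OF P(2,4) UV(2,4) _ K1(3)], of "I2 W"])
      (use ecomp_type[OF r(2) c] in \<open>simp_all add: hom_def k UV P\<close>)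
  let ?K = "\<lparr>fdom = W, fcod = R, F0 = K0, F1 = K1\<rparr>"
  have "internal_functor C ?K"
    by (rule internal_functorI) (simp_all add: w r k sK tK iK mK)
  moreover have "comp_ifun C P ?K = U" "comp_ifun C P' ?K = V"
    by (rule ifun_eqI; simp add: UV P K0 K1)+
  ultimately show "\<exists>h. h \<in> hom (Cat C) W R \<and> P \<cdot>\<^bsub>Cat C\<^esub> h = U \<and> P' \<cdot>\<^bsub>Cat C\<^esub> h = V"
    by (intro exI[of _ ?K]) (simp add: hom_def)
qed

end

context extensive_category
begin

text \<open>The object parts are identities; the square of arrow parts is the sum of two trivial
  squares and the given one.\<close>

lemma two_map_pullback:
  assumes p: "is_pullback C f g x p q"
  shows "is_pullback (Cat C) (two_map f) (two_map g) (two x) (two_map p) (two_map q)"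
proof -
  note t = pullbackD[OF p]
  have i: "is_pullback C (Ident C b) (Ident C b) b (Ident C b) (Ident C b)" if "b \<in> Obj C" for b
    using pullback_Ident[of "Ident C b" b b] that by simp
  have "is_pullback C (F1 (two_map f)) (F1 (two_map g)) (arrows x) (F1 (two_map p)) (F1 (two_map q))"
    using coprod_arr_pullback[OF i[OF one_obj] coprod_arr_pullback[OF i[OF one_obj] p]] by (simp add: two_map_def)
  then show ?thesis
    using t two_map_functor i by (intro Cat_pullbackI) simp_all
qed

text \<open>Every factorisation in \<open>two X\<close> has an identity as one of its factors, so
  factorisations lift uniquely. Formally, the square splits along the two summands of the object of
  pairs, on which composition is \<open>into0\<close> and \<open>into1\<close>, and both parts are
  injection squares.\<close>

lemma two_map_conduche:
  assumes f: "f \<in> Arr C"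
  shows "discrete_conduche C (two_map f)"
proof -
  let ?X = "Dom C f" and ?Y = "Cod C f"
  have X: "?X \<in> Obj C" "?Y \<in> Obj C" using f by simp_all
  note F = two_map_functor[OF f]
  \<comment> \<open>The map that \<open>f\<close> induces between cones; the action of
    \<open>two_map f\<close> on composable pairs turns out to be the sum of two copies of
    it.\<close>
  define c where "c = coprod_arr C (Ident C one) f"
  have c: "c \<in> Arr C" "Dom C c = cone ?X" "Cod C c = cone ?Y" "c \<cdot> apex ?X = apex ?Y" "c \<cdot> base ?X = base ?Y \<cdot> f"
    using f unfolding c_def cone_def apex_def base_def by simp_all
  note m = two_map_F1(1-3)[OF f] two_map_F1(4-6)[OF f refl]
  have i1: "F1 (two_map f) \<cdot> into1 ?X = into1 ?Y \<cdot> c" and i0: "F1 (two_map f) \<cdot> into0 ?X = into0 ?Y \<cdot> c"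
    by (rule cone_eqI[OF X(1)]; simp add: X c m f)+
  have pb1: "is_pullback C (F1 (two_map f)) (into1 ?Y) (cone ?X) (into1 ?X) c"
    by (rule injection_pullback[OF arrows_coproduct1 arrows_coproduct1, of _ _ _ "Ident C one"])
      (simp_all add: hom_def X m f c i1)
  have pb0: "is_pullback C (F1 (two_map f)) (into0 ?Y) (cone ?X) (into0 ?X) c"
    by (rule injection_pullback[OF arrows_coproduct0 arrows_coproduct0, of _ _ _ "Ident C one"])
      (simp_all add: hom_def X m f c i0)
  have "F2 C (two_map f) = coprod_arr C c c"
    unfolding F2_def
  proof (rule ipair_eqI)
    have U: "unital (two ?X)" "unital (two ?Y)" using X two_unital by simp_all
    show "is_pullback C (isrc (fcod (two_map f))) (itrg (fcod (two_map f))) (I2 (fcod (two_map f)))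
      (ipr1 (fcod (two_map f))) (ipr2 (fcod (two_map f)))"
      using icat_pullback[OF U(2)] by simp
    show "composable (fcod (two_map f)) (F1 (two_map f) \<cdot> ipr1 (fdom (two_map f)))
       (F1 (two_map f) \<cdot> ipr2 (fdom (two_map f)))"
      using ifun_composable[OF F composable_projections[OF ifunD(1)[OF F]]] .
    show "ipr1 (fcod (two_map f)) \<cdot> coprod_arr C c c = F1 (two_map f) \<cdot> ipr1 (fdom (two_map f))"
      "ipr2 (fcod (two_map f)) \<cdot> coprod_arr C c c = F1 (two_map f) \<cdot> ipr2 (fdom (two_map f))"
      by (rule copair_eqI[of "cone ?X" "cone ?X"]; simp add: X c m f i0 i1)+
  qed (simp_all add: X c)
  then show ?thesis
    using copair_pullback[OF pb0 pb1] F by (simp add: discrete_conduche_def)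
qed

text \<open>The forgetful functor from the slice has a right adjoint, sending \<open>z\<close> to
  the projection of the product of \<open>z\<close> and \<open>y\<close> onto \<open>y\<close>, so
  it preserves coequalisers. In elementary terms, a test map \<open>h\<close> is replaced by the
  test map \<open>(h, b)\<close> over \<open>y\<close>.\<close>

lemma slice_coequaliser:
  assumes q: "is_coequaliser (slice C y) (a, u, b) (a, v, b) (b, q, c)"
  shows "is_coequaliser C u v q"
proof -
  note s = q[unfolded is_coequaliser_def parallel_def, simplified, unfolded slice_Arr]
  have t: "a \<in> Arr C" "b \<in> Arr C" "c \<in> Arr C" "Cod C a = y" "Cod C b = y" "Cod C c = y"
    "u \<in> hom C (Dom C a) (Dom C b)" "v \<in> hom C (Dom C a) (Dom C b)" "q \<in> hom C (Dom C b) (Dom C c)"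
    "b \<cdot> u = a" "b \<cdot> v = a" "c \<cdot> q = b" "q \<cdot> u = q \<cdot> v"
    using s by auto
  note ht = homD[OF t(7)] homD[OF t(8)] homD[OF t(9)]
  have y: "y \<in> Obj C" using t(1,4) by auto
  have "\<exists>P p1 p2. is_pullback C (bang z) (bang y) P p1 p2" if "z \<in> Obj C" for z
    using pullbacks that y unfolding has_pullbacks_def by simp
  note prod = this
  show ?thesis
  proof (rule coequaliserI)
    fix z h assume h: "h \<in> hom C (Cod C u) z" "h \<cdot> u = h \<cdot> v"
    have z: "z \<in> Obj C" using hom_obj h(1) by blast
    note hh = homD[OF h(1), unfolded ht]
    obtain P p1 p2 where p: "is_pullback C (bang z) (bang y) P p1 p2" using prod[OF z] by blast
    note pt = pullbackD[OF p]
    obtain w where w: "w \<in> hom C (Dom C b) P" "p1 \<cdot> w = h" "p2 \<cdot> w = b"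
      by (rule pullback_factor[OF p, of h "Dom C b" b]) (simp_all add: hh t z y hom_def)
    note wt = homD[OF w(1)]
    have wuv: "w \<cdot> u = w \<cdot> v"
    proof (rule pullback_unique[OF p, of _ "Dom C a"])
      show "p1 \<cdot> (w \<cdot> u) = p1 \<cdot> (w \<cdot> v)"
        using comp_eq_comp[OF w(2), of u] comp_eq_comp[OF w(2), of v] h(2) by (simp add: pt wt ht)
      show "p2 \<cdot> (w \<cdot> u) = p2 \<cdot> (w \<cdot> v)"
        using comp_eq_comp[OF w(3), of u] comp_eq_comp[OF w(3), of v] by (simp add: pt wt ht t y)
    qed (simp_all add: hom_def wt ht)
    obtain k where k: "k \<in> hom (slice C y) c p2" "k \<cdot>\<^bsub>slice C y\<^esub> (b, q, c) = (b, w, p2)"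
      by (rule coequaliser_factor[OF q, of "(b, w, p2)" p2])
        (use w pt t wt wuv y in \<open>simp_all add: slice_hom\<close>)
    then obtain k' where k': "k = (c, k', p2)" "k' \<in> hom C (Dom C c) P" "k' \<cdot> q = w"
      by (auto simp: slice_hom pt)
    note kt = homD[OF k'(2)]
    have "(p1 \<cdot> k') \<cdot> q = h" using k'(3) w(2) by (simp add: pt kt ht)
    moreover have "p1 \<cdot> k' \<in> hom C (Cod C q) z" by (simp add: hom_def pt kt ht z)
    ultimately show "\<exists>k. k \<in> hom C (Cod C q) z \<and> k \<cdot> q = h" by blast
  next
    fix z k l assume kl: "k \<in> hom C (Cod C q) z" "l \<in> hom C (Cod C q) z" "k \<cdot> q = l \<cdot> q"
    have z: "z \<in> Obj C" using hom_obj kl(1) by blast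
    note klt = homD[OF kl(1), unfolded ht] homD[OF kl(2), unfolded ht]
    obtain P p1 p2 where p: "is_pullback C (bang z) (bang y) P p1 p2" using prod[OF z] by blast
    note pt = pullbackD[OF p]
    obtain w where w: "w \<in> hom C (Dom C c) P" "p1 \<cdot> w = k" "p2 \<cdot> w = c"
      by (rule pullback_factor[OF p, of k "Dom C c" c]) (simp_all add: klt t z y hom_def)
    obtain w' where w': "w' \<in> hom C (Dom C c) P" "p1 \<cdot> w' = l" "p2 \<cdot> w' = c"
      by (rule pullback_factor[OF p, of l "Dom C c" c]) (simp_all add: klt t z y hom_def)
    note wt = homD[OF w(1)] homD[OF w'(1)]
    have "w \<cdot> q = w' \<cdot> q"
    proof (rule pullback_unique[OF p, of _ "Dom C b"])
      show "p1 \<cdot> (w \<cdot> q) = p1 \<cdot> (w' \<cdot> q)"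
        using comp_eq_comp[OF w(2), of q] comp_eq_comp[OF w'(2), of q] kl(3) by (simp add: pt wt ht)
      show "p2 \<cdot> (w \<cdot> q) = p2 \<cdot> (w' \<cdot> q)"
        using comp_eq_comp[OF w(3), of q] comp_eq_comp[OF w'(3), of q] by (simp add: pt wt ht t y)
    qed (simp_all add: hom_def wt ht)
    then have wq: "(c, w, p2) \<cdot>\<^bsub>slice C y\<^esub> (b, q, c) = (c, w', p2) \<cdot>\<^bsub>slice C y\<^esub> (b, q, c)" by simp
    have "(c, w, p2) = (c, w', p2)"
      by (rule coequaliser_unique[OF q category_slice[OF category_axioms] _ _ wq, of p2])
        (use w w' pt t y in \<open>simp_all add: slice_hom\<close>)
    then show "k = l" using w(2) w'(2) by simp
  qed (simp_all add: parallel_def ht t(13))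
qed

end

section \<open>Coequalisers in the strict slice\<close>

context extensive_category
begin

text \<open>\<open>F1 (two_map q)\<close> preserves \<open>e0\<close> and \<open>e1\<close> and acts
  as \<open>q\<close> on the edges, and a coequaliser is epic.\<close>

lemma two_map_F1_epi:
  assumes q: "is_coequaliser C f g q" and h: "h \<in> Arr C" "Dom C h = arrows (Cod C q)"
    and k: "k \<in> Arr C" "Dom C k = arrows (Cod C q)" "Cod C h = Cod C k"
    and e: "h \<cdot> F1 (two_map q) = k \<cdot> F1 (two_map q)"
  shows "h = k"
proof -
  have qt: "q \<in> Arr C" using q by (simp add: is_coequaliser_def)
  note t = two_map_F1(1-3)[OF qt] two_map_F1(4-6)[OF qt refl]
  have X: "Dom C q \<in> Obj C" "Cod C q \<in> Obj C" using qt by simp_all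
  have a: "h \<cdot> (F1 (two_map q) \<cdot> w) = k \<cdot> (F1 (two_map q) \<cdot> w)"
    if "w \<in> Arr C" "Cod C w = arrows (Dom C q)" for w
  proof -
    have "(h \<cdot> F1 (two_map q)) \<cdot> w = (k \<cdot> F1 (two_map q)) \<cdot> w" by (simp only: e)
    then show ?thesis by (simp add: that h k t)
  qed
  have "h \<cdot> edge (Cod C q) = k \<cdot> edge (Cod C q)"
    by (rule coequaliser_unique[OF q category_axioms, of _ "Cod C k"])
      (use a[of "edge (Dom C q)"] in \<open>simp_all add: hom_def h k t qt X\<close>)
  then show ?thesis
    using a[of "e0 (Dom C q)"] a[of "e1 (Dom C q)"]
    by (rule_tac arrows_eqI[OF X(2)]) (simp_all add: h k t X)
qed

lemma two_map_epi:
  assumes q: "is_coequaliser C f g q" and k: "internal_functor C k" "internal_functor C l"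
    "fdom k = two (Cod C q)" "fdom l = two (Cod C q)" "fcod k = fcod l"
    "comp_ifun C k (two_map q) = comp_ifun C l (two_map q)"
  shows "k = l"
proof (rule ifun_eqI)
  note t = ifunD(3-8)[OF k(1), unfolded k two_simps] ifunD(3-8)[OF k(2), unfolded k two_simps]
  show "F1 k = F1 l"
    by (rule two_map_F1_epi[OF q]) (use arg_cong[OF k(6), of F1] in \<open>simp_all add: t\<close>)
  show "F0 k = F0 l"
    using arg_cong[OF k(6), of F0] by (simp add: t)
qed (use k in simp_all)

text \<open>\<open>f\<close> and \<open>g\<close> have the same composite with the edge family of
  \<open>h\<close>, so this family descends along \<open>q\<close>; with the endpoints of
  \<open>h\<close> unchanged, the descended family is a \<open>path\<close>.\<close>

lemma two_map_factor:
  assumes q: "is_coequaliser C f g q" and h: "internal_functor C h" "fdom h = two (Cod C f)"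
    "comp_ifun C h (two_map f) = comp_ifun C h (two_map g)"
  obtains k where "internal_functor C k" "fdom k = two (Cod C q)" "fcod k = fcod h" "comp_ifun C k (two_map q) = h"
proof -
  let ?Y = "Cod C f" and ?Z = "Cod C q" and ?D = "fcod h"
  have t: "f \<in> Arr C" "g \<in> Arr C" "Dom C g = Dom C f" "Cod C g = ?Y" "q \<in> Arr C" "Dom C q = ?Y"
    using q by (auto simp: is_coequaliser_def parallel_def)
  have Y: "?Y \<in> Obj C" "?Z \<in> Obj C" "Dom C f \<in> Obj C" using t by simp_all
  note ht = ifunD(3-8)[OF h(1), unfolded h two_simps] icat_type[OF ifunD(2)[OF h(1)]]
  note hv = functor_values(3,4)[OF h(1) Y(1) h(2)]
  let ?y = "F1 h \<cdot> edge ?Y"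
  have "?y \<cdot> f = ?y \<cdot> g"
    using arg_cong[OF h(3), of "\<lambda>F. F1 F \<cdot> edge (Dom C f)"] two_map_F1[OF t(1)] two_map_F1[OF t(2)]
    by (simp add: ht t Y)
  moreover have "?y \<in> hom C ?Y (I1 ?D)" by (simp add: hom_def ht Y)
  ultimately obtain y where y: "y \<in> hom C ?Z (I1 ?D)" "y \<cdot> q = ?y"
    using coequaliser_factor[OF q, of ?y "I1 ?D"] ht by metis
  note yt = homD[OF y(1)]
  have a: "F0 h \<cdot> d0 \<in> hom C one (I0 ?D)" "F0 h \<cdot> d1 \<in> hom C one (I0 ?D)" by (simp_all add: hom_def ht)
  \<comment> \<open>As \<open>q\<close> is epic, it suffices to compare sources and targets after
    \<open>q\<close>, where they are those of the edge family of \<open>h\<close>.\<close>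
  have s: "isrc ?D \<cdot> y = (F0 h \<cdot> d0) \<cdot> bang ?Z" "itrg ?D \<cdot> y = (F0 h \<cdot> d1) \<cdot> bang ?Z"
    by (rule coequaliser_unique[OF q category_axioms, of _ "I0 ?D"];
      simp add: hom_def ht yt t Y y(2) hv)+
  let ?k = "path ?Z ?D (F0 h \<cdot> d0) (F0 h \<cdot> d1) y"
  have k: "internal_functor C ?k" "F1 ?k \<cdot> edge ?Z = y"
    using path_functor[OF Y(2) ifunD(14)[OF h(1)] a y(1) s] by auto
  note kt = ifunD(3-8)[OF k(1), unfolded path_simps two_simps]
  have kF0: "F0 ?k = F0 h" by (rule ob2_eqI) (simp_all add: kt ht)
  have "comp_ifun C ?k (two_map q) = h"
  proof (rule functor_eqI[OF _ h(1) Y(1) _ h(2)])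
    show "F1 (comp_ifun C ?k (two_map q)) \<cdot> edge ?Y = F1 h \<cdot> edge ?Y"
      using comp_eq_comp[OF k(2), of q] by (simp add: kt t Y yt y(2))
    show "F0 (comp_ifun C ?k (two_map q)) = F0 h" using kF0 ht by simp
  qed (use comp_ifun_functor[OF two_map_functor[OF t(5)] k(1)] in \<open>simp_all add: t\<close>)
  then show ?thesis using that[of ?k] k(1) by simp
qed

section \<open>Internal transformations and whiskering\<close>

lemma inatD:
  assumes "internal_nat_trans C \<alpha>"
  shows "internal_functor C (tsrc \<alpha>)" "internal_functor C (ttrg \<alpha>)"
    "fdom (ttrg \<alpha>) = fdom (tsrc \<alpha>)" "fcod (ttrg \<alpha>) = fcod (tsrc \<alpha>)"
    "tcomp \<alpha> \<in> Arr C" "Dom C (tcomp \<alpha>) = I0 (fdom (tsrc \<alpha>))" "Cod C (tcomp \<alpha>) = I1 (fcod (tsrc \<alpha>))"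
    "isrc (fcod (tsrc \<alpha>)) \<cdot> tcomp \<alpha> = F0 (tsrc \<alpha>)" "itrg (fcod (tsrc \<alpha>)) \<cdot> tcomp \<alpha> = F0 (ttrg \<alpha>)"
    "ecomp C (fcod (tsrc \<alpha>)) (tcomp \<alpha> \<cdot> itrg (fdom (tsrc \<alpha>))) (F1 (tsrc \<alpha>)) =
      ecomp C (fcod (tsrc \<alpha>)) (F1 (ttrg \<alpha>)) (tcomp \<alpha> \<cdot> isrc (fdom (tsrc \<alpha>)))"
  using assms by (auto simp: internal_nat_trans_def Let_def hom_def)

text \<open>\<open>two_map q\<close> is the identity on objects, and the other factor of the
  composite component is an identity arrow. A 2-cell out of the quotient thus has the same component
  as its restriction along \<open>two_map q\<close>.\<close>

lemma whisker_two_map: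
  assumes q: "q \<in> Arr C" and k: "internal_functor C (tsrc \<beta>)" "fdom (tsrc \<beta>) = two (Cod C q)"
    and t: "tcomp \<beta> \<in> Arr C" "Dom C (tcomp \<beta>) = ob2" "Cod C (tcomp \<beta>) = I1 (fcod (tsrc \<beta>))"
    "isrc (fcod (tsrc \<beta>)) \<cdot> tcomp \<beta> = F0 (tsrc \<beta>)"
  shows "tcomp (hcomp_inat C \<beta> (id_inat C (two_map q))) = tcomp \<beta>"
proof -
  have Y: "Cod C q \<in> Obj C" using q by simp
  note d = ifunD[OF k(1), unfolded k(2) two_simps]
  have "F1 (tsrc \<beta>) \<cdot> copair (e0 (Cod C q)) (e1 (Cod C q)) = iid (fcod (tsrc \<beta>)) \<cdot> (isrc (fcod (tsrc \<beta>)) \<cdot> tcomp \<beta>)"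
    using d(11) t(4) by simp
  then show ?thesis
    using ecomp_ident(1)[OF d(2) t(1,3)] t Y by (simp add: hcomp_inat_def id_inat_def)
qed

lemma slice_Cat_hom:
  "h \<in> hom (slice (Cat C) Y) B Z \<longleftrightarrow> (\<exists>h'. h = (B, h', Z) \<and> internal_functor C B \<and> fcod B = Y \<and>
     internal_functor C Z \<and> fcod Z = Y \<and> internal_functor C h' \<and> fdom h' = fdom B \<and> fcod h' = fdom Z \<and>
     comp_ifun C Z h' = B)"
  unfolding slice_hom by (auto simp: hom_def)

lemma slice2_Cat_cells:
  "\<gamma> \<in> cells (slice2 (Cat C) Y) u v \<longleftrightarrow> (\<exists>\<alpha>. \<gamma> = (u, \<alpha>, v) \<and> parallel (slice (Cat C) Y) u v \<and>
     internal_nat_trans C \<alpha> \<and> tsrc \<alpha> = slice_arrow u \<and> ttrg \<alpha> = slice_arrow v \<and>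
     hcomp_inat C (id_inat C (Cod (slice (Cat C) Y) u)) \<alpha> = id_inat C (Dom (slice (Cat C) Y) u))"
  by (simp add: slice2_cells) (simp add: cells_def)

text \<open>Factorisations of 1-cells come from \<open>two_map_factor\<close>, and their
  compatibility with the structure functors from \<open>two_map_epi\<close>. The quotient changes
  nothing on objects, so a 2-cell keeps its component and only its naturality has to
  descend.\<close>

lemma two_map_slice2_coequaliser:
  assumes q: "is_coequaliser (slice C y) (a, u, b) (a, v, b) (b, q, c)"
  shows "is_2coequaliser (slice2 (Cat C) (two y)) (two_map a, two_map u, two_map b)
    (two_map a, two_map v, two_map b) (two_map b, two_map q, two_map c)"
proof -
  note Q = slice_coequaliser[OF q]
  note s = q[unfolded is_coequaliser_def parallel_def, simplified, unfolded slice_Arr]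
  have t: "a \<in> Arr C" "b \<in> Arr C" "c \<in> Arr C" "Cod C a = y" "Cod C b = y" "Cod C c = y"
    "u \<in> hom C (Dom C a) (Dom C b)" "v \<in> hom C (Dom C a) (Dom C b)" "q \<in> hom C (Dom C b) (Dom C c)"
    "b \<cdot> u = a" "b \<cdot> v = a" "c \<cdot> q = b" "q \<cdot> u = q \<cdot> v"
    using s by auto
  note ht = homD[OF t(7)] homD[OF t(8)] homD[OF t(9)]
  have F: "internal_functor C (two_map a)" "internal_functor C (two_map b)" "internal_functor C (two_map c)"
    "internal_functor C (two_map u)" "internal_functor C (two_map v)" "internal_functor C (two_map q)"
    using t ht two_map_functor by simp_all
  have T: "comp_ifun C (two_map b) (two_map u) = two_map a" "comp_ifun C (two_map b) (two_map v) = two_map a"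
    "comp_ifun C (two_map c) (two_map q) = two_map b"
    "comp_ifun C (two_map q) (two_map u) = comp_ifun C (two_map q) (two_map v)"
    using two_map_comp t ht by simp_all
  let ?K = "slice2 (Cat C) (two y)"
  let ?u = "(two_map a, two_map u, two_map b)" and ?v = "(two_map a, two_map v, two_map b)"
    and ?q = "(two_map b, two_map q, two_map c)"
  have par: "parallel ?K ?u ?v" "?q \<in> Arr ?K" "Dom ?K ?q = Cod ?K ?u" "?q \<cdot>\<^bsub>?K\<^esub> ?u = ?q \<cdot>\<^bsub>?K\<^esub> ?v"
    by (simp_all add: parallel_def slice_Arr hom_def F T t ht)
  show ?thesis
    unfolding is_2coequaliser_def
  proof (intro conjI ballI impI par)
    fix Z h assume Z: "Z \<in> Obj ?K" and h: "h \<in> hom ?K (Cod ?K ?u) Z" and e: "h \<cdot>\<^bsub>?K\<^esub> ?u = h \<cdot>\<^bsub>?K\<^esub> ?v"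
    from h obtain h' where h': "h = (two_map b, h', Z)" "internal_functor C h'" "fdom h' = two (Dom C b)"
      "fcod h' = fdom Z" "comp_ifun C Z h' = two_map b"
      by (auto simp: slice_Cat_hom)
    have Zt: "internal_functor C Z" "fcod Z = two y" using Z by simp_all
    have e': "comp_ifun C h' (two_map u) = comp_ifun C h' (two_map v)" using e by (simp add: h'(1))
    obtain k where k: "internal_functor C k" "fdom k = two (Cod C q)" "fcod k = fcod h'"
      "comp_ifun C k (two_map q) = h'"
      by (rule two_map_factor[OF Q h'(2) _ e']) (simp add: h' ht)
    have kc: "comp_ifun C Z k = two_map c"
    proof (rule two_map_epi[OF Q])
      show "comp_ifun C (comp_ifun C Z k) (two_map q) = comp_ifun C (two_map c) (two_map q)"
        using comp_ifun_assoc[OF F(6) k(1) Zt(1)] k h' T(3) by simp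
    qed (use comp_ifun_functor[OF k(1) Zt(1)] k h' F Zt in \<open>simp_all add: ht t\<close>)
    show "\<exists>!k. k \<in> hom ?K (Cod ?K ?q) Z \<and> k \<cdot>\<^bsub>?K\<^esub> ?q = h"
    proof (rule ex1I[of _ "(two_map c, k, Z)"])
      show "(two_map c, k, Z) \<in> hom ?K (Cod ?K ?q) Z \<and> (two_map c, k, Z) \<cdot>\<^bsub>?K\<^esub> ?q = h"
        using k kc h' Zt by (simp add: slice_Cat_hom F ht t)
    next
      fix l assume "l \<in> hom ?K (Cod ?K ?q) Z \<and> l \<cdot>\<^bsub>?K\<^esub> ?q = h"
      then obtain l' where l': "l = (two_map c, l', Z)" "internal_functor C l'" "fdom l' = two (Dom C c)"
        "fcod l' = fdom Z" "comp_ifun C l' (two_map q) = h'"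
        by (auto simp: slice_Cat_hom h'(1))
      have "l' = k" by (rule two_map_epi[OF Q]) (use l' k h' in \<open>simp_all add: ht\<close>)
      then show "l = (two_map c, k, Z)" using l' by simp
    qed
  next
    fix Z k k' \<alpha> assume Z: "Z \<in> Obj ?K" and k: "k \<in> hom ?K (Cod ?K ?q) Z" "k' \<in> hom ?K (Cod ?K ?q) Z"
      and \<alpha>: "\<alpha> \<in> cells ?K (k \<cdot>\<^bsub>?K\<^esub> ?q) (k' \<cdot>\<^bsub>?K\<^esub> ?q)"
    have Zt: "internal_functor C Z" "fcod Z = two y" using Z by simp_all
    obtain k1 where k1: "k = (two_map c, k1, Z)" "internal_functor C k1" "fdom k1 = two (Dom C c)"
      "fcod k1 = fdom Z" "comp_ifun C Z k1 = two_map c"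
      using k(1) by (auto simp: slice_Cat_hom)
    obtain k2 where k2: "k' = (two_map c, k2, Z)" "internal_functor C k2" "fdom k2 = two (Dom C c)"
      "fcod k2 = fdom Z" "comp_ifun C Z k2 = two_map c"
      using k(2) by (auto simp: slice_Cat_hom)
    note k1t = ifunD(3-8)[OF k1(2), unfolded k1(3,4) two_simps]
      and k2t = ifunD(3-8)[OF k2(2), unfolded k2(3,4) two_simps]
    let ?B = "fdom Z" and ?A = "two (Dom C c)"
    have B: "unital ?B" using ifunD(1)[OF Zt(1)] .
    obtain \<alpha>' where \<alpha>': "\<alpha> = ((two_map b, comp_ifun C k1 (two_map q), Z), \<alpha>', (two_map b, comp_ifun C k2 (two_map q), Z))"
      "internal_nat_trans C \<alpha>'" "tsrc \<alpha>' = comp_ifun C k1 (two_map q)" "ttrg \<alpha>' = comp_ifun C k2 (two_map q)"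
      "hcomp_inat C (id_inat C Z) \<alpha>' = id_inat C (two_map b)"
      using \<alpha> by (auto simp: slice2_Cat_cells k1(1) k2(1))
    define m where "m = tcomp \<alpha>'"
    note n = inatD[OF \<alpha>'(2), unfolded \<alpha>'(3,4) comp_ifun_simps two_map_simps two_simps k1(4) k2(4) m_def[symmetric] ht]
    have Y: "Dom C b \<in> Obj C" "Dom C c \<in> Obj C" using t by simp_all
    note bt = icat_type[OF B]
    have mt: "m \<in> Arr C" "Dom C m = ob2" "Cod C m = I1 ?B" "isrc ?B \<cdot> m = F0 k1" "itrg ?B \<cdot> m = F0 k2"
      using n k1t k2t by simp_all
    note qt = two_map_F1(1-3)[OF ht(7), unfolded ht]
    have Fq: "src (Dom C c) \<cdot> F1 (two_map q) = src (Dom C b)" "trg (Dom C c) \<cdot> F1 (two_map q) = trg (Dom C b)"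
      using ifunD(9,10)[OF F(6)] Y by (simp_all add: ht)
    have c1: "composable ?B (m \<cdot> trg (Dom C c)) (F1 k1)"
      using comp_eq_comp[OF mt(4), of "trg (Dom C c)"] ifunD(10)[OF k1(2), unfolded k1(3,4)] Y
      by (simp add: composable_def mt bt k1t)
    have c2: "composable ?B (F1 k2) (m \<cdot> src (Dom C c))"
      using comp_eq_comp[OF mt(5), of "src (Dom C c)"] ifunD(9)[OF k2(2), unfolded k2(3,4)] Y
      by (simp add: composable_def mt bt k2t)
    \<comment> \<open>Naturality of \<open>\<alpha>'\<close> is this equation precomposed with
      \<open>F1 (two_map q)\<close>, which is epic.\<close>
    have nat: "ecomp C ?B (m \<cdot> trg (Dom C c)) (F1 k1) = ecomp C ?B (F1 k2) (m \<cdot> src (Dom C c))"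
    proof (rule two_map_F1_epi[OF Q])
      show "ecomp C ?B (m \<cdot> trg (Dom C c)) (F1 k1) \<cdot> F1 (two_map q) =
          ecomp C ?B (F1 k2) (m \<cdot> src (Dom C c)) \<cdot> F1 (two_map q)"
        using n(10) ecomp_comp(2)[OF B c1 qt(1)] ecomp_comp(2)[OF B c2 qt(1)]
        by (simp add: qt k1t k2t mt Y Fq)
    qed (simp_all add: ecomp_type[OF B c1] ecomp_type[OF B c2] Y ht k1t mt)
    let ?b = "\<lparr>tsrc = k1, ttrg = k2, tcomp = m\<rparr>"
    have bnat: "internal_nat_trans C ?b"
      using nat k1 k2 mt by (simp add: internal_nat_trans_def Let_def hom_def)
    have wh: "hcomp_inat C ?b (id_inat C (two_map q)) = \<alpha>'"
    proof (rule inat_eqI)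
      have "tcomp (hcomp_inat C ?b (id_inat C (two_map q))) = tcomp ?b"
        by (rule whisker_two_map) (simp_all add: ht k1 mt)
      then show "tcomp (hcomp_inat C ?b (id_inat C (two_map q))) = tcomp \<alpha>'" by (simp add: m_def)
    qed (simp_all add: hcomp_inat_def id_inat_def \<alpha>')
    \<comment> \<open>\<open>two_map b\<close> and \<open>two_map c\<close> are both the identity on
      objects with codomain \<open>two y\<close>, so their identity 2-cells have equal components
      and the condition on \<open>\<alpha>'\<close> carries over.\<close>
    have over: "hcomp_inat C (id_inat C Z) ?b = id_inat C (two_map c)"
    proof (rule inat_eqI)
      show "tcomp (hcomp_inat C (id_inat C Z) ?b) = tcomp (id_inat C (two_map c))"
        using arg_cong[OF \<alpha>'(5), of tcomp]
        by (simp add: hcomp_inat_def id_inat_def \<alpha>'(3,4) m_def[symmetric] k2t t)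
    qed (simp_all add: hcomp_inat_def id_inat_def k1 k2)
    show "\<exists>!\<beta>. \<beta> \<in> cells ?K k k' \<and> HComp ?K \<beta> (Ident2 ?K ?q) = \<alpha>"
    proof (rule ex1I[of _ "(k, ?b, k')"])
      show "(k, ?b, k') \<in> cells ?K k k' \<and> HComp ?K (k, ?b, k') (Ident2 ?K ?q) = \<alpha>"
        using bnat over wh homD[OF k(1)] homD[OF k(2)]
        by (simp add: slice2_Cat_cells parallel_def k1(1) k2(1) \<alpha>'(1))
    next
      fix \<beta> assume "\<beta> \<in> cells ?K k k' \<and> HComp ?K \<beta> (Ident2 ?K ?q) = \<alpha>"
      then obtain \<beta>' where \<beta>': "\<beta> = (k, \<beta>', k')" "internal_nat_trans C \<beta>'" "tsrc \<beta>' = k1" "ttrg \<beta>' = k2"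
        "hcomp_inat C \<beta>' (id_inat C (two_map q)) = \<alpha>'"
        by (auto simp: slice2_Cat_cells k1(1) k2(1) \<alpha>'(1))
      have "tcomp (hcomp_inat C \<beta>' (id_inat C (two_map q))) = tcomp \<beta>'"
        by (rule whisker_two_map) (use inatD[OF \<beta>'(2)] in \<open>simp_all add: ht k1 \<beta>'\<close>)
      then have "\<beta>' = ?b" using \<beta>' by (intro inat_eqI) (simp_all add: m_def)
      then show "\<beta> = (k, ?b, k')" using \<beta>' by simp
    qed
  qed
qed

end

section \<open>Transport along the chosen pullbacks\<close>

context category
begin

lemma chosen_pullback:
  assumes "is_pullback C f g x p q"
  shows "is_pullback C f g (pb_ob C f g) (pb1 C f g) (pb2 C f g)"
proof -
  have "\<exists>t. (\<lambda>(x, p, q). is_pullback C f g x p q) t" using assms by auto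
  from someI_ex[OF this] show ?thesis
    by (auto simp: pb_ob_def pb1_def pb2_def pb_def split_def)
qed

lemma pullback_map:
  assumes p: "is_pullback C f a x p p'" and r: "is_pullback C f b y r r'"
    and u: "u \<in> hom C (Dom C a) (Dom C b)" "b \<cdot> u = a"
  obtains k where "k \<in> hom C x y" "r \<cdot> k = p" "r' \<cdot> k = u \<cdot> p'"
proof -
  note t = pullbackD[OF p] pullbackD[OF r] homD[OF u(1)]
  show ?thesis
  proof (rule pullback_factor[OF r, of p x "u \<cdot> p'"])
    show "f \<cdot> p = b \<cdot> (u \<cdot> p')" using comp_eq_comp[OF u(2), of p'] by (simp add: t)
  qed (simp_all add: hom_def t that)
qed

lemma pullback_comparison:
  assumes p: "is_pullback C f a x p p'" and r: "is_pullback C f a y r r'"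
  obtains e e' where "e \<in> hom C x y" "e' \<in> hom C y x" "e' \<cdot> e = Ident C x" "e \<cdot> e' = Ident C y"
    "r \<cdot> e = p" "r' \<cdot> e = p'" "p \<cdot> e' = r" "p' \<cdot> e' = r'"
proof -
  note t = pullbackD[OF p] pullbackD[OF r]
  obtain e where e: "e \<in> hom C x y" "r \<cdot> e = p" "r' \<cdot> e = p'"
    by (rule pullback_factor[OF r, of p x p']) (simp_all add: hom_def t)
  obtain e' where e': "e' \<in> hom C y x" "p \<cdot> e' = r" "p' \<cdot> e' = r'"
    by (rule pullback_factor[OF p, of r y r']) (use t(22) in \<open>simp_all add: hom_def t(1-21)\<close>)
  note et = homD[OF e(1)] homD[OF e'(1)]
  have "e' \<cdot> e = Ident C x"
    by (rule pullback_unique[OF p, of _ x])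
      (use comp_eq_comp[OF e'(2), of e] comp_eq_comp[OF e'(3), of e] in \<open>simp_all add: hom_def et e t(1-10,12-21)\<close>)
  moreover have "e \<cdot> e' = Ident C y"
    by (rule pullback_unique[OF r, of _ y])
      (use comp_eq_comp[OF e(2), of e'] comp_eq_comp[OF e(3), of e'] in \<open>simp_all add: hom_def et e' t(1-10,12-21)\<close>)
  ultimately show ?thesis using that e e' by blast
qed

text \<open>Trades the \<open>THE\<close> in \<open>pullback_functor\<close> for the equations that
  characterise the induced arrow between chosen pullbacks.\<close>

lemma pullback_functor_arrow:
  assumes p: "is_pullback C f a x p p'" and r: "is_pullback C f b y r r'"
    and u: "u \<in> hom C (Dom C a) (Dom C b)" "b \<cdot> u = a"
  obtains k where "FArr (pullback_functor C f) (a, u, b) = (pb1 C f a, k, pb1 C f b)"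
    "k \<in> hom C (pb_ob C f a) (pb_ob C f b)" "pb1 C f b \<cdot> k = pb1 C f a" "pb2 C f b \<cdot> k = u \<cdot> pb2 C f a"
proof -
  note P = chosen_pullback[OF p] and R = chosen_pullback[OF r]
  let ?Q = "\<lambda>k. k \<in> hom C (pb_ob C f a) (pb_ob C f b) \<and> pb1 C f b \<cdot> k = pb1 C f a \<and> pb2 C f b \<cdot> k = u \<cdot> pb2 C f a"
  obtain k where k: "k \<in> hom C (pb_ob C f a) (pb_ob C f b)" "pb1 C f b \<cdot> k = pb1 C f a" "pb2 C f b \<cdot> k = u \<cdot> pb2 C f a"
    by (rule pullback_map[OF P R u])
  have "(THE k. ?Q k) = k"
  proof (rule the_equality)
    fix l assume "?Q l"
    then show "l = k" using k by (metis pullback_unique[OF R])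
  qed (use k in simp)
  then show ?thesis using that k by (simp add: pullback_functor_def)
qed

end

text \<open>The square exhibits \<open>W\<close> as \<open>w\<close> conjugated by \<open>e\<close>
  and \<open>d\<close>; a composite formed on the side of \<open>W\<close> is thereby computed on
  the side of \<open>w\<close>.\<close>

lemma (in category) conjugate_square:
  assumes "G \<in> hom C y z" "e' \<in> hom C y' y" "w \<in> hom C x y" "d \<in> hom C x x'" "d' \<in> hom C x' x" "W \<in> hom C x' y'"
    and e: "e \<in> hom C y y'" "e' \<cdot> e = Ident C y" "d \<cdot> d' = Ident C x'" "e \<cdot> w = W \<cdot> d"
  shows "(G \<cdot> e') \<cdot> W = (G \<cdot> w) \<cdot> d'"
proof -
  note t = homD[OF assms(1)] homD[OF assms(2)] homD[OF assms(3)] homD[OF assms(4)] homD[OF assms(5)]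
    homD[OF assms(6)] homD[OF assms(7)]
  have o: "x \<in> Obj C" "y \<in> Obj C" "x' \<in> Obj C" "y' \<in> Obj C" using assms hom_obj by blast+
  have "(G \<cdot> e') \<cdot> W = (G \<cdot> e') \<cdot> (W \<cdot> (d \<cdot> d'))" by (simp add: t o e(3))
  also have "\<dots> = (G \<cdot> e') \<cdot> ((W \<cdot> d) \<cdot> d')" by (simp add: t)
  also have "\<dots> = (G \<cdot> e') \<cdot> ((e \<cdot> w) \<cdot> d')" by (simp only: e(4))
  also have "\<dots> = G \<cdot> ((e' \<cdot> e) \<cdot> (w \<cdot> d'))" by (simp add: t)
  also have "\<dots> = (G \<cdot> w) \<cdot> d'" by (simp add: t o e(2))
  finally show ?thesis .
qed

context extensive_category
begin

lemma two_map_Cat: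
  assumes "k \<in> Arr C"
  shows "two_map k \<in> Arr (Cat C)" "Dom (Cat C) (two_map k) = two (Dom C k)"
    "Cod (Cat C) (two_map k) = two (Cod C k)"
    "l \<in> Arr C \<Longrightarrow> Cod C l = Dom C k \<Longrightarrow> two_map k \<cdot>\<^bsub>Cat C\<^esub> two_map l = two_map (k \<cdot> l)"
  using assms two_map_functor two_map_comp by simp_all

text \<open>\<open>two_map z\<close> and its composite with \<open>G\<close> are both the identity
  on objects, hence so is \<open>G\<close>; this is the hypothesis that \<open>two_map_full\<close>
  asks for.\<close>

lemma two_map_full_over:
  assumes G: "G \<in> hom (Cat C) (two X) (two (Dom C z))" and z: "z \<in> Arr C" and X: "X \<in> Obj C"
    and e: "two_map z \<cdot>\<^bsub>Cat C\<^esub> G = two_map p"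
  obtains k where "k \<in> hom C X (Dom C z)" "G = two_map k"
proof (rule two_map_full[of G X "Dom C z"])
  have "F0 (two_map z \<cdot>\<^bsub>Cat C\<^esub> G) = F0 (two_map p)" by (simp only: e)
  then show "F0 G = Ident C ob2" using G ifunD(3-5)[of G] by (auto simp: hom_def)
qed (use G z X that in \<open>simp_all add: hom_def\<close>)

text \<open>The \<open>\<theta>\<close> compare \<open>two\<close> of a diagram in \<open>C\<close>
  with an isomorphic diagram in \<open>Cat C\<close>, as arises when pullbacks are chosen
  independently on the two sides. A test map is conjugated into \<open>Cat C\<close>, factored there
  and conjugated back; fullness of \<open>two_map\<close> turns the result into an arrow of
  \<open>C\<close>.\<close>

lemma two_map_reflects_coequaliser:
  assumes par: "a1 \<in> Arr C" "b1 \<in> Arr C" "c1 \<in> Arr C" "Cod C a1 = x" "Cod C b1 = x" "Cod C c1 = x"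
    and u: "u \<in> hom C (Dom C a1) (Dom C b1)" "b1 \<cdot> u = a1"
    and v: "v \<in> hom C (Dom C a1) (Dom C b1)" "b1 \<cdot> v = a1"
    and q: "q \<in> hom C (Dom C b1) (Dom C c1)" "c1 \<cdot> q = b1"
    and quv: "q \<cdot> u = q \<cdot> v"
    and Q: "is_2coequaliser (slice2 (Cat C) (two x)) (A1, U, B1) (A1, V, B1) (B1, W, C1)"
    and \<theta>a: "\<theta>a \<in> hom (Cat C) (two (Dom C a1)) (fdom A1)"
      "\<theta>a' \<in> hom (Cat C) (fdom A1) (two (Dom C a1))" "\<theta>a \<cdot>\<^bsub>Cat C\<^esub> \<theta>a' = Ident (Cat C) (fdom A1)"
    and \<theta>b: "\<theta>b \<in> hom (Cat C) (two (Dom C b1)) (fdom B1)"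
      "\<theta>b' \<in> hom (Cat C) (fdom B1) (two (Dom C b1))" "\<theta>b' \<cdot>\<^bsub>Cat C\<^esub> \<theta>b = Ident (Cat C) (two (Dom C b1))"
      "\<theta>b \<cdot>\<^bsub>Cat C\<^esub> \<theta>b' = Ident (Cat C) (fdom B1)" "B1 \<cdot>\<^bsub>Cat C\<^esub> \<theta>b = two_map b1"
    and \<theta>c: "\<theta>c \<in> hom (Cat C) (two (Dom C c1)) (fdom C1)"
      "\<theta>c' \<in> hom (Cat C) (fdom C1) (two (Dom C c1))" "\<theta>c' \<cdot>\<^bsub>Cat C\<^esub> \<theta>c = Ident (Cat C) (two (Dom C c1))"
      "\<theta>c \<cdot>\<^bsub>Cat C\<^esub> \<theta>c' = Ident (Cat C) (fdom C1)" "C1 \<cdot>\<^bsub>Cat C\<^esub> \<theta>c = two_map c1"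
    and nu: "\<theta>b \<cdot>\<^bsub>Cat C\<^esub> two_map u = U \<cdot>\<^bsub>Cat C\<^esub> \<theta>a"
    and nv: "\<theta>b \<cdot>\<^bsub>Cat C\<^esub> two_map v = V \<cdot>\<^bsub>Cat C\<^esub> \<theta>a"
    and nq: "\<theta>c \<cdot>\<^bsub>Cat C\<^esub> two_map q = W \<cdot>\<^bsub>Cat C\<^esub> \<theta>b"
  shows "is_coequaliser (slice C x) (a1, u, b1) (a1, v, b1) (b1, q, c1)"
proof -
  interpret K: category "Cat C" by (rule category_Cat)
  let ?S = "slice2 (Cat C) (two x)"
  note S = Q[unfolded is_2coequaliser_def slice2_parallel parallel_def, simplified, unfolded slice_Arr]
  have SA: "internal_functor C A1" "internal_functor C B1" "internal_functor C C1"
    "fcod A1 = two x" "fcod B1 = two x" "fcod C1 = two x"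
    "U \<in> hom (Cat C) (fdom A1) (fdom B1)" "V \<in> hom (Cat C) (fdom A1) (fdom B1)"
    "W \<in> hom (Cat C) (fdom B1) (fdom C1)" "B1 \<cdot>\<^bsub>Cat C\<^esub> U = A1" "B1 \<cdot>\<^bsub>Cat C\<^esub> V = A1" "C1 \<cdot>\<^bsub>Cat C\<^esub> W = B1"
    using S by auto
  have SK: "A1 \<in> Arr (Cat C)" "B1 \<in> Arr (Cat C)" "C1 \<in> Arr (Cat C)"
    "Dom (Cat C) A1 = fdom A1" "Dom (Cat C) B1 = fdom B1" "Dom (Cat C) C1 = fdom C1"
    "Cod (Cat C) A1 = two x" "Cod (Cat C) B1 = two x" "Cod (Cat C) C1 = two x"
    using SA by simp_all
  have factor: "\<exists>L. L \<in> hom (Cat C) (fdom C1) (two (Dom C z)) \<and> two_map z \<cdot>\<^bsub>Cat C\<^esub> L = C1 \<and> L \<cdot>\<^bsub>Cat C\<^esub> W = H"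
    if z: "z \<in> Arr C" "Cod C z = x" and H: "H \<in> hom (Cat C) (fdom B1) (two (Dom C z))"
      "two_map z \<cdot>\<^bsub>Cat C\<^esub> H = B1" "H \<cdot>\<^bsub>Cat C\<^esub> U = H \<cdot>\<^bsub>Cat C\<^esub> V" for z H
  proof -
    have Ht: "internal_functor C H" "fdom H = fdom B1" "fcod H = two (Dom C z)"
      "comp_ifun C (two_map z) H = B1" "comp_ifun C H U = comp_ifun C H V"
      using H by (simp_all add: hom_def)
    obtain L where "L \<in> hom ?S C1 (two_map z)" "L \<cdot>\<^bsub>?S\<^esub> (B1, W, C1) = (B1, H, two_map z)"
      by (rule coequaliser2_factor[OF Q, of "(B1, H, two_map z)" "two_map z"])
        (simp_all add: slice_Cat_hom two_map_functor z SA Ht)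
    then show ?thesis by (auto simp: slice_Cat_hom) (auto simp: hom_def)
  qed
  have unique: "L = L'"
    if "z \<in> Arr C" "Cod C z = x" "L \<in> hom (Cat C) (fdom C1) (two (Dom C z))" "L' \<in> hom (Cat C) (fdom C1) (two (Dom C z))"
      "two_map z \<cdot>\<^bsub>Cat C\<^esub> L = C1" "two_map z \<cdot>\<^bsub>Cat C\<^esub> L' = C1" "L \<cdot>\<^bsub>Cat C\<^esub> W = L' \<cdot>\<^bsub>Cat C\<^esub> W" for z L L'
  proof -
    have "(C1, L, two_map z) = (C1, L', two_map z)"
      by (rule coequaliser2_unique[OF Q category_slice2[OF category_Cat], of _ "two_map z"])
        (use that homD[OF that(3)] homD[OF that(4)] in
          \<open>simp_all add: slice_Cat_hom SA two_map_functor\<close>)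
    then show ?thesis by simp
  qed
  note t = par homD[OF u(1)] homD[OF v(1)] homD[OF q(1)]
  have X: "Dom C a1 \<in> Obj C" "Dom C b1 \<in> Obj C" "Dom C c1 \<in> Obj C" using par by simp_all
  \<comment> \<open>Keeps composition in \<open>Cat C\<close> folded, so that the category laws of
    \<open>K\<close> act as rewrite rules.\<close>
  note Cat_simps [simp del]
  note K\<theta> = homD[OF \<theta>a(1)] homD[OF \<theta>a(2)] homD[OF \<theta>b(1)] homD[OF \<theta>b(2)] homD[OF \<theta>c(1)] homD[OF \<theta>c(2)]
    homD[OF SA(7)] homD[OF SA(8)] homD[OF SA(9)]
  have two_hom: "two_map k \<in> hom (Cat C) (two y) (two z)" if "k \<in> hom C y z" for k y z
    using two_map_Cat homD[OF that] by (simp add: hom_def)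
  show ?thesis
  proof (rule coequaliserI)
    fix z h assume h: "h \<in> hom (slice C x) (Cod (slice C x) (a1, u, b1)) z"
      and e: "h \<cdot>\<^bsub>slice C x\<^esub> (a1, u, b1) = h \<cdot>\<^bsub>slice C x\<^esub> (a1, v, b1)"
    obtain h' where h': "h = (b1, h', z)" "z \<in> Arr C" "Cod C z = x" "h' \<in> hom C (Dom C b1) (Dom C z)" "z \<cdot> h' = b1"
      using h by (auto simp: slice_hom)
    have e': "h' \<cdot> u = h' \<cdot> v" using e by (simp add: h'(1))
    note h't = homD[OF h'(4)]
    let ?H = "two_map h' \<cdot>\<^bsub>Cat C\<^esub> \<theta>b'"
    have H: "?H \<in> hom (Cat C) (fdom B1) (two (Dom C z))"
      by (rule K.Comp_in_hom[OF \<theta>b(2) two_hom[OF h'(4)]])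
    have "two_map z \<cdot>\<^bsub>Cat C\<^esub> ?H = two_map b1 \<cdot>\<^bsub>Cat C\<^esub> \<theta>b'"
      by (rule K.comp_eq_comp) (use K\<theta> h' h't two_map_Cat in simp_all)
    also have "\<dots> = B1 \<cdot>\<^bsub>Cat C\<^esub> (\<theta>b \<cdot>\<^bsub>Cat C\<^esub> \<theta>b')"
      unfolding \<theta>b(5)[symmetric] by (simp add: K\<theta> SK)
    also have "\<dots> = B1" by (simp add: \<theta>b(4) SK)
    finally have HB: "two_map z \<cdot>\<^bsub>Cat C\<^esub> ?H = B1" .
    have "?H \<cdot>\<^bsub>Cat C\<^esub> U = (two_map h' \<cdot>\<^bsub>Cat C\<^esub> two_map u) \<cdot>\<^bsub>Cat C\<^esub> \<theta>a'"
      by (rule K.conjugate_square[OF two_hom[OF h'(4)] \<theta>b(2) two_hom[OF u(1)] \<theta>a(1,2) SA(7) \<theta>b(1,3) \<theta>a(3) nu])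
    also have "\<dots> = (two_map h' \<cdot>\<^bsub>Cat C\<^esub> two_map v) \<cdot>\<^bsub>Cat C\<^esub> \<theta>a'"
      using two_map_Cat(4)[OF h't(1)] t h't e' by simp
    also have "\<dots> = ?H \<cdot>\<^bsub>Cat C\<^esub> V"
      by (rule K.conjugate_square[symmetric, OF two_hom[OF h'(4)] \<theta>b(2) two_hom[OF v(1)] \<theta>a(1,2) SA(8) \<theta>b(1,3) \<theta>a(3) nv])
    finally obtain L where L: "L \<in> hom (Cat C) (fdom C1) (two (Dom C z))" "two_map z \<cdot>\<^bsub>Cat C\<^esub> L = C1"
      "L \<cdot>\<^bsub>Cat C\<^esub> W = ?H"
      using factor[OF h'(2,3) H HB] by blast
    note Lt = homD[OF L(1)]
    have "two_map z \<cdot>\<^bsub>Cat C\<^esub> (L \<cdot>\<^bsub>Cat C\<^esub> \<theta>c) = C1 \<cdot>\<^bsub>Cat C\<^esub> \<theta>c"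
      by (rule K.comp_eq_comp[OF L(2)]) (use K\<theta> h' Lt two_map_Cat in simp_all)
    then have zL: "two_map z \<cdot>\<^bsub>Cat C\<^esub> (L \<cdot>\<^bsub>Cat C\<^esub> \<theta>c) = two_map c1" by (simp only: \<theta>c(5))
    obtain k where k: "k \<in> hom C (Dom C c1) (Dom C z)" "L \<cdot>\<^bsub>Cat C\<^esub> \<theta>c = two_map k"
      by (rule two_map_full_over[OF K.Comp_in_hom[OF \<theta>c(1) L(1)] h'(2) X(3) zL])
    note kt = homD[OF k(1)]
    have zk: "z \<cdot> k = c1"
      by (rule two_map_inj) (use zL two_map_Cat(4)[OF h'(2) kt(1)] kt h' t k(2) in simp_all)
    have "two_map (k \<cdot> q) = (L \<cdot>\<^bsub>Cat C\<^esub> \<theta>c) \<cdot>\<^bsub>Cat C\<^esub> two_map q"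
      using two_map_Cat(4)[OF kt(1)] kt t k(2) by simp
    also have "\<dots> = L \<cdot>\<^bsub>Cat C\<^esub> (W \<cdot>\<^bsub>Cat C\<^esub> \<theta>b)"
      unfolding nq[symmetric] by (rule K.comp_assoc) (use K\<theta> Lt t two_map_Cat in simp_all)
    also have "\<dots> = ?H \<cdot>\<^bsub>Cat C\<^esub> \<theta>b"
      by (rule K.comp_eq_comp[OF L(3)]) (use K\<theta> Lt in simp_all)
    also have "\<dots> = two_map h' \<cdot>\<^bsub>Cat C\<^esub> (\<theta>b' \<cdot>\<^bsub>Cat C\<^esub> \<theta>b)"
      by (rule K.comp_assoc) (use K\<theta> h't two_map_Cat in simp_all)
    also have "\<dots> = two_map h'"
      using two_map_Cat[OF h't(1)] h't by (simp add: \<theta>b(3))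
    finally have "k \<cdot> q = h'"
      by (rule two_map_inj[rotated -1]) (use kt t h't in simp_all)
    then have "(c1, k, z) \<in> hom (slice C x) (Cod (slice C x) (b1, q, c1)) z \<and>
        (c1, k, z) \<cdot>\<^bsub>slice C x\<^esub> (b1, q, c1) = h"
      using k zk h' par by (simp add: slice_hom)
    then show "\<exists>k. k \<in> hom (slice C x) (Cod (slice C x) (b1, q, c1)) z \<and> k \<cdot>\<^bsub>slice C x\<^esub> (b1, q, c1) = h"
      by blast
  next
    fix z k l assume k: "k \<in> hom (slice C x) (Cod (slice C x) (b1, q, c1)) z"
      and l: "l \<in> hom (slice C x) (Cod (slice C x) (b1, q, c1)) z"
      and e: "k \<cdot>\<^bsub>slice C x\<^esub> (b1, q, c1) = l \<cdot>\<^bsub>slice C x\<^esub> (b1, q, c1)"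
    obtain k' where k': "k = (c1, k', z)" "z \<in> Arr C" "Cod C z = x" "k' \<in> hom C (Dom C c1) (Dom C z)" "z \<cdot> k' = c1"
      using k by (auto simp: slice_hom)
    obtain l' where l': "l = (c1, l', z)" "l' \<in> hom C (Dom C c1) (Dom C z)" "z \<cdot> l' = c1"
      using l by (auto simp: slice_hom)
    have e': "k' \<cdot> q = l' \<cdot> q" using e by (simp add: k'(1) l'(1))
    \<comment> \<open>For a competing factorisation \<open>m\<close>, its conjugate lies over
      \<open>C1\<close>, restricts along \<open>W\<close> to a functor that depends only on
      \<open>m \<cdot> q\<close>, and still determines \<open>two_map m\<close>.\<close>
    have over: "two_map z \<cdot>\<^bsub>Cat C\<^esub> (two_map m \<cdot>\<^bsub>Cat C\<^esub> \<theta>c') = C1"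
      and desc: "(two_map m \<cdot>\<^bsub>Cat C\<^esub> \<theta>c') \<cdot>\<^bsub>Cat C\<^esub> W = two_map (m \<cdot> q) \<cdot>\<^bsub>Cat C\<^esub> \<theta>b'"
      and retr: "(two_map m \<cdot>\<^bsub>Cat C\<^esub> \<theta>c') \<cdot>\<^bsub>Cat C\<^esub> \<theta>c = two_map m"
      and mhom: "two_map m \<cdot>\<^bsub>Cat C\<^esub> \<theta>c' \<in> hom (Cat C) (fdom C1) (two (Dom C z))"
      if m: "m \<in> hom C (Dom C c1) (Dom C z)" "z \<cdot> m = c1" for m
    proof -
      note mt = homD[OF m(1)]
      have "two_map z \<cdot>\<^bsub>Cat C\<^esub> (two_map m \<cdot>\<^bsub>Cat C\<^esub> \<theta>c') = two_map c1 \<cdot>\<^bsub>Cat C\<^esub> \<theta>c'"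
        by (rule K.comp_eq_comp) (use K\<theta> k' m(2) mt two_map_Cat in simp_all)
      also have "\<dots> = C1 \<cdot>\<^bsub>Cat C\<^esub> (\<theta>c \<cdot>\<^bsub>Cat C\<^esub> \<theta>c')"
        unfolding \<theta>c(5)[symmetric] by (simp add: K\<theta> SK)
      also have "\<dots> = C1" by (simp add: \<theta>c(4) SK)
      finally show "two_map z \<cdot>\<^bsub>Cat C\<^esub> (two_map m \<cdot>\<^bsub>Cat C\<^esub> \<theta>c') = C1" .
      have "(two_map m \<cdot>\<^bsub>Cat C\<^esub> \<theta>c') \<cdot>\<^bsub>Cat C\<^esub> W = (two_map m \<cdot>\<^bsub>Cat C\<^esub> two_map q) \<cdot>\<^bsub>Cat C\<^esub> \<theta>b'"
        by (rule K.conjugate_square[OF two_hom[OF m(1)] \<theta>c(2) two_hom[OF q(1)] \<theta>b(1,2) SA(9) \<theta>c(1,3) \<theta>b(4) nq])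
      then show "(two_map m \<cdot>\<^bsub>Cat C\<^esub> \<theta>c') \<cdot>\<^bsub>Cat C\<^esub> W = two_map (m \<cdot> q) \<cdot>\<^bsub>Cat C\<^esub> \<theta>b'"
        using two_map_Cat(4)[OF mt(1)] mt t by simp
      have "(two_map m \<cdot>\<^bsub>Cat C\<^esub> \<theta>c') \<cdot>\<^bsub>Cat C\<^esub> \<theta>c = two_map m \<cdot>\<^bsub>Cat C\<^esub> (\<theta>c' \<cdot>\<^bsub>Cat C\<^esub> \<theta>c)"
        by (rule K.comp_assoc) (use K\<theta> mt two_map_Cat in simp_all)
      also have "\<dots> = two_map m" using two_map_Cat[OF mt(1)] mt by (simp add: \<theta>c(3))
      finally show "(two_map m \<cdot>\<^bsub>Cat C\<^esub> \<theta>c') \<cdot>\<^bsub>Cat C\<^esub> \<theta>c = two_map m" .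
      show "two_map m \<cdot>\<^bsub>Cat C\<^esub> \<theta>c' \<in> hom (Cat C) (fdom C1) (two (Dom C z))"
        by (rule K.Comp_in_hom[OF \<theta>c(2) two_hom[OF m(1)]])
    qed
    note K' = over[OF k'(4,5)] desc[OF k'(4,5)] retr[OF k'(4,5)] mhom[OF k'(4,5)]
      and L' = over[OF l'(2,3)] desc[OF l'(2,3)] retr[OF l'(2,3)] mhom[OF l'(2,3)]
    have "two_map k' \<cdot>\<^bsub>Cat C\<^esub> \<theta>c' = two_map l' \<cdot>\<^bsub>Cat C\<^esub> \<theta>c'"
      by (rule unique[OF k'(2,3) K'(4) L'(4) K'(1) L'(1)]) (simp only: K'(2) L'(2) e')
    then have "two_map k' = two_map l'" using K'(3) L'(3) by metis
    then have "k' = l'"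
      by (rule two_map_inj[rotated -1]) (use homD[OF k'(4)] homD[OF l'(2)] in simp_all)
    then show "k = l" using k'(1) l'(1) by simp
  qed (use par u v q quv in \<open>simp_all add: parallel_def slice_Arr\<close>)
qed

text \<open>The stability hypothesis speaks of the pullbacks chosen in \<open>Cat C\<close>, the
  conclusion of those chosen in \<open>C\<close>. By \<open>two_map_pullback\<close>,
  \<open>two\<close> of the latter are pullbacks in \<open>Cat C\<close> as well, so the two are
  compared there.\<close>

lemma coequaliser_pullback:
  assumes f: "f \<in> Arr C" and st: "Cat_coequalisers_stable_along_discrete_conduche C"
    and q: "is_coequaliser (slice C (Cod C f)) u v q"
  shows "is_coequaliser (slice C (Dom C f)) (FArr (pullback_functor C f) u) (FArr (pullback_functor C f) v)
    (FArr (pullback_functor C f) q)"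
proof -
  interpret K: category "Cat C" by (rule category_Cat)
  let ?F = "two_map f"
  obtain a u' b a' v' b' b'' q' c where trip: "u = (a, u', b)" "v = (a', v', b')" "q = (b'', q', c)"
    by (metis prod_cases3)
  have eq: "a' = a" "b' = b" "b'' = b"
    using q by (simp_all add: is_coequaliser_def parallel_def trip)
  note q = q[unfolded trip eq]
  note s = q[unfolded is_coequaliser_def parallel_def, simplified, unfolded slice_Arr]
  have t: "a \<in> Arr C" "b \<in> Arr C" "c \<in> Arr C" "Cod C a = Cod C f" "Cod C b = Cod C f" "Cod C c = Cod C f"
    "u' \<in> hom C (Dom C a) (Dom C b)" "v' \<in> hom C (Dom C a) (Dom C b)" "q' \<in> hom C (Dom C b) (Dom C c)"
    "b \<cdot> u' = a" "b \<cdot> v' = a" "c \<cdot> q' = b" "q' \<cdot> u' = q' \<cdot> v'"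
    using s by auto
  note ht = homD[OF t(7)] homD[OF t(8)] homD[OF t(9)]
  have two_hom: "two_map k \<in> hom (Cat C) (two y) (two z)" if "k \<in> hom C y z" for k y z
    using two_map_functor homD[OF that] by (simp add: hom_def)
  have pb: "is_pullback C f w (pb_ob C f w) (pb1 C f w) (pb2 C f w)" if "w \<in> Arr C" "Cod C w = Cod C f" for w
    using pullbacks f that chosen_pullback unfolding has_pullbacks_def by metis
  note A = pb[OF t(1,4)] and B = pb[OF t(2,5)] and D = pb[OF t(3,6)]
  note A2 = two_map_pullback[OF A] and B2 = two_map_pullback[OF B] and D2 = two_map_pullback[OF D]
  note A3 = K.chosen_pullback[OF A2] and B3 = K.chosen_pullback[OF B2] and D3 = K.chosen_pullback[OF D2]
  note At = pullbackD[OF A] and Bt = pullbackD[OF B] and Dt = pullbackD[OF D]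
  note A3t = K.pullbackD[OF A3] and B3t = K.pullbackD[OF B3] and D3t = K.pullbackD[OF D3]
  obtain us where us: "FArr (pullback_functor C f) (a, u', b) = (pb1 C f a, us, pb1 C f b)"
    "us \<in> hom C (pb_ob C f a) (pb_ob C f b)" "pb1 C f b \<cdot> us = pb1 C f a" "pb2 C f b \<cdot> us = u' \<cdot> pb2 C f a"
    by (rule pullback_functor_arrow[OF A B t(7,10)])
  obtain vs where vs: "FArr (pullback_functor C f) (a, v', b) = (pb1 C f a, vs, pb1 C f b)"
    "vs \<in> hom C (pb_ob C f a) (pb_ob C f b)" "pb1 C f b \<cdot> vs = pb1 C f a" "pb2 C f b \<cdot> vs = v' \<cdot> pb2 C f a"
    by (rule pullback_functor_arrow[OF A B t(8,11)])
  obtain qs where qs: "FArr (pullback_functor C f) (b, q', c) = (pb1 C f b, qs, pb1 C f c)"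
    "qs \<in> hom C (pb_ob C f b) (pb_ob C f c)" "pb1 C f c \<cdot> qs = pb1 C f b" "pb2 C f c \<cdot> qs = q' \<cdot> pb2 C f b"
    by (rule pullback_functor_arrow[OF B D t(9,12)])
  have arr: "two_map k \<in> hom (Cat C) (Dom (Cat C) (two_map w)) (Dom (Cat C) (two_map z))"
    "two_map z \<cdot>\<^bsub>Cat C\<^esub> two_map k = two_map w"
    if "k \<in> hom C (Dom C w) (Dom C z)" "z \<cdot> k = w" "z \<in> Arr C" for k w z
    using two_hom[OF that(1)] two_map_comp[OF that(3), of k] homD[OF that(1)] that(2) by simp_all
  obtain U where U: "FArr (pullback_functor (Cat C) ?F) (two_map a, two_map u', two_map b) =
      (pb1 (Cat C) ?F (two_map a), U, pb1 (Cat C) ?F (two_map b))"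
    "U \<in> hom (Cat C) (pb_ob (Cat C) ?F (two_map a)) (pb_ob (Cat C) ?F (two_map b))"
    "pb1 (Cat C) ?F (two_map b) \<cdot>\<^bsub>Cat C\<^esub> U = pb1 (Cat C) ?F (two_map a)"
    "pb2 (Cat C) ?F (two_map b) \<cdot>\<^bsub>Cat C\<^esub> U = two_map u' \<cdot>\<^bsub>Cat C\<^esub> pb2 (Cat C) ?F (two_map a)"
    by (rule K.pullback_functor_arrow[OF A3 B3 arr[OF t(7,10,2)]])
  obtain V where V: "FArr (pullback_functor (Cat C) ?F) (two_map a, two_map v', two_map b) =
      (pb1 (Cat C) ?F (two_map a), V, pb1 (Cat C) ?F (two_map b))"
    "V \<in> hom (Cat C) (pb_ob (Cat C) ?F (two_map a)) (pb_ob (Cat C) ?F (two_map b))"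
    "pb1 (Cat C) ?F (two_map b) \<cdot>\<^bsub>Cat C\<^esub> V = pb1 (Cat C) ?F (two_map a)"
    "pb2 (Cat C) ?F (two_map b) \<cdot>\<^bsub>Cat C\<^esub> V = two_map v' \<cdot>\<^bsub>Cat C\<^esub> pb2 (Cat C) ?F (two_map a)"
    by (rule K.pullback_functor_arrow[OF A3 B3 arr[OF t(8,11,2)]])
  obtain W where W: "FArr (pullback_functor (Cat C) ?F) (two_map b, two_map q', two_map c) =
      (pb1 (Cat C) ?F (two_map b), W, pb1 (Cat C) ?F (two_map c))"
    "W \<in> hom (Cat C) (pb_ob (Cat C) ?F (two_map b)) (pb_ob (Cat C) ?F (two_map c))"
    "pb1 (Cat C) ?F (two_map c) \<cdot>\<^bsub>Cat C\<^esub> W = pb1 (Cat C) ?F (two_map b)"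
    "pb2 (Cat C) ?F (two_map c) \<cdot>\<^bsub>Cat C\<^esub> W = two_map q' \<cdot>\<^bsub>Cat C\<^esub> pb2 (Cat C) ?F (two_map b)"
    by (rule K.pullback_functor_arrow[OF B3 D3 arr[OF t(9,12,3)]])
  have "is_2coequaliser (slice2 (Cat C) (two (Cod C f))) (two_map a, two_map u', two_map b)
    (two_map a, two_map v', two_map b) (two_map b, two_map q', two_map c)"
    by (rule two_map_slice2_coequaliser[OF q])
  then have "is_2coequaliser (slice2 (Cat C) (fcod ?F)) (two_map a, two_map u', two_map b)
    (two_map a, two_map v', two_map b) (two_map b, two_map q', two_map c) \<and>
    agree_on_objects (slice_arrow (two_map a, two_map u', two_map b)) (slice_arrow (two_map a, two_map v', two_map b))"
    by (simp add: agree_on_objects_def)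
  with st two_map_conduche[OF f] have "is_2coequaliser (slice2 (Cat C) (fdom ?F))
    (FArr (pullback_functor (Cat C) ?F) (two_map a, two_map u', two_map b))
    (FArr (pullback_functor (Cat C) ?F) (two_map a, two_map v', two_map b))
    (FArr (pullback_functor (Cat C) ?F) (two_map b, two_map q', two_map c))"
    unfolding Cat_coequalisers_stable_along_discrete_conduche_def by blast
  then have Q: "is_2coequaliser (slice2 (Cat C) (two (Dom C f)))
    (pb1 (Cat C) ?F (two_map a), U, pb1 (Cat C) ?F (two_map b))
    (pb1 (Cat C) ?F (two_map a), V, pb1 (Cat C) ?F (two_map b))
    (pb1 (Cat C) ?F (two_map b), W, pb1 (Cat C) ?F (two_map c))"
    by (simp add: U(1) V(1) W(1))
  \<comment> \<open>Naturality of the comparisons: both sides agree after the two projections of the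
    chosen pullback of \<open>two_map z\<close>.\<close>
  have transport: "e' \<cdot>\<^bsub>Cat C\<^esub> two_map k = G \<cdot>\<^bsub>Cat C\<^esub> e"
    if wz: "w \<in> Arr C" "Cod C w = Cod C f" "z \<in> Arr C" "Cod C z = Cod C f" "l \<in> hom C (Dom C w) (Dom C z)"
      and k: "k \<in> hom C (pb_ob C f w) (pb_ob C f z)" "pb1 C f z \<cdot> k = pb1 C f w" "pb2 C f z \<cdot> k = l \<cdot> pb2 C f w"
      and G: "G \<in> hom (Cat C) (pb_ob (Cat C) ?F (two_map w)) (pb_ob (Cat C) ?F (two_map z))"
        "pb1 (Cat C) ?F (two_map z) \<cdot>\<^bsub>Cat C\<^esub> G = pb1 (Cat C) ?F (two_map w)"
        "pb2 (Cat C) ?F (two_map z) \<cdot>\<^bsub>Cat C\<^esub> G = two_map l \<cdot>\<^bsub>Cat C\<^esub> pb2 (Cat C) ?F (two_map w)"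
      and e: "e \<in> hom (Cat C) (two (pb_ob C f w)) (pb_ob (Cat C) ?F (two_map w))"
        "pb1 (Cat C) ?F (two_map w) \<cdot>\<^bsub>Cat C\<^esub> e = two_map (pb1 C f w)"
        "pb2 (Cat C) ?F (two_map w) \<cdot>\<^bsub>Cat C\<^esub> e = two_map (pb2 C f w)"
      and e': "e' \<in> hom (Cat C) (two (pb_ob C f z)) (pb_ob (Cat C) ?F (two_map z))"
        "pb1 (Cat C) ?F (two_map z) \<cdot>\<^bsub>Cat C\<^esub> e' = two_map (pb1 C f z)"
        "pb2 (Cat C) ?F (two_map z) \<cdot>\<^bsub>Cat C\<^esub> e' = two_map (pb2 C f z)"
    for w z l k G e e'
  proof -
    note w = pb[OF wz(1,2)] and z = pb[OF wz(3,4)]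
    note w3 = K.chosen_pullback[OF two_map_pullback[OF w]] and z3 = K.chosen_pullback[OF two_map_pullback[OF z]]
    note ty = pullbackD[OF w] pullbackD[OF z] homD[OF k(1)] homD[OF wz(5)]
    note Ty = K.pullbackD(5-10)[OF w3] K.pullbackD(5-10)[OF z3] homD[OF G(1)] homD[OF e(1)] homD[OF e'(1)]
      two_map_Cat(1-3)[OF homD(1)[OF k(1)]] two_map_Cat(1-3)[OF homD(1)[OF wz(5)]]
    note Cat_simps [simp del]
    show ?thesis
    proof (rule K.pullback_unique[OF z3])
      show "e' \<cdot>\<^bsub>Cat C\<^esub> two_map k \<in> hom (Cat C) (two (pb_ob C f w)) (pb_ob (Cat C) ?F (two_map z))"
        by (rule K.Comp_in_hom[OF two_hom[OF k(1)] e'(1)])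
      show "G \<cdot>\<^bsub>Cat C\<^esub> e \<in> hom (Cat C) (two (pb_ob C f w)) (pb_ob (Cat C) ?F (two_map z))"
        by (rule K.Comp_in_hom[OF e(1) G(1)])
      have "pb1 (Cat C) ?F (two_map z) \<cdot>\<^bsub>Cat C\<^esub> (e' \<cdot>\<^bsub>Cat C\<^esub> two_map k) = two_map (pb1 C f z) \<cdot>\<^bsub>Cat C\<^esub> two_map k"
        by (rule K.comp_eq_comp[OF e'(2)]) (simp_all add: Ty ty)
      also have "\<dots> = two_map (pb1 C f w)" using two_map_Cat(4)[of "pb1 C f z" k] k(2) ty by simp
      also have "\<dots> = pb1 (Cat C) ?F (two_map z) \<cdot>\<^bsub>Cat C\<^esub> (G \<cdot>\<^bsub>Cat C\<^esub> e)"
        unfolding e(2)[symmetric] by (rule K.comp_eq_comp[OF G(2), symmetric]) (simp_all add: Ty)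
      finally show "pb1 (Cat C) ?F (two_map z) \<cdot>\<^bsub>Cat C\<^esub> (e' \<cdot>\<^bsub>Cat C\<^esub> two_map k) =
        pb1 (Cat C) ?F (two_map z) \<cdot>\<^bsub>Cat C\<^esub> (G \<cdot>\<^bsub>Cat C\<^esub> e)" .
      have "pb2 (Cat C) ?F (two_map z) \<cdot>\<^bsub>Cat C\<^esub> (e' \<cdot>\<^bsub>Cat C\<^esub> two_map k) = two_map (pb2 C f z) \<cdot>\<^bsub>Cat C\<^esub> two_map k"
        by (rule K.comp_eq_comp[OF e'(3)]) (simp_all add: Ty ty)
      also have "\<dots> = two_map (l \<cdot> pb2 C f w)" using two_map_Cat(4)[of "pb2 C f z" k] k(3) ty by simp
      also have "\<dots> = two_map l \<cdot>\<^bsub>Cat C\<^esub> two_map (pb2 C f w)" using two_map_Cat(4)[of l "pb2 C f w"] ty by simp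
      also have "\<dots> = (two_map l \<cdot>\<^bsub>Cat C\<^esub> pb2 (Cat C) ?F (two_map w)) \<cdot>\<^bsub>Cat C\<^esub> e"
        unfolding e(3)[symmetric] by (rule K.comp_assoc[symmetric]) (use two_map_Cat(2)[OF wz(1)] in \<open>simp_all add: Ty ty\<close>)
      also have "\<dots> = pb2 (Cat C) ?F (two_map z) \<cdot>\<^bsub>Cat C\<^esub> (G \<cdot>\<^bsub>Cat C\<^esub> e)"
        by (rule K.comp_eq_comp[OF G(3), symmetric]) (simp_all add: Ty)
      finally show "pb2 (Cat C) ?F (two_map z) \<cdot>\<^bsub>Cat C\<^esub> (e' \<cdot>\<^bsub>Cat C\<^esub> two_map k) =
        pb2 (Cat C) ?F (two_map z) \<cdot>\<^bsub>Cat C\<^esub> (G \<cdot>\<^bsub>Cat C\<^esub> e)" .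
    qed
  qed
  obtain ea ea' where ea: "ea \<in> hom (Cat C) (two (pb_ob C f a)) (pb_ob (Cat C) ?F (two_map a))"
    "ea' \<in> hom (Cat C) (pb_ob (Cat C) ?F (two_map a)) (two (pb_ob C f a))"
    "ea' \<cdot>\<^bsub>Cat C\<^esub> ea = Ident (Cat C) (two (pb_ob C f a))" "ea \<cdot>\<^bsub>Cat C\<^esub> ea' = Ident (Cat C) (pb_ob (Cat C) ?F (two_map a))"
    "pb1 (Cat C) ?F (two_map a) \<cdot>\<^bsub>Cat C\<^esub> ea = two_map (pb1 C f a)"
    "pb2 (Cat C) ?F (two_map a) \<cdot>\<^bsub>Cat C\<^esub> ea = two_map (pb2 C f a)"
    by (rule K.pullback_comparison[OF A2 A3])
  obtain eb eb' where eb: "eb \<in> hom (Cat C) (two (pb_ob C f b)) (pb_ob (Cat C) ?F (two_map b))"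
    "eb' \<in> hom (Cat C) (pb_ob (Cat C) ?F (two_map b)) (two (pb_ob C f b))"
    "eb' \<cdot>\<^bsub>Cat C\<^esub> eb = Ident (Cat C) (two (pb_ob C f b))" "eb \<cdot>\<^bsub>Cat C\<^esub> eb' = Ident (Cat C) (pb_ob (Cat C) ?F (two_map b))"
    "pb1 (Cat C) ?F (two_map b) \<cdot>\<^bsub>Cat C\<^esub> eb = two_map (pb1 C f b)"
    "pb2 (Cat C) ?F (two_map b) \<cdot>\<^bsub>Cat C\<^esub> eb = two_map (pb2 C f b)"
    by (rule K.pullback_comparison[OF B2 B3])
  obtain ec ec' where ec: "ec \<in> hom (Cat C) (two (pb_ob C f c)) (pb_ob (Cat C) ?F (two_map c))"
    "ec' \<in> hom (Cat C) (pb_ob (Cat C) ?F (two_map c)) (two (pb_ob C f c))"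
    "ec' \<cdot>\<^bsub>Cat C\<^esub> ec = Ident (Cat C) (two (pb_ob C f c))" "ec \<cdot>\<^bsub>Cat C\<^esub> ec' = Ident (Cat C) (pb_ob (Cat C) ?F (two_map c))"
    "pb1 (Cat C) ?F (two_map c) \<cdot>\<^bsub>Cat C\<^esub> ec = two_map (pb1 C f c)"
    "pb2 (Cat C) ?F (two_map c) \<cdot>\<^bsub>Cat C\<^esub> ec = two_map (pb2 C f c)"
    by (rule K.pullback_comparison[OF D2 D3])
  note nu = transport[OF t(1,4,2,5,7) us(2-4) U(2-4) ea(1,5,6) eb(1,5,6)]
    and nv = transport[OF t(1,4,2,5,8) vs(2-4) V(2-4) ea(1,5,6) eb(1,5,6)]
    and nq = transport[OF t(2,5,3,6,9) qs(2-4) W(2-4) eb(1,5,6) ec(1,5,6)]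
  have quv: "qs \<cdot> us = qs \<cdot> vs"
  proof (rule pullback_unique[OF D, of _ "pb_ob C f a"])
    note ty = homD[OF us(2)] homD[OF vs(2)] homD[OF qs(2)] At Bt Dt ht
    show "pb1 C f c \<cdot> (qs \<cdot> us) = pb1 C f c \<cdot> (qs \<cdot> vs)"
      using comp_eq_comp[OF qs(3), of us] comp_eq_comp[OF qs(3), of vs] us(3) vs(3) by (simp add: ty)
    have "pb2 C f c \<cdot> (qs \<cdot> us) = q' \<cdot> (u' \<cdot> pb2 C f a)" "pb2 C f c \<cdot> (qs \<cdot> vs) = q' \<cdot> (v' \<cdot> pb2 C f a)"
      using comp_eq_comp[OF qs(4), of us] comp_eq_comp[OF qs(4), of vs] us(4) vs(4) by (simp_all add: ty)
    moreover have "q' \<cdot> (u' \<cdot> pb2 C f a) = (q' \<cdot> v') \<cdot> pb2 C f a"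
      by (rule comp_eq_comp[OF t(13)]) (simp_all add: ty)
    ultimately show "pb2 C f c \<cdot> (qs \<cdot> us) = pb2 C f c \<cdot> (qs \<cdot> vs)" by (simp add: ty)
  qed (simp_all add: hom_def homD[OF us(2)] homD[OF vs(2)] homD[OF qs(2)])
  have fdoms: "fdom (pb1 (Cat C) ?F (two_map a)) = pb_ob (Cat C) ?F (two_map a)"
    "fdom (pb1 (Cat C) ?F (two_map b)) = pb_ob (Cat C) ?F (two_map b)"
    "fdom (pb1 (Cat C) ?F (two_map c)) = pb_ob (Cat C) ?F (two_map c)"
    using A3t(7) B3t(7) D3t(7) by simp_all
  have "is_coequaliser (slice C (Dom C f)) (pb1 C f a, us, pb1 C f b) (pb1 C f a, vs, pb1 C f b) (pb1 C f b, qs, pb1 C f c)"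
    by (rule two_map_reflects_coequaliser[where \<theta>a = ea and \<theta>a' = ea' and \<theta>b = eb and \<theta>b' = eb'
        and \<theta>c = ec and \<theta>c' = ec', OF At(5) Bt(5) Dt(5) At(9) Bt(9) Dt(9) _ us(3) _ vs(3) _ qs(3) quv Q])
      (simp_all only: At(7) Bt(7) Dt(7) fdoms us(2) vs(2) qs(2) ea eb ec nu nv nq)
  then show ?thesis by (simp add: trip eq us(1) vs(1) qs(1))
qed

end

theorem proposition6p7:
  fixes E :: "('o, 'm) cat"
  assumes "category E"
    and "extensive E"
    and "has_pullbacks E"
    and "has_terminal E"
    and "Cat_has_coequalisers_agreeing_on_objects E"
    and "Cat_coequalisers_stable_along_discrete_conduche E"
  shows "pullback_stable_coequalisers E"
proof -
  interpret extensive_category E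
    using assms(1-4) by (simp add: extensive_category_def extensive_category_axioms_def)
  have "\<exists>q. is_coequaliser E f g q" if "parallel E f g" for f g
  proof -
    have fg: "f \<in> Arr E" "g \<in> Arr E" "Dom E f = Dom E g" "Cod E f = Cod E g"
      using that by (auto simp: parallel_def)
    \<comment> \<open>Both functors have the identity of \<open>ob2\<close> as object part, so the
      existence hypothesis covers this pair.\<close>
    have "parallel (Cat E) (two_map f) (two_map g) \<and> agree_on_objects (two_map f) (two_map g)"
      using fg two_map_functor by (simp add: parallel_def agree_on_objects_def)
    then obtain Q where "is_2coequaliser (Cat E) (two_map f) (two_map g) Q"
      using assms(5) unfolding Cat_has_coequalisers_agreeing_on_objects_def by blast
    then show ?thesis by (rule coequaliser_of_2coequaliser[OF that])
  qed
  then show ?thesis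
    using coequaliser_pullback[OF _ assms(6)]
    unfolding pullback_stable_coequalisers_def has_coequalisers_def preserves_coequalisers_def by blast
qed

end
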